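(* Let $S$ be a nonempty index set, let $K$ be a commutative ring, and let $T=K[x_i: i\in S]$ be the polynomial ring over $K$ in the variables $x_i$. Let $I=(x_ix_k: i,k\in S,\ i\neq k)$ and, for each $k\in S$, let $I_k=(x_i: i\in S,\ i\neq k)$, as ideals of $T$. Then the following assertions hold. (i) $I=\bigcap_{k\in S}I_k$. In particular, $K$ is reduced if and only if $T/I$ is reduced. (ii) $K$ is an integral domain if and only if $\operatorname{Min}(I)=\{I_k: k\in S\}$. (iii) If $K$ is a Noetherian domain, then $\dim(T/I)=\dim(K)+1$. (iv) If $S$ is infinite and $K$ is a field, then $R:=(T/I)_{\mathfrak{m}}$ is a reduced local P.Z. ring with $\dim(R)=1$ and infinitely many minimal primes, where $\mathfrak{m}=(x_i: i\in S)$.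
   Context: All rings are commutative. $\operatorname{Min}(I)$ denotes the set of prime ideals of $T$ minimal over $I$, and $\dim$ denotes Krull dimension. In (iv), $(T/I)_{\mathfrak{m}}$ is the localization of $T/I$ at the prime ideal $\mathfrak{m}/I$. A local ring is a ring with a unique maximal ideal (not assumed Noetherian). A P.Z. (properly zipped) ring is a ring $R$ satisfying infinite prime absorbance: if a prime ideal $\mathfrak{p}$ of $R$ contains the intersection of a family $(\mathfrak{p}_i)$ of prime ideals of $R$, then $\mathfrak{p}_k\subseteq\mathfrak{p}$ for some $k$. *)

theory Defs
  imports "HOL-Algebra.Algebra" "HOL-Library.Extended_Nat"
begin

text \<open>
  The polynomial ring K[x_i : i in S]. As in \<^theory>\<open>HOL-Algebra.Indexed_Polynomials\<close>, monomials
  are finite multisets of indices and a polynomial maps monomials to coefficients; that theory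
  provides the carrier, constants, variables and addition, but no product of polynomials.
\<close>

definition mpoly_mult ::
    "('a, 'm) ring_scheme \<Rightarrow> ('i multiset \<Rightarrow> 'a) \<Rightarrow> ('i multiset \<Rightarrow> 'a) \<Rightarrow> ('i multiset \<Rightarrow> 'a)"
  where "mpoly_mult K P Q = (\<lambda>m. \<Oplus>\<^bsub>K\<^esub>k\<in>{k. k \<subseteq># m}. P k \<otimes>\<^bsub>K\<^esub> Q (m - k))"

definition mpoly_ring :: "('a, 'm) ring_scheme \<Rightarrow> 'i set \<Rightarrow> ('i multiset \<Rightarrow> 'a) ring"
  where "mpoly_ring K S =
    \<lparr>carrier = ring.indexed_pset K S (carrier K),
     monoid.mult = mpoly_mult K,
     monoid.one = ring.indexed_const K \<one>\<^bsub>K\<^esub>,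
     ring.zero = ring.indexed_const K \<zero>\<^bsub>K\<^esub>,
     ring.add = ring.indexed_padd K\<rparr>"

definition reduced_ring :: "('a, 'm) ring_scheme \<Rightarrow> bool"
  where "reduced_ring R \<longleftrightarrow>
    cring R \<and> (\<forall>x\<in>carrier R. \<forall>n::nat. x [^]\<^bsub>R\<^esub> n = \<zero>\<^bsub>R\<^esub> \<longrightarrow> x = \<zero>\<^bsub>R\<^esub>)"

definition minimal_primes :: "('a, 'm) ring_scheme \<Rightarrow> 'a set \<Rightarrow> 'a set set"
  where "minimal_primes R I =
    {P. primeideal P R \<and> I \<subseteq> P \<and> (\<forall>Q. primeideal Q R \<and> I \<subseteq> Q \<and> Q \<subseteq> P \<longrightarrow> Q = P)}"

text \<open>
  Krull dimension: the supremum of the lengths n of chains of prime ideals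
  P 0 < P 1 < ... < P n. The zero ring, having no prime ideals, is assigned 0 here
  (the supremum of the empty set in \<^typ>\<open>enat\<close>).
\<close>

definition krull_dim :: "('a, 'm) ring_scheme \<Rightarrow> enat"
  where "krull_dim R =
    Sup {enat n | n. \<exists>P. (\<forall>i\<le>n. primeideal (P i) R) \<and> (\<forall>i<n. P i \<subset> P (Suc i))}"

definition local_ring :: "('a, 'm) ring_scheme \<Rightarrow> bool"
  where "local_ring R \<longleftrightarrow> cring R \<and> (\<exists>!M. maximalideal M R)"

text \<open>
  Properly zipped rings. The intersection of a family is taken inside the carrier, so the empty
  family has intersection the whole ring, which no prime ideal contains.
\<close>

definition pz_ring :: "('a, 'm) ring_scheme \<Rightarrow> bool"
  where "pz_ring R \<longleftrightarrow> cring R \<and>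
    (\<forall>P F. primeideal P R \<and> (\<forall>Q\<in>F. primeideal Q R) \<and> carrier R \<inter> \<Inter>F \<subseteq> P \<longrightarrow> (\<exists>Q\<in>F. Q \<subseteq> P))"

text \<open>
  Localization of a commutative ring at a multiplicative subset: fractions r/s are classes of
  pairs (r, s), where r/s = r'/s' iff t (r s' - r' s) = 0 for some t in the subset.
\<close>

definition frac_rel :: "('a, 'm) ring_scheme \<Rightarrow> 'a set \<Rightarrow> (('a \<times> 'a) \<times> ('a \<times> 'a)) set"
  where "frac_rel R M =
    {((r, s), (r', s')) | r s r' s'. r \<in> carrier R \<and> s \<in> M \<and> r' \<in> carrier R \<and> s' \<in> M \<and>
       (\<exists>t\<in>M. t \<otimes>\<^bsub>R\<^esub> ((r \<otimes>\<^bsub>R\<^esub> s') \<ominus>\<^bsub>R\<^esub> (r' \<otimes>\<^bsub>R\<^esub> s)) = \<zero>\<^bsub>R\<^esub>)}"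

definition localization :: "('a, 'm) ring_scheme \<Rightarrow> 'a set \<Rightarrow> ('a \<times> 'a) set ring"
  where "localization R M =
    \<lparr>carrier = (carrier R \<times> M) // frac_rel R M,
     monoid.mult = (\<lambda>A B. \<Union>(a, s)\<in>A. \<Union>(b, t)\<in>B. frac_rel R M `` {(a \<otimes>\<^bsub>R\<^esub> b, s \<otimes>\<^bsub>R\<^esub> t)}),
     monoid.one = frac_rel R M `` {(\<one>\<^bsub>R\<^esub>, \<one>\<^bsub>R\<^esub>)},
     ring.zero = frac_rel R M `` {(\<zero>\<^bsub>R\<^esub>, \<one>\<^bsub>R\<^esub>)},
     ring.add = (\<lambda>A B. \<Union>(a, s)\<in>A. \<Union>(b, t)\<in>B.
        frac_rel R M `` {((a \<otimes>\<^bsub>R\<^esub> t) \<oplus>\<^bsub>R\<^esub> (b \<otimes>\<^bsub>R\<^esub> s), s \<otimes>\<^bsub>R\<^esub> t)})\<rparr>"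

definition localization_at :: "('a, 'm) ring_scheme \<Rightarrow> 'a set \<Rightarrow> ('a \<times> 'a) set ring"
  where "localization_at R P = localization R (carrier R - P)"

definition quot_ideal :: "('a, 'm) ring_scheme \<Rightarrow> 'a set \<Rightarrow> 'a set \<Rightarrow> 'a set set"
  where "quot_ideal R I J = (\<lambda>a. I +>\<^bsub>R\<^esub> a) ` J"

end

theory Submission
  imports Defs
begin

text \<open>
  \<open>I\<close> consists of the polynomials vanishing on all monomials that are powers of a single variable,
  and \<open>I\<^sub>k\<close> is the kernel of the surjection \<open>T \<rightarrow> K[x\<^sub>k]\<close> killing the other variables. A prime
  containing \<open>I\<close> misses at most one variable, so it contains some \<open>I\<^sub>k\<close>; hence chains of primes of
  \<open>T/I\<close> are chains of primes of \<open>K[x]\<close>, and over a field the primes between \<open>I\<close> and \<open>(x\<^sub>i)\<close> are the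
  \<open>I\<^sub>k\<close> and \<open>(x\<^sub>i)\<close> itself.

  For \<open>dim K[x] = dim K + 1\<close> over a Noetherian ring, the point is that no prime \<open>Q\<close> of \<open>K[x]\<close> lies
  strictly between \<open>qK[x]\<close> and \<open>pK[x]\<close> if \<open>q \<subset> p\<close> are adjacent primes of \<open>K\<close>. The domain
  \<open>D = K[x]/Q\<close> would be algebraic over \<open>K/q\<close>. As in the Krull--Akizuki theorem, for \<open>a \<in> p - q\<close> the
  module \<open>D/aD\<close> is, after localizing at \<open>p\<close>, generated by finitely many powers of \<open>x\<close>; this contradicts
  \<open>Q \<subseteq> pK[x]\<close>, because the powers of \<open>x\<close> are linearly independent modulo \<open>pK[x]\<close>.
\<close>

section \<open>Modules generated by powers of an element\<close>

text \<open>Contraction to \<open>K\<close> may send two members of a chain of primes of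
  \<open>K[x]\<close> to the same prime, and this alone only bounds \<open>dim K[x]\<close> by
  \<open>2 dim K + 1\<close>. What saves the count is that losses do not accumulate: if a chain
  steps from a prime over \<open>q\<close> other than \<open>qK[x]\<close> to an extended prime
  \<open>pK[x]\<close>, the statement on adjacent primes provides a prime of \<open>K\<close>
  strictly between \<open>q\<close> and \<open>p\<close>, which pays back the lost step. Hence at
  most one step is lost in all. The module argument takes place inside \<open>D\<close>; the local
  ring \<open>K_p\<close> and the quotient \<open>D/aD\<close> are never formed. Ideals of
  \<open>K_p\<close> are represented by ideals of \<open>K\<close> that are closed under cancelling
  factors outside \<open>p\<close>, and finite length by stabilising chains. Since the powers of
  \<open>x\<close> satisfy relations in \<open>D\<close>, an element there has no well-defined
  degree or leading coefficient; submodules are therefore compared through the coefficients that can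
  occur at \<open>x^i\<close> after terms of lower degree.\<close>

definition submod :: "('a, 'm) ring_scheme \<Rightarrow> 'a set \<Rightarrow> 'a set \<Rightarrow> bool"
  where "submod D K U \<longleftrightarrow> U \<subseteq> carrier D \<and> \<zero>\<^bsub>D\<^esub> \<in> U \<and>
    (\<forall>u\<in>U. \<forall>v\<in>U. u \<oplus>\<^bsub>D\<^esub> v \<in> U) \<and> (\<forall>k\<in>K. \<forall>u\<in>U. k \<otimes>\<^bsub>D\<^esub> u \<in> U)"

text \<open>The index bounds the degree strictly: \<open>span_pow D K x n\<close> is generated over
  \<open>K\<close> by the \<open>n\<close> powers \<open>x^0, ..., x^(n-1)\<close>.\<close>

fun span_pow :: "('a, 'm) ring_scheme \<Rightarrow> 'a set \<Rightarrow> 'a \<Rightarrow> nat \<Rightarrow> 'a set"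
  where "span_pow D K x 0 = {\<zero>\<^bsub>D\<^esub>}"
  | "span_pow D K x (Suc n) = {g \<oplus>\<^bsub>D\<^esub> k \<otimes>\<^bsub>D\<^esub> x [^]\<^bsub>D\<^esub> n | g k. g \<in> span_pow D K x n \<and> k \<in> K}"

lemma submodI:
  assumes "U \<subseteq> carrier D" "\<zero>\<^bsub>D\<^esub> \<in> U"
    and "\<And>u v. u \<in> U \<Longrightarrow> v \<in> U \<Longrightarrow> u \<oplus>\<^bsub>D\<^esub> v \<in> U"
    and "\<And>k u. k \<in> K \<Longrightarrow> u \<in> U \<Longrightarrow> k \<otimes>\<^bsub>D\<^esub> u \<in> U"
  shows "submod D K U"
  using assms unfolding submod_def by blast

lemma submodD:
  assumes "submod D K U"
  shows "U \<subseteq> carrier D" "\<zero>\<^bsub>D\<^esub> \<in> U"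
    and "\<And>u v. u \<in> U \<Longrightarrow> v \<in> U \<Longrightarrow> u \<oplus>\<^bsub>D\<^esub> v \<in> U"
    and "\<And>k u. k \<in> K \<Longrightarrow> u \<in> U \<Longrightarrow> k \<otimes>\<^bsub>D\<^esub> u \<in> U"
  using assms unfolding submod_def by blast+

lemma submod_Int: "submod D K U \<Longrightarrow> submod D K V \<Longrightarrow> submod D K (U \<inter> V)"
  unfolding submod_def by blast

text \<open>Closure under negation, which \<open>submod\<close> does not ask for, comes from
  multiplication by \<open>\<ominus> \<one>\<close>.\<close>

lemma (in cring) ideal_if_submod:
  assumes "submod R (carrier R) I"
  shows "ideal I R"
proof (rule idealI[OF ring_axioms])
  note I = submodD[OF assms]
  show "subgroup I (add_monoid R)"
  proof
    show "inv\<^bsub>add_monoid R\<^esub> a \<in> I" if "a \<in> I" for a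
    proof -
      have "(\<ominus> \<one>) \<otimes> a \<in> I" by (rule I(4)) (use that in simp_all)
      then show ?thesis using subsetD[OF I(1) that] unfolding a_inv_def[symmetric] by (simp add: l_minus)
    qed
  qed (use I in auto)
  fix a r assume a: "a \<in> I" and r: "r \<in> carrier R"
  show "r \<otimes> a \<in> I" by (rule I(4)[OF r a])
  then show "a \<otimes> r \<in> I" using r subsetD[OF I(1) a] by (simp add: m_comm)
qed

text \<open>Nothing makes the powers of \<open>x\<close> independent over \<open>K\<close>: the
  locale serves the polynomial ring itself as well as its quotients by primes.\<close>

locale power_basis = cring D for D (structure) + fixes K x
  assumes subring: "subring K D" and x_closed [simp]: "x \<in> carrier D"
begin

abbreviation "G \<equiv> span_pow D K x"

lemma K_closed [simp]: "k \<in> K \<Longrightarrow> k \<in> carrier D"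
  using subringE(1)[OF subring] by blast

lemma K_ops [simp]: "\<zero> \<in> K" "\<one> \<in> K" "k \<in> K \<Longrightarrow> \<ominus> k \<in> K"
  "k \<in> K \<Longrightarrow> l \<in> K \<Longrightarrow> k \<otimes> l \<in> K" "k \<in> K \<Longrightarrow> l \<in> K \<Longrightarrow> k \<oplus> l \<in> K"
  using subringE[OF subring] by auto

lemma K_minus [simp]: "k \<in> K \<Longrightarrow> l \<in> K \<Longrightarrow> k \<ominus> l \<in> K"
  by (simp add: a_minus_def)

lemma K_submod: "submod D K K"
  by (rule submodI) auto

lemma K_pow [simp]: "k \<in> K \<Longrightarrow> k [^] (n::nat) \<in> K"
  by (induction n) auto

lemma submod_minus:
  assumes "submod D K U" "u \<in> U" "v \<in> U"
  shows "u \<ominus> v \<in> U"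
proof -
  have c: "u \<in> carrier D" "v \<in> carrier D" using assms submodD(1) by blast+
  have "u \<oplus> (\<ominus> \<one>) \<otimes> v \<in> U" using assms submodD by (metis K_ops(2,3))
  moreover have "u \<oplus> (\<ominus> \<one>) \<otimes> v = u \<ominus> v" using c by algebra
  ultimately show ?thesis by simp
qed

lemma carrier_submod: "submod D K (carrier D)"
  by (rule submodI) auto

definition "sum_set U V = {u \<oplus> v | u v. u \<in> U \<and> v \<in> V}"

lemma sum_set_submod:
  assumes U: "submod D K U" and V: "submod D K V"
  shows "submod D K (sum_set U V)" "U \<subseteq> sum_set U V" "V \<subseteq> sum_set U V"
proof -
  note UD = submodD[OF U] and VD = submodD[OF V]
  show sub: "U \<subseteq> sum_set U V"
  proof
    fix u assume "u \<in> U"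
    then have "u = u \<oplus> \<zero>" using UD(1) by auto
    then show "u \<in> sum_set U V" unfolding sum_set_def using \<open>u \<in> U\<close> VD(2) by blast
  qed
  show "V \<subseteq> sum_set U V"
  proof
    fix v assume "v \<in> V"
    then have "v = \<zero> \<oplus> v" using VD(1) by auto
    then show "v \<in> sum_set U V" unfolding sum_set_def using \<open>v \<in> V\<close> UD(2) by blast
  qed
  show "submod D K (sum_set U V)"
  proof (rule submodI)
    show "sum_set U V \<subseteq> carrier D" unfolding sum_set_def using UD(1) VD(1) by auto
    show "\<zero> \<in> sum_set U V" using sub UD(2) by blast
    fix w w' assume "w \<in> sum_set U V" "w' \<in> sum_set U V"
    then obtain u v u' v' where *: "w = u \<oplus> v" "w' = u' \<oplus> v'" "u \<in> U" "v \<in> V" "u' \<in> U" "v' \<in> V"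
      unfolding sum_set_def by blast
    have "w \<oplus> w' = (u \<oplus> u') \<oplus> (v \<oplus> v')"
      unfolding * using *(3,5)[THEN subsetD[OF UD(1)]] *(4,6)[THEN subsetD[OF VD(1)]] by algebra
    then show "w \<oplus> w' \<in> sum_set U V" unfolding sum_set_def using * UD(3) VD(3) by blast
  next
    fix k w assume k: "k \<in> K" and "w \<in> sum_set U V"
    then obtain u v where *: "w = u \<oplus> v" "u \<in> U" "v \<in> V" unfolding sum_set_def by blast
    have "k \<otimes> w = k \<otimes> u \<oplus> k \<otimes> v"
      unfolding * using *(2)[THEN subsetD[OF UD(1)]] *(3)[THEN subsetD[OF VD(1)]] k[THEN K_closed] by algebra
    then show "k \<otimes> w \<in> sum_set U V" unfolding sum_set_def using * k UD(4) VD(4) by blast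
  qed
qed

lemma image_mult_submod:
  assumes U: "submod D K U" and a: "a \<in> carrier D"
  shows "submod D K ((\<otimes>) a ` U)"
proof (rule submodI)
  note UD = submodD[OF U]
  show "(\<otimes>) a ` U \<subseteq> carrier D" using UD(1) a by auto
  show "\<zero> \<in> (\<otimes>) a ` U" using UD(2) a by (intro image_eqI[of _ _ \<zero>]) simp_all
  show "w \<oplus> w' \<in> (\<otimes>) a ` U" if w: "w \<in> (\<otimes>) a ` U" "w' \<in> (\<otimes>) a ` U" for w w'
  proof -
    from w obtain u v where *: "w = a \<otimes> u" "w' = a \<otimes> v" "u \<in> U" "v \<in> U" by blast
    then have "w \<oplus> w' = a \<otimes> (u \<oplus> v)" using a UD(1) by (simp add: r_distr subset_iff)
    then show ?thesis using UD(3)[OF *(3,4)] by blast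
  qed
  show "k \<otimes> w \<in> (\<otimes>) a ` U" if kw: "k \<in> K" "w \<in> (\<otimes>) a ` U" for k w
  proof -
    from kw obtain u where *: "w = a \<otimes> u" "u \<in> U" by blast
    then have "k \<otimes> w = a \<otimes> (k \<otimes> u)" using a UD(1) kw(1)[THEN K_closed] by (simp add: m_lcomm subset_iff)
    then show ?thesis using UD(4)[OF kw(1) *(2)] by blast
  qed
qed

lemma span_pow_SucI: "g \<in> G n \<Longrightarrow> k \<in> K \<Longrightarrow> g \<oplus> k \<otimes> x [^] n \<in> G (Suc n)"
  by auto

lemma span_pow_submod: "submod D K (G n)"
proof (induction n)
  case 0 then show ?case by (auto intro!: submodI)
next
  case (Suc n)
  note IH = submodD[OF Suc]
  show ?case
  proof (rule submodI)
    show "G (Suc n) \<subseteq> carrier D" using IH(1) by auto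
    show "\<zero> \<in> G (Suc n)" using span_pow_SucI[OF IH(2) K_ops(1)] by simp
  next
    fix u v assume "u \<in> G (Suc n)" "v \<in> G (Suc n)"
    then obtain g k g' k' where *: "u = g \<oplus> k \<otimes> x [^] n" "v = g' \<oplus> k' \<otimes> x [^] n"
      "g \<in> G n" "k \<in> K" "g' \<in> G n" "k' \<in> K" by auto
    have "g \<in> carrier D" "g' \<in> carrier D" "x [^] n \<in> carrier D" using * IH(1) by auto
    then have "u \<oplus> v = (g \<oplus> g') \<oplus> (k \<oplus> k') \<otimes> x [^] n"
      unfolding * using *(4,6)[THEN K_closed] by algebra
    then show "u \<oplus> v \<in> G (Suc n)"
      using span_pow_SucI[OF IH(3)[OF *(3,5)] K_ops(5)[OF *(4,6)]] by metis
  next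
    fix l u assume l: "l \<in> K" and "u \<in> G (Suc n)"
    then obtain g k where *: "u = g \<oplus> k \<otimes> x [^] n" "g \<in> G n" "k \<in> K" by auto
    have "g \<in> carrier D" "x [^] n \<in> carrier D" using * IH(1) by auto
    then have "l \<otimes> u = l \<otimes> g \<oplus> (l \<otimes> k) \<otimes> x [^] n"
      unfolding * using *(3)[THEN K_closed] l[THEN K_closed] by algebra
    then show "l \<otimes> u \<in> G (Suc n)"
      using span_pow_SucI[OF IH(4)[OF l *(2)] K_ops(4)[OF l *(3)]] by metis
  qed
qed

lemmas span_pow_closed = submodD(1)[OF span_pow_submod]

lemma span_pow_Suc: "g \<in> G n \<Longrightarrow> g \<in> G (Suc n)"
  using span_pow_SucI[of g n \<zero>] subsetD[OF span_pow_closed[of n], of g] by simp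

lemma span_pow_mono: "m \<le> n \<Longrightarrow> G m \<subseteq> G n"
  by (rule lift_Suc_mono_le[of G]) (use span_pow_Suc in blast)+

lemma pow_in_span_pow: "k \<in> K \<Longrightarrow> n < m \<Longrightarrow> k \<otimes> x [^] n \<in> G m"
proof -
  assume k: "k \<in> K" and "n < m"
  have "k \<otimes> x [^] n \<in> G (Suc n)"
    using span_pow_SucI[OF submodD(2)[OF span_pow_submod[of n]] k] k by simp
  then show ?thesis using span_pow_mono[of "Suc n" m] \<open>n < m\<close> by auto
qed

lemma pow_span_pow: "g \<in> G n \<Longrightarrow> x [^] m \<otimes> g \<in> G (m + n)"
proof (induction n arbitrary: g)
  case 0
  then show ?case using submodD(2)[OF span_pow_submod[of m]] by simp
next
  case (Suc n)
  then obtain h k where *: "g = h \<oplus> k \<otimes> x [^] n" "h \<in> G n" "k \<in> K" by auto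
  then have "h \<in> carrier D" "x [^] n \<in> carrier D" "x [^] m \<in> carrier D" using span_pow_closed by auto
  then have "x [^] m \<otimes> g = x [^] m \<otimes> h \<oplus> k \<otimes> (x [^] m \<otimes> x [^] n)"
    unfolding * using *(3)[THEN K_closed] by algebra
  also have "\<dots> = x [^] m \<otimes> h \<oplus> k \<otimes> x [^] (m + n)" by (simp add: nat_pow_mult)
  finally show ?case using Suc.IH[OF *(2)] *(3) by auto
qed

text \<open>The leading coefficient \<open>c\<close> need not be invertible, so each reduction step
  costs one factor \<open>c\<close>. Only the chosen expressions of \<open>f\<close> and
  \<open>g\<close> enter, so relations between the powers of \<open>x\<close> do no harm. The
  difference \<open>n - d\<close> is truncated: for \<open>n \<le> d\<close> the quotient
  \<open>u\<close> is zero.\<close>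

lemma pseudo_division:
  assumes f: "f = f0 \<oplus> c \<otimes> x [^] d" "f0 \<in> G d" "c \<in> K" and g: "g \<in> G n"
  obtains k u r where "u \<in> G (n - d)" "r \<in> G d" "c [^] (k::nat) \<otimes> g = u \<otimes> f \<oplus> r"
  using g
proof (induction n arbitrary: g thesis)
  case 0
  then have g: "g = \<zero>" by simp
  have "f0 \<in> carrier D" using f span_pow_closed by blast
  then have "c [^] (0::nat) \<otimes> g = \<zero> \<otimes> f \<oplus> \<zero>" using f unfolding g by simp
  then show ?case using "0.prems"(1)[of \<zero> \<zero> 0] submodD(2)[OF span_pow_submod] by simp
next
  case (Suc n)
  have cl: "f0 \<in> carrier D" "f \<in> carrier D" "c \<in> carrier D"
    using f span_pow_closed[of d] by auto
  show ?case
  proof (cases "Suc n \<le> d")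
    case True
    then have "g \<in> G d" using Suc.prems(2) span_pow_mono[of "Suc n" d] by blast
    moreover have "c [^] (0::nat) \<otimes> g = \<zero> \<otimes> f \<oplus> g"
      using cl subsetD[OF span_pow_closed \<open>g \<in> G d\<close>] by simp
    ultimately show ?thesis using Suc.prems(1)[of \<zero> g 0] submodD(2)[OF span_pow_submod] by simp
  next
    case False
    then obtain e where n: "n = e + d" using nat_le_iff_add by (metis add.commute not_less_eq_eq)
    from Suc.prems(2) obtain g1 b where g: "g = g1 \<oplus> b \<otimes> x [^] n" "g1 \<in> G n" "b \<in> K" by auto
    have cl2: "g1 \<in> carrier D" "b \<in> carrier D" "x [^] e \<in> carrier D" "x [^] d \<in> carrier D" "g \<in> carrier D"
      using g span_pow_closed[of n] by auto
    \<comment> \<open>This is \<open>c g - b x^e f\<close>, in which the terms at \<open>x^n\<close>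
      have cancelled.\<close>
    let ?g = "c \<otimes> g1 \<ominus> b \<otimes> (x [^] e \<otimes> f0)"
    have eq: "c \<otimes> g = (b \<otimes> x [^] e) \<otimes> f \<oplus> ?g"
      unfolding g f n nat_pow_mult[OF x_closed, symmetric] using cl cl2 by algebra
    have "b \<otimes> (x [^] e \<otimes> f0) \<in> G n"
      using pow_span_pow[OF f(2), of e] g(3) submodD(4)[OF span_pow_submod] n by simp
    then have "?g \<in> G n" using g f submodD(4)[OF span_pow_submod] submod_minus[OF span_pow_submod] by blast
    from Suc.IH[OF _ this] obtain u r k where IH: "u \<in> G (n - d)" "r \<in> G d"
      "c [^] (k::nat) \<otimes> ?g = u \<otimes> f \<oplus> r" by blast
    have cl3: "u \<in> carrier D" "r \<in> carrier D" "c [^] k \<in> carrier D" "?g \<in> carrier D"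
      using IH \<open>?g \<in> G n\<close> span_pow_closed cl by (auto simp del: span_pow.simps)
    have "c [^] Suc k \<otimes> g = c [^] k \<otimes> (c \<otimes> g)" using cl cl2 by (simp add: m_assoc)
    also have "\<dots> = c [^] k \<otimes> ((b \<otimes> x [^] e) \<otimes> f) \<oplus> c [^] k \<otimes> ?g"
      unfolding eq using cl cl2 cl3 by (simp add: r_distr)
    also have "\<dots> = (u \<oplus> (c [^] k \<otimes> b) \<otimes> x [^] e) \<otimes> f \<oplus> r"
      unfolding IH using cl(2) cl2(2,3) cl3(1-3) by algebra
    finally have "c [^] Suc k \<otimes> g = (u \<oplus> (c [^] k \<otimes> b) \<otimes> x [^] e) \<otimes> f \<oplus> r" .
    moreover have "u \<oplus> (c [^] k \<otimes> b) \<otimes> x [^] e \<in> G (Suc n - d)"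
    proof -
      have "Suc n - d = Suc e" "n - d = e" using n by auto
      then show ?thesis using IH(1) g(3) f(3) span_pow_SucI[of u e "c [^] k \<otimes> b"] by simp
    qed
    ultimately show ?thesis using Suc.prems(1) IH(2) by blast
  qed
qed

text \<open>The relation \<open>c x^d \<in> G d\<close> presents zero as a polynomial expression of
  degree \<open>d\<close> with leading coefficient \<open>c\<close>. Pseudo-division by it leaves
  only a remainder.\<close>

lemma algebraic_span_pow:
  assumes c: "c \<in> K" "c \<noteq> \<zero>" "c \<otimes> x [^] d \<in> G d" and g: "g \<in> G n"
    and int: "\<And>a b. a \<in> K \<Longrightarrow> b \<in> K \<Longrightarrow> a \<otimes> b = \<zero> \<Longrightarrow> a = \<zero> \<or> b = \<zero>"
  shows "\<exists>k\<in>K. k \<noteq> \<zero> \<and> k \<otimes> g \<in> G d"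
proof -
  let ?f0 = "(\<ominus> \<one>) \<otimes> (c \<otimes> x [^] d)"
  have f0: "?f0 \<in> G d" using submodD(4)[OF span_pow_submod _ c(3)] by simp
  have "c \<in> carrier D" "x [^] d \<in> carrier D" using c by auto
  then have "\<zero> = ?f0 \<oplus> c \<otimes> x [^] d" by algebra
  then obtain k u r where *: "u \<in> G (n - d)" "r \<in> G d" "c [^] (k::nat) \<otimes> g = u \<otimes> \<zero> \<oplus> r"
    using pseudo_division[OF _ f0 c(1) g] by metis
  have "r \<in> carrier D" "u \<in> carrier D" using * span_pow_closed by blast+
  with * have "c [^] k \<otimes> g \<in> G d" by simp
  moreover have "c [^] k \<noteq> \<zero>"
  proof (induction k)
    case 0
    show ?case
    proof
      assume "c [^] (0::nat) = \<zero>"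
      then have "\<one> = \<zero>" by simp
      then have "c = \<zero>" using c(1) K_closed by (metis l_null l_one)
      then show False using c by simp
    qed
  next
    case (Suc k)
    then show ?case using int[of "c [^] k" c] c by auto
  qed
  ultimately show ?thesis using c(1) K_pow by blast
qed

text \<open>Leading coefficient ideals as in Hilbert's basis theorem. An element may have several
  expressions in the powers of \<open>x\<close>; \<open>c\<close> counts as soon as one of them ends
  in \<open>c x^i\<close>.\<close>

definition lead :: "nat \<Rightarrow> 'a set \<Rightarrow> 'a set"
  where "lead i U = {c \<in> K. \<exists>h\<in>G i. h \<oplus> c \<otimes> x [^] i \<in> U}"

lemma lead_submod:
  assumes "submod D K U"
  shows "submod D K (lead i U)"
proof (rule submodI)
  show "lead i U \<subseteq> carrier D" unfolding lead_def by auto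
  have "\<zero> \<oplus> \<zero> \<otimes> x [^] i \<in> U" using submodD(2)[OF assms] by simp
  then show "\<zero> \<in> lead i U" unfolding lead_def using submodD(2)[OF span_pow_submod[of i]] K_ops(1) by blast
next
  fix u v assume "u \<in> lead i U" "v \<in> lead i U"
  then obtain g h where *: "u \<in> K" "v \<in> K" "g \<in> G i" "h \<in> G i" "g \<oplus> u \<otimes> x [^] i \<in> U" "h \<oplus> v \<otimes> x [^] i \<in> U"
    unfolding lead_def by auto
  have "(g \<oplus> h) \<oplus> (u \<oplus> v) \<otimes> x [^] i = (g \<oplus> u \<otimes> x [^] i) \<oplus> (h \<oplus> v \<otimes> x [^] i)"
    using *(1,2)[THEN K_closed] *(3,4)[THEN subsetD[OF span_pow_closed]] nat_pow_closed[OF x_closed, of i] by algebra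
  moreover have "g \<oplus> h \<in> G i" using * submodD(3)[OF span_pow_submod] by blast
  ultimately show "u \<oplus> v \<in> lead i U" unfolding lead_def using * submodD(3)[OF assms] K_ops(5)
    by (auto intro!: bexI[of _ "g \<oplus> h"])
next
  fix k u assume k: "k \<in> K" and "u \<in> lead i U"
  then obtain g where *: "u \<in> K" "g \<in> G i" "g \<oplus> u \<otimes> x [^] i \<in> U"
    unfolding lead_def by auto
  have "(k \<otimes> g) \<oplus> (k \<otimes> u) \<otimes> x [^] i = k \<otimes> (g \<oplus> u \<otimes> x [^] i)"
    using k[THEN K_closed] *(1)[THEN K_closed] *(2)[THEN subsetD[OF span_pow_closed]] nat_pow_closed[OF x_closed, of i] by algebra
  moreover have "k \<otimes> g \<in> G i" using * k submodD(4)[OF span_pow_submod] by blast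
  ultimately show "k \<otimes> u \<in> lead i U" unfolding lead_def using * k submodD(4)[OF assms] K_ops(4)
    by (auto intro!: bexI[of _ "k \<otimes> g"])
qed

lemma lead_mono: "U \<subseteq> V \<Longrightarrow> lead i U \<subseteq> lead i V"
  unfolding lead_def by blast

text \<open>Applied with \<open>M = {1}\<close> to ascending chains, and with the complement of a prime to
  descending ones.\<close>

lemma eq_if_lead_eq:
  assumes U: "submod D K U" and V: "submod D K V" and UV: "U \<subseteq> V"
    and M: "M \<subseteq> K" and sat: "\<And>s h. s \<in> M \<Longrightarrow> h \<in> G d \<Longrightarrow> s \<otimes> h \<in> U \<Longrightarrow> h \<in> U"
    and lead: "\<And>i c. i < d \<Longrightarrow> c \<in> lead i V \<Longrightarrow> \<exists>s\<in>M. s \<otimes> c \<in> lead i U"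
    and h: "h \<in> V" "h \<in> G d"
  shows "h \<in> U"
proof -
  have "\<And>h. i \<le> d \<Longrightarrow> h \<in> V \<Longrightarrow> h \<in> G i \<Longrightarrow> h \<in> U" for i
  proof (induction i)
    case 0
    then show ?case using submodD(2)[OF U] by simp
  next
    case (Suc i)
    then obtain g c where *: "h = g \<oplus> c \<otimes> x [^] i" "g \<in> G i" "c \<in> K" by auto
    then have "c \<in> lead i V" unfolding lead_def using Suc.prems by auto
    then obtain s where s: "s \<in> M" "s \<otimes> c \<in> lead i U" using lead Suc.prems(1) by (meson Suc_le_lessD)
    then obtain g' where g': "g' \<in> G i" "g' \<oplus> (s \<otimes> c) \<otimes> x [^] i \<in> U" unfolding lead_def by auto
    \<comment> \<open>An element of \<open>U\<close> with the same leading term as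
      \<open>s \<otimes> h\<close>. The difference has lower degree and stays in \<open>V\<close>,
      so the induction hypothesis applies to it.\<close>
    let ?h = "g' \<oplus> (s \<otimes> c) \<otimes> x [^] i"
    have sK: "s \<in> K" using s M by blast
    have eq: "s \<otimes> h \<ominus> ?h = s \<otimes> g \<ominus> g'"
      unfolding * using *(3)[THEN K_closed] sK[THEN K_closed] *(2)[THEN subsetD[OF span_pow_closed]]
        g'(1)[THEN subsetD[OF span_pow_closed]] nat_pow_closed[OF x_closed, of i] by algebra
    have "s \<otimes> h \<ominus> ?h \<in> V"
      using submod_minus[OF V] submodD(4)[OF V sK Suc.prems(2)] g'(2) UV by blast
    moreover have "s \<otimes> h \<ominus> ?h \<in> G i"
      unfolding eq using submod_minus[OF span_pow_submod] submodD(4)[OF span_pow_submod sK *(2)] g'(1) by blast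
    ultimately have "s \<otimes> h \<ominus> ?h \<in> U" using Suc by auto
    then have "(s \<otimes> h \<ominus> ?h) \<oplus> ?h \<in> U" using g'(2) submodD(3)[OF U] by blast
    moreover have "(s \<otimes> h \<ominus> ?h) \<oplus> ?h = s \<otimes> h"
    proof -
      have "s \<otimes> h \<in> carrier D" "?h \<in> carrier D"
        using sK Suc.prems(2) submodD(1)[OF V] g'(2) submodD(1)[OF U] by auto
      then show ?thesis by algebra
    qed
    moreover have "h \<in> G d" using Suc.prems(1,3) span_pow_mono by blast
    ultimately show ?case using sat s(1) by metis
  qed
  then show ?thesis using h by blast
qed

end

section \<open>A Krull--Akizuki argument\<close>

text \<open>Abstract form of the extension of \<open>K/q\<close> by the residue class of
  \<open>x\<close> modulo \<open>Q\<close>. Here \<open>p_min\<close> says that \<open>p\<close> has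
  height at most one, \<open>acc\<close> that the base ring is Noetherian, \<open>gen\<close> that
  \<open>x\<close> generates \<open>D\<close>, and \<open>alg\<close> that \<open>x\<close> is
  algebraic.\<close>

locale height_one = domain D + power_basis D K x for D (structure) and K x +
  fixes p
  assumes p_submod: "submod D K p" and p_sub: "p \<subseteq> K" and p_one: "\<one> \<notin> p"
    and p_prime: "\<And>a b. a \<in> K \<Longrightarrow> b \<in> K \<Longrightarrow> a \<otimes> b \<in> p \<Longrightarrow> a \<in> p \<or> b \<in> p"
    and p_min: "\<And>P. submod D K P \<Longrightarrow> P \<subseteq> p \<Longrightarrow> P \<noteq> {\<zero>} \<Longrightarrow>
      (\<And>a b. a \<in> K \<Longrightarrow> b \<in> K \<Longrightarrow> a \<otimes> b \<in> P \<Longrightarrow> a \<in> P \<or> b \<in> P) \<Longrightarrow> P = p"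
    and acc: "\<And>U :: nat \<Rightarrow> 'a set. (\<And>n. submod D K (U n)) \<Longrightarrow> (\<And>n. U n \<subseteq> K) \<Longrightarrow>
      (\<And>n. U n \<subseteq> U (Suc n)) \<Longrightarrow> \<exists>n. \<forall>m\<ge>n. U m = U n"
    and gen: "\<And>g. g \<in> carrier D \<Longrightarrow> \<exists>n. g \<in> G n"
    and alg: "\<exists>c\<in>K. \<exists>d. c \<noteq> \<zero> \<and> c \<otimes> x [^] d \<in> G d"
begin

abbreviation "M \<equiv> K - p"

lemma M_mult: "s \<in> M \<Longrightarrow> t \<in> M \<Longrightarrow> s \<otimes> t \<in> M"
  using p_prime by auto

lemma M_one: "\<one> \<in> M"
  using p_one by auto

lemma M_K: "s \<in> M \<Longrightarrow> s \<in> K"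
  by auto

text \<open>The contraction to \<open>D\<close> of the localization of \<open>U\<close> at
  \<open>p\<close>, expressed without fractions.\<close>

definition local_sat :: "'a set \<Rightarrow> 'a set"
  where "local_sat U = {h \<in> carrier D. \<exists>s\<in>M. s \<otimes> h \<in> U}"

text \<open>These sets correspond to the ideals of the localization of \<open>K\<close> at
  \<open>p\<close>; \<open>K\<close> itself represents the unit ideal.\<close>

definition local_ideal :: "'a set \<Rightarrow> bool"
  where "local_ideal U \<longleftrightarrow> submod D K U \<and> U \<subseteq> K \<and> (\<forall>s\<in>M. \<forall>h\<in>K. s \<otimes> h \<in> U \<longrightarrow> h \<in> U)"

lemma local_sat_submod:
  assumes "submod D K U"
  shows "submod D K (local_sat U)"
proof (rule submodI)
  show "local_sat U \<subseteq> carrier D" unfolding local_sat_def by blast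
  have "\<one> \<otimes> \<zero> \<in> U" using submodD(2)[OF assms] by simp
  then show "\<zero> \<in> local_sat U" unfolding local_sat_def using M_one by blast
next
  fix u v assume "u \<in> local_sat U" "v \<in> local_sat U"
  then obtain s t where *: "u \<in> carrier D" "v \<in> carrier D" "s \<in> M" "t \<in> M" "s \<otimes> u \<in> U" "t \<otimes> v \<in> U"
    unfolding local_sat_def by blast
  have "t \<otimes> (s \<otimes> u) \<oplus> s \<otimes> (t \<otimes> v) \<in> U"
    using * submodD(3,4)[OF assms] M_K by blast
  moreover have "t \<otimes> (s \<otimes> u) \<oplus> s \<otimes> (t \<otimes> v) = (s \<otimes> t) \<otimes> (u \<oplus> v)"
    using *(1,2) *(3,4)[THEN M_K, THEN K_closed] by algebra
  ultimately show "u \<oplus> v \<in> local_sat U"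
    unfolding local_sat_def using M_mult[OF *(3,4)] * by (auto intro!: bexI[of _ "s \<otimes> t"])
next
  fix k u assume k: "k \<in> K" and "u \<in> local_sat U"
  then obtain s where *: "u \<in> carrier D" "s \<in> M" "s \<otimes> u \<in> U"
    unfolding local_sat_def by blast
  have "k \<otimes> (s \<otimes> u) \<in> U" using * k submodD(4)[OF assms] by blast
  moreover have "k \<otimes> (s \<otimes> u) = s \<otimes> (k \<otimes> u)"
    using *(1) *(2)[THEN M_K, THEN K_closed] k[THEN K_closed] by algebra
  ultimately show "k \<otimes> u \<in> local_sat U"
    unfolding local_sat_def using * k by auto
qed

lemma local_sat_incl: "submod D K U \<Longrightarrow> U \<subseteq> local_sat U"
  unfolding local_sat_def using M_one submodD(1) by (fastforce intro!: bexI[of _ \<one>])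

lemma local_sat_mono: "U \<subseteq> V \<Longrightarrow> local_sat U \<subseteq> local_sat V"
  unfolding local_sat_def by blast

lemma local_sat_idem:
  assumes "h \<in> carrier D" "s \<in> M" "s \<otimes> h \<in> local_sat U"
  shows "h \<in> local_sat U"
proof -
  obtain t where t: "t \<in> M" "t \<otimes> (s \<otimes> h) \<in> U" using assms unfolding local_sat_def by blast
  then have "(t \<otimes> s) \<otimes> h \<in> U" using assms M_K by (simp add: m_assoc)
  then show ?thesis unfolding local_sat_def using M_mult[OF t(1) assms(2)] assms(1) by blast
qed

lemma local_ideal_sat:
  assumes "submod D K U" "U \<subseteq> K"
  shows "local_ideal (local_sat U \<inter> K)"
  unfolding local_ideal_def
proof (intro conjI ballI impI)
  note S = submodD[OF local_sat_submod[OF assms(1)]]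
  show "submod D K (local_sat U \<inter> K)"
    by (rule submodI) (use S in auto)
  fix s h assume "s \<in> M" "h \<in> K" "s \<otimes> h \<in> local_sat U \<inter> K"
  then show "h \<in> local_sat U \<inter> K" using local_sat_idem[of h s U] by auto
qed auto

lemma local_idealD:
  assumes "local_ideal L"
  shows "submod D K L" "L \<subseteq> K" "\<And>s h. s \<in> M \<Longrightarrow> h \<in> K \<Longrightarrow> s \<otimes> h \<in> L \<Longrightarrow> h \<in> L"
  using assms unfolding local_ideal_def by auto

definition add_gen :: "'a set \<Rightarrow> 'a \<Rightarrow> 'a set"
  where "add_gen L b = {l \<oplus> k \<otimes> b | l k. l \<in> L \<and> k \<in> K}"

lemma add_gen:
  assumes L: "submod D K L" and b: "b \<in> carrier D"
  shows "submod D K (add_gen L b)" "L \<subseteq> add_gen L b" "b \<in> add_gen L b"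
proof -
  have eq: "add_gen L b = sum_set L ((\<otimes>) b ` K)"
    unfolding add_gen_def sum_set_def using b by (auto simp: m_comm)
  note bK = image_mult_submod[OF K_submod b]
  show "submod D K (add_gen L b)" "L \<subseteq> add_gen L b" unfolding eq by (rule sum_set_submod[OF L bK])+
  have "b \<in> (\<otimes>) b ` K" using b by (intro image_eqI[of _ _ \<one>]) simp_all
  then show "b \<in> add_gen L b" unfolding eq using sum_set_submod(3)[OF L bK] by blast
qed

text \<open>The relation is reverse inclusion, so its minimal elements are maximal submodules. It
  provides both a maximal annihilator and Noetherian induction on local ideals.\<close>

lemma wf_submod: "wf {(V, U). submod D K U \<and> submod D K V \<and> V \<subseteq> K \<and> U \<subset> V}"
proof (rule ccontr)
  assume "\<not> ?thesis"
  then obtain f where "\<forall>i. (f (Suc i), f i) \<in> {(V, U). submod D K U \<and> submod D K V \<and> V \<subseteq> K \<and> U \<subset> V}"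
    unfolding wf_iff_no_infinite_down_chain by blast
  then have f: "submod D K (f n) \<and> submod D K (f (Suc n)) \<and> f (Suc n) \<subseteq> K \<and> f n \<subset> f (Suc n)" for n
    by simp
  have "\<exists>n. \<forall>m\<ge>n. f m = f n"
  proof (rule acc)
    fix n
    show "submod D K (f n)" "f n \<subseteq> K" "f n \<subseteq> f (Suc n)" using f[of n] by blast+
  qed
  then obtain n where "\<forall>m\<ge>n. f m = f n" by blast
  then have "f (Suc n) = f n" using le_SucI[OF order_refl] by blast
  then show False using f[of n] by blast
qed

text \<open>An associated prime of a proper local ideal containing a nonzero element lies in \<open>p\<close>
  and is nonzero, hence is \<open>p\<close>.\<close>

lemma ex_socle_element:
  assumes L: "local_ideal L" and nz: "l \<in> L" "l \<noteq> \<zero>" and proper: "L \<noteq> K"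
  obtains b where "b \<in> K" "b \<notin> L" "\<And>k. k \<in> K \<Longrightarrow> k \<otimes> b \<in> L \<longleftrightarrow> k \<in> p"
proof -
  note LD = local_idealD[OF L]
  define ann where "ann b = {k \<in> K. k \<otimes> b \<in> L}" for b
  have ann: "submod D K (ann b)" if b: "b \<in> K" for b
  proof (rule submodI)
    show "ann b \<subseteq> carrier D" unfolding ann_def by auto
    show "\<zero> \<in> ann b" unfolding ann_def using submodD(2)[OF LD(1)] b by simp
    fix u v assume "u \<in> ann b" "v \<in> ann b"
    then show "u \<oplus> v \<in> ann b" unfolding ann_def using submodD(3)[OF LD(1)] b by (simp add: l_distr)
  next
    fix k u assume "k \<in> K" "u \<in> ann b"
    then show "k \<otimes> u \<in> ann b" unfolding ann_def using submodD(4)[OF LD(1)] b by (simp add: m_assoc)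
  qed
  define F where "F = ann ` (K - L)"
  have "F \<noteq> {}" unfolding F_def using proper LD(2) by blast
  then obtain f where "f \<in> F" by blast
  \<comment> \<open>\<open>A\<close> is maximal under inclusion among the annihilators modulo
    \<open>L\<close> of elements outside \<open>L\<close>.\<close>
  obtain A where A: "A \<in> F"
    and min: "\<And>V. (V, A) \<in> {(V, U). submod D K U \<and> submod D K V \<and> V \<subseteq> K \<and> U \<subset> V} \<Longrightarrow> V \<notin> F"
    by (rule wfE_min[OF wf_submod \<open>f \<in> F\<close>]) blast
  then obtain b where b: "b \<in> K" "b \<notin> L" "A = ann b" unfolding F_def by blast
  have max: "ann c = ann b" if "c \<in> K" "c \<notin> L" "ann b \<subseteq> ann c" for c
  proof (rule ccontr)
    assume "ann c \<noteq> ann b"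
    then have "(ann c, A) \<in> {(V, U). submod D K U \<and> submod D K V \<and> V \<subseteq> K \<and> U \<subset> V}"
      using ann that b unfolding ann_def by auto
    then have "ann c \<notin> F" using min by blast
    then show False unfolding F_def using that by blast
  qed
  have "ann b = p"
  proof (rule p_min[OF ann[OF b(1)]])
    show "ann b \<subseteq> p"
    proof
      fix k assume "k \<in> ann b"
      then have "k \<in> K" "k \<otimes> b \<in> L" unfolding ann_def by auto
      then show "k \<in> p" using LD(3)[of k b] b by blast
    qed
    have "l \<in> ann b"
    proof -
      have "l \<in> K" using nz LD(2) by blast
      moreover from this have "l \<otimes> b = b \<otimes> l" using b by (simp add: m_comm)
      ultimately show ?thesis unfolding ann_def using submodD(4)[OF LD(1) b(1) nz(1)] by simp
    qed
    then show "ann b \<noteq> {\<zero>}" using nz by blast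
  next
    fix u v assume uv: "u \<in> K" "v \<in> K" "u \<otimes> v \<in> ann b"
    show "u \<in> ann b \<or> v \<in> ann b"
    proof (rule disjCI)
      assume "v \<notin> ann b"
      then have vb: "v \<otimes> b \<in> K" "v \<otimes> b \<notin> L" using uv b unfolding ann_def by auto
      have "ann b \<subseteq> ann (v \<otimes> b)"
      proof
        fix k assume k: "k \<in> ann b"
        then have "k \<in> K" "v \<otimes> (k \<otimes> b) \<in> L" using submodD(4)[OF LD(1) uv(2)] unfolding ann_def by auto
        then show "k \<in> ann (v \<otimes> b)" unfolding ann_def using uv b by (simp add: m_lcomm)
      qed
      then have "ann (v \<otimes> b) = ann b" using max vb by blast
      moreover have "u \<in> ann (v \<otimes> b)" using uv b unfolding ann_def by (simp add: m_assoc)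
      ultimately show "u \<in> ann b" by simp
    qed
  qed
  then show thesis using that[of b] b unfolding ann_def by blast
qed

text \<open>Modulo a nonzero ideal, the localization of \<open>K\<close> at \<open>p\<close> has
  finite length. In the Noetherian induction on \<open>L\<close>, a socle element produces a larger
  \<open>L'\<close> with no local ideal of the chain strictly between them. A descending chain is
  then controlled by its sums with \<open>L'\<close>, where the induction hypothesis applies, and
  its intersections with \<open>L'\<close>.\<close>

lemma dcc_local_ideal:
  assumes "local_ideal L" "l \<in> L" "l \<noteq> \<zero>"
    and "\<And>n. local_ideal (I n)" "\<And>n. L \<subseteq> I n" "\<And>n. I (Suc n) \<subseteq> I n"
  shows "\<exists>n. \<forall>m\<ge>n. I m = I n"
  using assms
proof (induction L arbitrary: I rule: wf_induct_rule[OF wf_submod])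
  case (1 L)
  note LD = local_idealD[OF 1(2)]
  note ID = local_idealD[OF 1(5)]
  have anti: "I m \<subseteq> I n" if "n \<le> m" for m n
    by (rule lift_Suc_antimono_le[of I]) (use 1(7) that in blast)+
  show ?case
  proof (cases "L = K")
    case True
    then have "I n = K" for n using 1(6)[of n] ID(2)[of n] by blast
    then show ?thesis by blast
  next
    case False
    then obtain b where b: "b \<in> K" "b \<notin> L" "\<And>k. k \<in> K \<Longrightarrow> k \<otimes> b \<in> L \<longleftrightarrow> k \<in> p"
      using ex_socle_element[OF 1(2-4)] by blast
    define L' where "L' = local_sat (add_gen L b) \<inter> K"
    note ag = add_gen[OF LD(1) K_closed[OF b(1)]]
    have agK: "add_gen L b \<subseteq> K" unfolding add_gen_def using LD(2) b(1) by auto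
    have L': "local_ideal L'" unfolding L'_def by (rule local_ideal_sat[OF ag(1) agK])
    note L'D = local_idealD[OF L']
    have LL': "L \<subseteq> L'" "b \<in> L'" unfolding L'_def using ag local_sat_incl[OF ag(1)] agK by auto
    define Sm where "Sm n = sum_set (I n) L'" for n
    define J where "J n = local_sat (Sm n) \<inter> K" for n
    note Sm = sum_set_submod[OF ID(1) L'D(1), folded Sm_def]
    note sm = Sm(1) and IJ = Sm(2) and L'J = Sm(3)
    have JK: "Sm n \<subseteq> K" for n
      unfolding Sm_def sum_set_def using ID(2)[of n] L'D(2) K_ops(5) by blast
    have "\<exists>n. \<forall>m\<ge>n. J m = J n"
    proof (rule 1(1))
      show "(L', L) \<in> {(V, U). submod D K U \<and> submod D K V \<and> V \<subseteq> K \<and> U \<subset> V}"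
        using LD(1) L'D(1,2) LL' b(2) by blast
      show "local_ideal (J n)" for n unfolding J_def by (rule local_ideal_sat[OF sm JK])
      show "L' \<subseteq> J n" for n unfolding J_def using L'J[of n] local_sat_incl[OF sm[of n]] L'D(2) by blast
      have "Sm (Suc n) \<subseteq> Sm n" for n unfolding Sm_def sum_set_def using 1(7)[of n] by blast
      then show "J (Suc n) \<subseteq> J n" for n unfolding J_def using local_sat_mono[of "Sm (Suc n)" "Sm n"] by blast
      show "local_ideal L'" "l \<in> L'" "l \<noteq> \<zero>" using L' LL' 1(3,4) by auto
    qed
    then obtain n1 where n1: "\<And>m. m \<ge> n1 \<Longrightarrow> J m = J n1" by blast
    \<comment> \<open>An element of \<open>I n \<inter> L'\<close> outside \<open>L\<close> involves
      \<open>b\<close> with a coefficient outside \<open>p\<close>; cancelling that coefficient puts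
      \<open>b\<close>, and with it all of \<open>L'\<close>, into \<open>I n\<close>.\<close>
    have simple: "I n \<inter> L' = L \<or> I n \<inter> L' = L'" for n
    proof (rule disjCI)
      assume "I n \<inter> L' \<noteq> L'"
      have "y \<in> L" if y: "y \<in> I n" "y \<in> L'" for y
      proof (rule ccontr)
        assume yL: "y \<notin> L"
        from y(2) obtain s where s: "s \<in> M" "s \<otimes> y \<in> add_gen L b" "y \<in> K" unfolding L'_def local_sat_def by blast
        then obtain l' k where lk: "s \<otimes> y = l' \<oplus> k \<otimes> b" "l' \<in> L" "k \<in> K" unfolding add_gen_def by blast
        have cl: "s \<in> carrier D" "y \<in> carrier D" "l' \<in> carrier D" "k \<otimes> b \<in> carrier D"
          using s lk LD(2) b(1) by auto
        have "k \<notin> p"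
        proof
          assume "k \<in> p"
          then have "k \<otimes> b \<in> L" using b lk by blast
          then have "s \<otimes> y \<in> L" using lk submodD(3)[OF LD(1)] by simp
          then show False using LD(3) s yL by blast
        qed
        have "k \<otimes> b = s \<otimes> y \<ominus> l'" using lk(1) cl by algebra
        moreover have "s \<otimes> y \<ominus> l' \<in> I n"
          using submod_minus[OF ID(1)] submodD(4)[OF ID(1)] M_K[OF s(1)] y(1) lk(2) 1(6) by blast
        ultimately have "b \<in> I n" using ID(3)[of k b n] \<open>k \<notin> p\<close> lk(3) b(1) by simp
        then have "add_gen L b \<subseteq> I n"
          unfolding add_gen_def using 1(6)[of n] submodD(3,4)[OF ID(1)[of n]] by blast
        then have "L' \<subseteq> I n" unfolding L'_def local_sat_def using ID(3)[of _ _ n] by blast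
        with \<open>I n \<inter> L' \<noteq> L'\<close> show False by blast
      qed
      then show "I n \<inter> L' = L" using LL'(1) 1(6)[of n] by blast
    qed
    have "\<exists>n2. \<forall>m\<ge>n2. I m \<inter> L' = I n2 \<inter> L'"
    proof (cases "\<exists>n. I n \<inter> L' = L")
      case True
      then obtain n where n: "I n \<inter> L' = L" by blast
      have "I m \<inter> L' = L" if "m \<ge> n" for m
        using anti[OF that] n 1(6)[of m] LL'(1) by blast
      then show ?thesis using n by blast
    next
      case False
      then have "I n \<inter> L' = L'" for n using simple by blast
      then show ?thesis by blast
    qed
    then obtain n2 where n2: "\<And>m. m \<ge> n2 \<Longrightarrow> I m \<inter> L' = I n2 \<inter> L'" by blast
    define n where "n = max n1 n2"
    \<comment> \<open>The modular law up to a factor \<open>s\<close> outside \<open>p\<close>: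
      \<open>s y\<close> splits into a part in \<open>I m\<close> and a part in \<open>L'\<close>,
      and the latter lies in \<open>I n \<inter> L' = I m \<inter> L'\<close>.\<close>
    have "I m = I n" if m: "m \<ge> n" for m
    proof (rule antisym[OF anti[OF m]], rule subsetI)
      fix y assume y: "y \<in> I n"
      then have yK: "y \<in> K" using ID(2) by blast
      have "J m = J n" using n1[of m] n1[of n] m n_def by simp
      then have "y \<in> J m" unfolding J_def using y IJ[of n] yK local_sat_incl[OF sm[of n]] by blast
      then obtain s u v where *: "s \<in> M" "s \<otimes> y = u \<oplus> v" "u \<in> I m" "v \<in> L'"
        unfolding J_def local_sat_def Sm_def sum_set_def by blast
      have cl: "s \<in> carrier D" "y \<in> carrier D" "u \<in> carrier D" "v \<in> carrier D"
        using K_closed[OF M_K[OF *(1)]] K_closed[OF yK] K_closed[OF subsetD[OF ID(2) *(3)]]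
          K_closed[OF subsetD[OF L'D(2) *(4)]] by blast+
      have "v = s \<otimes> y \<ominus> u" using *(2) cl by algebra
      moreover have "s \<otimes> y \<ominus> u \<in> I n"
        using submod_minus[OF ID(1)] submodD(4)[OF ID(1)] M_K[OF *(1)] y *(3) anti[OF m] by blast
      ultimately have "v \<in> I n \<inter> L'" using *(4) by simp
      then have "v \<in> I m" using n2[of m] n2[of n] m n_def by auto
      then have "s \<otimes> y \<in> I m" using * submodD(3)[OF ID(1)] by simp
      then show "y \<in> I m" using ID(3) *(1) yK by blast
    qed
    then show ?thesis by blast
  qed
qed

lemma zero_submod: "submod D K {\<zero>}"
  by (rule submodI) auto

text \<open>In the quotient of the localization of \<open>K\<close> at \<open>p\<close> by
  \<open>c\<close>, which is Artinian, the image of \<open>p\<close> is nilpotent. Concretely, the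
  chain of ideals generated by \<open>c\<close> and \<open>a^m\<close> becomes stationary.\<close>

lemma pow_dvd:
  assumes a: "a \<in> p" and c: "c \<in> K" "c \<noteq> \<zero>"
  obtains m s e where "s \<in> M" "e \<in> K" "s \<otimes> a [^] (m::nat) = e \<otimes> c"
proof -
  have aK: "a \<in> K" using a p_sub by blast
  \<comment> \<open>\<open>add_gen {\<zero>} c\<close> is the principal ideal of
    \<open>c\<close>.\<close>
  define C where "C = add_gen {\<zero>} c"
  define L where "L = local_sat C \<inter> K"
  define I where "I m = local_sat (add_gen C (a [^] (m::nat))) \<inter> K" for m
  note C = add_gen[OF zero_submod K_closed[OF c(1)], folded C_def]
  have CK: "C \<subseteq> K" unfolding C_def add_gen_def using c by auto
  note A = add_gen[OF C(1) K_closed[OF K_pow[OF aK]]]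
  have AK: "add_gen C (a [^] (m::nat)) \<subseteq> K" for m
    unfolding add_gen_def using CK aK by (blast intro: K_ops K_pow)
  have "\<exists>n. \<forall>m\<ge>n. I m = I n"
  proof (rule dcc_local_ideal)
    show "local_ideal L" unfolding L_def by (rule local_ideal_sat[OF C(1) CK])
    show "c \<in> L" unfolding L_def using C local_sat_incl[OF C(1)] c by blast
    show "c \<noteq> \<zero>" by fact
    show "local_ideal (I n)" for n unfolding I_def by (rule local_ideal_sat[OF A(1) AK])
    show "L \<subseteq> I n" for n unfolding I_def L_def using local_sat_mono[OF A(2)[of n]] by blast
    show "I (Suc n) \<subseteq> I n" for n
    proof -
      have "add_gen C (a [^] Suc n) \<subseteq> add_gen C (a [^] n)"
      proof
        fix y assume "y \<in> add_gen C (a [^] Suc n)"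
        then obtain l k where *: "y = l \<oplus> k \<otimes> a [^] Suc n" "l \<in> C" "k \<in> K" unfolding add_gen_def by blast
        then have "y = l \<oplus> (k \<otimes> a) \<otimes> a [^] n" using aK by (simp add: m_ac)
        then show "y \<in> add_gen C (a [^] n)" unfolding add_gen_def using *(2) K_ops(4)[OF *(3) aK] by blast
      qed
      then show ?thesis unfolding I_def using local_sat_mono by blast
    qed
  qed
  then obtain n where "\<forall>m\<ge>n. I m = I n" by blast
  then have "I (Suc n) = I n" using le_SucI[OF order_refl] by blast
  moreover have "a [^] n \<in> I n" unfolding I_def
    using subsetD[OF local_sat_incl[OF A(1)[of n]] A(3)[of n]] K_pow[OF aK, of n] by blast
  ultimately have "a [^] n \<in> I (Suc n)" by simp
  then obtain s k l where *: "s \<in> M" "k \<in> K" "l \<in> C" "s \<otimes> a [^] n = l \<oplus> k \<otimes> a [^] Suc n"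
    unfolding I_def local_sat_def add_gen_def[of C] by blast
  from *(3) obtain e where e: "e \<in> K" "l = \<zero> \<oplus> e \<otimes> c" unfolding C_def add_gen_def by blast
  have cl: "s \<in> carrier D" "k \<in> carrier D" "a \<in> carrier D" "a [^] n \<in> carrier D" "e \<otimes> c \<in> carrier D"
    using * e c aK by auto
  have ka: "k \<otimes> a \<in> p" using submodD(4)[OF p_submod *(2) a] .
  have "s \<otimes> a [^] n = e \<otimes> c \<oplus> k \<otimes> (a [^] n \<otimes> a)" using * e cl by simp
  \<comment> \<open>Stationarity puts \<open>s a^n\<close> into the ideal generated by
    \<open>c\<close> and \<open>a^(n+1)\<close>. Collecting the powers of \<open>a\<close> leaves
    the factor \<open>s - k a\<close>, which is outside \<open>p\<close> because \<open>a\<close> is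
    inside.\<close>
  then have "(s \<ominus> k \<otimes> a) \<otimes> a [^] n = e \<otimes> c" using cl
  proof -
    have "(s \<ominus> k \<otimes> a) \<otimes> a [^] n = s \<otimes> a [^] n \<ominus> k \<otimes> (a [^] n \<otimes> a)" using cl by algebra
    also have "\<dots> = e \<otimes> c \<oplus> k \<otimes> (a [^] n \<otimes> a) \<ominus> k \<otimes> (a [^] n \<otimes> a)"
      using \<open>s \<otimes> a [^] n = e \<otimes> c \<oplus> k \<otimes> (a [^] n \<otimes> a)\<close> by simp
    also have "\<dots> = e \<otimes> c" using cl by algebra
    finally show ?thesis .
  qed
  moreover have "s \<ominus> k \<otimes> a \<in> M"
  proof -
    have "s \<ominus> k \<otimes> a \<in> K" using * aK by simp
    moreover have "s \<ominus> k \<otimes> a \<notin> p"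
    proof
      assume "s \<ominus> k \<otimes> a \<in> p"
      then have "(s \<ominus> k \<otimes> a) \<oplus> k \<otimes> a \<in> p" using ka submodD(3)[OF p_submod] by blast
      moreover have "(s \<ominus> k \<otimes> a) \<oplus> k \<otimes> a = s" using cl by algebra
      ultimately show False using *(1) by simp
    qed
    ultimately show ?thesis by simp
  qed
  ultimately show thesis using that e(1) by blast
qed

text \<open>Let \<open>U n\<close> consist of the \<open>h \<in> G d\<close> with \<open>s h \<in> a\<^sup>n D + a G d\<close> for some \<open>s \<notin> p\<close>. The chain \<open>U n\<close>
  stabilises by the descending chain condition modulo \<open>a\<close>, so that every \<open>a\<^sup>n g\<close> lies in
  \<open>a\<^sup>m D + G d\<close> with \<open>m = n + 1\<close>, up to a factor \<open>s \<notin> p\<close>; then \<open>V N = G d \<inter> a\<^sup>n G N\<close> stabilises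
  by the ascending chain condition, which bounds the powers of \<open>x\<close> needed.\<close>

theorem bounded_generation:
  assumes a: "a \<in> p" "a \<noteq> \<zero>"
  shows "\<exists>N. \<forall>g\<in>carrier D. \<exists>s\<in>M. \<exists>g'\<in>carrier D. \<exists>r\<in>G N. s \<otimes> g = a \<otimes> g' \<oplus> r"
proof -
  have aK: "a \<in> K" using a p_sub by blast
  have acl [simp]: "a \<in> carrier D" using aK by simp
  obtain c d where c: "c \<in> K" "c \<noteq> \<zero>" "c \<otimes> x [^] d \<in> G d" using alg by blast
  note Gd = submodD[OF span_pow_submod[of d]]
  have int: "u = \<zero> \<or> v = \<zero>" if "u \<in> K" "v \<in> K" "u \<otimes> v = \<zero>" for u v
    using that integral by auto
  \<comment> \<open>Algebraicity supplies a nonzero multiplier from \<open>K\<close>, which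
    \<open>pow_dvd\<close> trades for a power of \<open>a\<close> up to a factor outside
    \<open>p\<close>.\<close>
  have B: "\<exists>m. \<exists>s\<in>M. (s \<otimes> a [^] (m::nat)) \<otimes> g \<in> G d" if g: "g \<in> carrier D" for g
  proof -
    obtain n where "g \<in> G n" using gen g by blast
    from algebraic_span_pow[OF c this int] obtain k where k: "k \<in> K" "k \<noteq> \<zero>" "k \<otimes> g \<in> G d" by blast
    obtain s e m where *: "s \<in> M" "e \<in> K" "s \<otimes> a [^] (m::nat) = e \<otimes> k" using pow_dvd[OF a(1) k(1,2)] by blast
    have "(s \<otimes> a [^] m) \<otimes> g = e \<otimes> (k \<otimes> g)" unfolding *(3) using * k g by (simp add: m_assoc)
    then show ?thesis using Gd(4)[OF *(2) k(3)] *(1) by metis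
  qed
  \<comment> \<open>The summand \<open>a G d\<close> carries a factor \<open>a\<close> as well; this
    is what later allows one \<open>a\<close> to be cancelled from the whole equation.\<close>
  define U where "U n = {h \<in> G d. \<exists>s\<in>M. \<exists>g'\<in>carrier D. \<exists>h'\<in>G d. s \<otimes> h = a [^] (n::nat) \<otimes> g' \<oplus> a \<otimes> h'}" for n
  have UE: "\<exists>s\<in>M. \<exists>g'\<in>carrier D. \<exists>h'\<in>G d. s \<otimes> h = a [^] (n::nat) \<otimes> g' \<oplus> a \<otimes> h'" if "h \<in> U n" for h n
    using that unfolding U_def by simp
  have Ueq: "U n = G d \<inter> local_sat (sum_set ((\<otimes>) (a [^] n) ` carrier D) ((\<otimes>) a ` G d))" for n
    unfolding U_def local_sat_def sum_set_def using Gd(1) by blast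
  have Usub: "submod D K (U n)" for n
    unfolding Ueq by (intro submod_Int span_pow_submod local_sat_submod sum_set_submod(1) image_mult_submod carrier_submod) simp_all
  have Usuc: "U (Suc n) \<subseteq> U n" for n
  proof
    fix u assume "u \<in> U (Suc n)"
    then obtain s g h where *: "u \<in> G d" "s \<in> M" "g \<in> carrier D"
      "h \<in> G d" "s \<otimes> u = a [^] Suc n \<otimes> g \<oplus> a \<otimes> h"
      unfolding U_def by blast
    then have "s \<otimes> u = a [^] n \<otimes> (a \<otimes> g) \<oplus> a \<otimes> h" by (simp add: m_assoc)
    moreover have "a \<otimes> g \<in> carrier D" using * by simp
    ultimately show "u \<in> U n" unfolding U_def using *(1,2,4) by blast
  qed
  have Usat: "h \<in> U n" if hU: "s \<in> M" "h \<in> G d" "s \<otimes> h \<in> U n" for s h n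
    using hU local_sat_idem[OF subsetD[OF Gd(1) hU(2)] hU(1)] unfolding Ueq by blast
  \<comment> \<open>Each \<open>U n\<close> contains \<open>a x^i\<close> for \<open>i < d\<close>,
    so \<open>a\<close> is a leading coefficient throughout. This bounds the chain from below by a
    nonzero local ideal, as \<open>dcc_local_ideal\<close> requires.\<close>
  have "\<exists>n. \<forall>m\<ge>n. local_sat (lead i (U m)) \<inter> K = local_sat (lead i (U n)) \<inter> K" if i: "i < d" for i
  proof (rule dcc_local_ideal)
    have leadK: "lead i V \<subseteq> K" for V unfolding lead_def by blast
    note A = add_gen[OF zero_submod acl]
    have AK: "add_gen {\<zero>} a \<subseteq> K" unfolding add_gen_def using aK by auto
    show "local_ideal (local_sat (add_gen {\<zero>} a) \<inter> K)" by (rule local_ideal_sat[OF A(1) AK])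
    show "a \<in> local_sat (add_gen {\<zero>} a) \<inter> K" using A aK local_sat_incl[OF A(1)] by blast
    show "a \<noteq> \<zero>" by fact
    show "local_ideal (local_sat (lead i (U n)) \<inter> K)" for n
      by (rule local_ideal_sat[OF lead_submod[OF Usub] leadK])
    show "local_sat (lead i (U (Suc n))) \<inter> K \<subseteq> local_sat (lead i (U n)) \<inter> K" for n
      using local_sat_mono[OF lead_mono[OF Usuc]] by blast
    show "local_sat (add_gen {\<zero>} a) \<inter> K \<subseteq> local_sat (lead i (U n)) \<inter> K" for n
    proof -
      have "\<one> \<otimes> x [^] i \<in> G d" by (rule pow_in_span_pow[OF K_ops(2) i])
      then have xi: "x [^] i \<in> G d" by simp
      have "\<one> \<otimes> (a \<otimes> x [^] i) = a [^] n \<otimes> \<zero> \<oplus> a \<otimes> x [^] i" by simp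
      then have "a \<otimes> x [^] i \<in> U n" unfolding U_def using Gd(4)[OF aK xi] xi M_one by blast
      then have "\<zero> \<oplus> a \<otimes> x [^] i \<in> U n" by simp
      then have "a \<in> lead i (U n)" unfolding lead_def using aK submodD(2)[OF span_pow_submod[of i]] by blast
      then have "add_gen {\<zero>} a \<subseteq> lead i (U n)"
        unfolding add_gen_def using submodD[OF lead_submod[OF Usub[of n], of i]] by blast
      then show ?thesis using local_sat_mono by blast
    qed
  qed
  then obtain f where f: "\<And>i m. i < d \<Longrightarrow> m \<ge> f i \<Longrightarrow>
      local_sat (lead i (U m)) \<inter> K = local_sat (lead i (U (f i))) \<inter> K" by metis
  \<comment> \<open>A common bound for the \<open>d\<close> indices at which the leading coefficient
    ideals become stationary.\<close>
  define n where "n = (\<Sum>i<d. f i)"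
  have fn: "f i \<le> n" if "i < d" for i unfolding n_def using that by (intro member_le_sum) auto
  have stable: "h \<in> U m" if m: "m \<ge> n" and h: "h \<in> U n" for m h
  proof (rule eq_if_lead_eq[OF Usub Usub, where M = M and d = d])
    show "U m \<subseteq> U n" by (rule lift_Suc_antimono_le[of U]) (use Usuc m in blast)+
    show "M \<subseteq> K" by blast
    show "h' \<in> U m" if "s \<in> M" "h' \<in> G d" "s \<otimes> h' \<in> U m" for s h' using Usat that by blast
    show "h \<in> U n" by fact
    show "h \<in> G d" using h unfolding U_def by blast
    fix i e assume i: "i < d" and e: "e \<in> lead i (U n)"
    have "e \<in> local_sat (lead i (U n)) \<inter> K"
      using e local_sat_incl[OF lead_submod[OF Usub]] unfolding lead_def by blast
    then have "e \<in> local_sat (lead i (U m)) \<inter> K"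
      using f[OF i, of n] f[OF i, of m] fn[OF i] m by simp
    then show "\<exists>s\<in>M. s \<otimes> e \<in> lead i (U m)" unfolding local_sat_def by blast
  qed
  \<comment> \<open>The induction runs on the power of \<open>a\<close> that brings \<open>g\<close>
    into \<open>G d\<close>. For exponents up to \<open>n\<close> the element \<open>s a^n g\<close>
    itself lies in \<open>G d\<close>, so \<open>g' = \<zero>\<close> works.\<close>
  have E: "\<exists>s\<in>M. \<exists>g'\<in>carrier D. \<exists>h\<in>G d. s \<otimes> (a [^] n \<otimes> g) = a [^] Suc n \<otimes> g' \<oplus> h"
    if "g \<in> carrier D" "s \<in> M" "(s \<otimes> a [^] m) \<otimes> g \<in> G d" for g s and m :: nat
    using that
  proof (induction m arbitrary: g s)
    case m: (0 g s)
    have "(s \<otimes> a [^] n) \<otimes> g \<in> G d"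
    proof -
      have "(s \<otimes> a [^] n) \<otimes> g = a [^] n \<otimes> ((s \<otimes> a [^] (0::nat)) \<otimes> g)"
        using m by (simp add: m_ac)
      then show ?thesis using Gd(4)[OF K_pow[OF aK] m(3)] by metis
    qed
    moreover have "s \<otimes> (a [^] n \<otimes> g) = a [^] Suc n \<otimes> \<zero> \<oplus> (s \<otimes> a [^] n) \<otimes> g"
      using m by (simp add: m_assoc)
    ultimately show ?case using m(2) by blast
  next
    case (Suc m g s)
    have cl: "s \<in> carrier D" "a [^] m \<in> carrier D" "a [^] n \<in> carrier D" "g \<in> carrier D"
      using Suc.prems by auto
    show ?case
    proof (cases "Suc m \<le> n")
      case True
      then obtain e where e: "n = e + Suc m" by (metis le_add_diff_inverse2)
      have "s \<otimes> (a [^] n \<otimes> g) = a [^] Suc n \<otimes> \<zero> \<oplus> a [^] e \<otimes> ((s \<otimes> a [^] Suc m) \<otimes> g)"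
        unfolding e nat_pow_mult[OF acl, symmetric] using Suc.prems cl by (simp add: m_ac)
      moreover have "a [^] e \<otimes> ((s \<otimes> a [^] Suc m) \<otimes> g) \<in> G d"
        using Gd(4)[OF K_pow[OF aK] Suc.prems(3)] .
      ultimately show ?thesis using Suc.prems(2) by blast
    next
      case False
      \<comment> \<open>Past the index \<open>n\<close>, membership of \<open>?h\<close> in
        \<open>U (Suc m)\<close> improves to \<open>U (Suc (Suc m))\<close>. Cancelling one
        \<open>a\<close> shows that already \<open>a^m\<close> brings \<open>?g\<close> into
        \<open>G d\<close>, and \<open>?g\<close> differs from a multiple of \<open>g\<close> by an
        element outside \<open>p\<close> only through a multiple of \<open>a\<close>.\<close>
      let ?h = "(s \<otimes> a [^] Suc m) \<otimes> g"
      have "\<one> \<otimes> ?h = a [^] Suc m \<otimes> (s \<otimes> g) \<oplus> a \<otimes> \<zero>" using cl by (simp add: m_ac)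
      then have "?h \<in> U (Suc m)" unfolding U_def using Suc.prems(3) M_one Gd(2) cl m_closed by blast
      moreover have "U (Suc m) \<subseteq> U n" by (rule lift_Suc_antimono_le[of U]) (use Usuc False in auto)
      ultimately have "?h \<in> U (Suc (Suc m))" using stable[of "Suc (Suc m)" ?h] False by auto
      then obtain t g' h' where *: "t \<in> M" "g' \<in> carrier D" "h' \<in> G d"
        "t \<otimes> ?h = a [^] Suc (Suc m) \<otimes> g' \<oplus> a \<otimes> h'" using UE by blast
      have cl2: "t \<in> carrier D" "h' \<in> carrier D" "g' \<in> carrier D" using * Gd(1) by auto
      let ?g = "(t \<otimes> s) \<otimes> g \<ominus> a \<otimes> g'"
      have "a \<otimes> (a [^] m \<otimes> ?g) = t \<otimes> ((s \<otimes> (a [^] m \<otimes> a)) \<otimes> g) \<ominus> ((a [^] m \<otimes> a) \<otimes> a) \<otimes> g'"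
        using cl cl2 acl by algebra
      also have "\<dots> = (((a [^] m \<otimes> a) \<otimes> a) \<otimes> g' \<oplus> a \<otimes> h') \<ominus> ((a [^] m \<otimes> a) \<otimes> a) \<otimes> g'"
        using *(4) by simp
      also have "\<dots> = a \<otimes> h'" using cl cl2 acl by algebra
      finally have "a [^] m \<otimes> ?g = h'" using a(2) cl cl2 by (simp add: m_lcancel)
      then have "(\<one> \<otimes> a [^] m) \<otimes> ?g \<in> G d" using *(3) by simp
      moreover have g1: "?g \<in> carrier D" using cl cl2 by simp
      ultimately obtain t' g'' h'' where **: "t' \<in> M" "g'' \<in> carrier D" "h'' \<in> G d"
        "t' \<otimes> (a [^] n \<otimes> ?g) = a [^] Suc n \<otimes> g'' \<oplus> h''" using Suc.IH[of ?g \<one>] M_one by blast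
      have cl3: "t' \<in> carrier D" "h'' \<in> carrier D" using ** Gd(1) by auto
      have "(t' \<otimes> (t \<otimes> s)) \<otimes> (a [^] n \<otimes> g) = t' \<otimes> (a [^] n \<otimes> ?g) \<oplus> (a [^] n \<otimes> a) \<otimes> (t' \<otimes> g')"
        using cl cl2 cl3 acl by algebra
      also have "\<dots> = (a [^] n \<otimes> a) \<otimes> (g'' \<oplus> t' \<otimes> g') \<oplus> h''"
        unfolding **(4) nat_pow_Suc using cl cl2 cl3 acl **(2) by algebra
      finally have "(t' \<otimes> (t \<otimes> s)) \<otimes> (a [^] n \<otimes> g) = a [^] Suc n \<otimes> (g'' \<oplus> t' \<otimes> g') \<oplus> h''" by simp
      moreover have "t' \<otimes> (t \<otimes> s) \<in> M" using M_mult ** * Suc.prems by blast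
      moreover have "g'' \<oplus> t' \<otimes> g' \<in> carrier D" using ** cl2 cl3 by simp
      ultimately show ?thesis using **(3) by blast
    qed
  qed
  define V where "V N = {h \<in> G d. \<exists>g\<in>G N. h = a [^] n \<otimes> g}" for N
  have an: "a [^] n \<in> carrier D" by simp
  have Veq: "V N = G d \<inter> (\<otimes>) (a [^] n) ` G N" for N unfolding V_def by blast
  have Vsub: "submod D K (V N)" for N
    unfolding Veq by (intro submod_Int span_pow_submod image_mult_submod an)
  have Vmono: "V N \<subseteq> V N'" if "N \<le> N'" for N N' unfolding V_def using span_pow_mono[OF that] by blast
  have "\<exists>N. \<forall>m\<ge>N. lead i (V m) = lead i (V N)" for i
  proof (rule acc)
    show "submod D K (lead i (V N))" for N by (rule lead_submod[OF Vsub])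
    show "lead i (V N) \<subseteq> K" for N unfolding lead_def by blast
    show "lead i (V N) \<subseteq> lead i (V (Suc N))" for N by (rule lead_mono[OF Vmono]) simp
  qed
  then obtain f' where f': "\<And>i m. m \<ge> f' i \<Longrightarrow> lead i (V m) = lead i (V (f' i))" by metis
  define N where "N = (\<Sum>i<d. f' i)"
  have fN: "f' i \<le> N" if "i < d" for i unfolding N_def using that by (intro member_le_sum) auto
  have stableV: "h \<in> V N" if h: "h \<in> V N'" for N' h
  proof (cases "N \<le> N'")
    case False
    then show ?thesis using Vmono h by (meson nat_le_linear subsetD)
  next
    case True
    show ?thesis
    proof (rule eq_if_lead_eq[OF Vsub Vsub Vmono[OF True], where M = "{\<one>}" and d = d])
      show "{\<one>} \<subseteq> K" by simp
      show "h' \<in> V N" if "s \<in> {\<one>}" "h' \<in> G d" "s \<otimes> h' \<in> V N" for s h'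
        using that Gd(1) by auto
      show "h \<in> V N'" by fact
      show "h \<in> G d" using h unfolding V_def by blast
      show "\<exists>s\<in>{\<one>}. s \<otimes> e \<in> lead i (V N)" if "i < d" "e \<in> lead i (V N')" for i e
      proof -
        have "e \<in> lead i (V N)" using f'[of i N] f'[of i N'] fN[OF that(1)] True that(2) by simp
        moreover have "e \<in> K" using that(2) unfolding lead_def by blast
        ultimately show ?thesis by simp
      qed
    qed
  qed
  show ?thesis
  proof (intro exI[of _ N] ballI)
    fix g assume g: "g \<in> carrier D"
    obtain m s0 where "s0 \<in> M" "(s0 \<otimes> a [^] (m::nat)) \<otimes> g \<in> G d" using B[OF g] by blast
    from E[OF g this] obtain s g' h where *: "s \<in> M" "g' \<in> carrier D" "h \<in> G d"
      "s \<otimes> (a [^] n \<otimes> g) = a [^] Suc n \<otimes> g' \<oplus> h" by blast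
    have cl: "s \<in> carrier D" "h \<in> carrier D" using * Gd(1) by auto
    \<comment> \<open>The degree of \<open>?r\<close> depends on \<open>g\<close>. Since
      \<open>a^n ?r = h\<close> lies in \<open>G d\<close>, the stationarity of \<open>V\<close>
      rewrites \<open>h\<close> as \<open>a^n r\<close> with \<open>r\<close> in the fixed
      \<open>G N\<close>, and cancellation gives \<open>?r = r\<close>.\<close>
    let ?r = "s \<otimes> g \<ominus> a \<otimes> g'"
    have "a [^] n \<otimes> ?r = s \<otimes> (a [^] n \<otimes> g) \<ominus> (a [^] n \<otimes> a) \<otimes> g'"
      using cl g *(2) an acl by algebra
    also have "\<dots> = ((a [^] n \<otimes> a) \<otimes> g' \<oplus> h) \<ominus> (a [^] n \<otimes> a) \<otimes> g'" using *(4) by simp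
    also have "\<dots> = h" using cl g *(2) an acl by algebra
    finally have eq: "a [^] n \<otimes> ?r = h" .
    have rc: "?r \<in> carrier D" using cl g * by simp
    then obtain N' where "?r \<in> G N'" using gen by blast
    then have "h \<in> V N'" unfolding V_def using eq *(3) by auto
    then have "h \<in> V N" using stableV by blast
    then obtain r where r: "r \<in> G N" "h = a [^] n \<otimes> r" unfolding V_def by blast
    have "r \<in> carrier D" using r(1) span_pow_closed by blast
    moreover have "a [^] n \<noteq> \<zero>"
    proof (induction n)
      case 0 show ?case by simp
    next
      case (Suc n) then show ?case using integral[of "a [^] n" a] a(2) by auto
    qed
    ultimately have "?r = r" using eq r(2) rc an by (metis m_lcancel)
    moreover have "s \<otimes> g = a \<otimes> g' \<oplus> ?r" using cl g *(2) acl by algebra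
    ultimately have "s \<otimes> g = a \<otimes> g' \<oplus> r" by simp
    then show "\<exists>s\<in>M. \<exists>g'\<in>carrier D. \<exists>r\<in>G N. s \<otimes> g = a \<otimes> g' \<oplus> r" using * r by blast
  qed
qed

end

section \<open>Primes of a polynomial ring in one variable\<close>

lemma (in ideal) finsum_mem:
  assumes "\<And>i. i \<in> A \<Longrightarrow> f i \<in> I"
  shows "finsum R f A \<in> I"
  using assms
proof (induction A rule: infinite_finite_induct)
  case (insert a A)
  then have "f \<in> A \<rightarrow> carrier R" "f a \<in> carrier R" using a_subset by auto
  then show ?case using insert by simp
qed auto

lemma (in ideal) minus_mem: "a \<in> I \<Longrightarrow> b \<in> I \<Longrightarrow> a \<ominus> b \<in> I"
  by (simp add: a_minus_def)

lemma (in ideal) mem_if_add_mem: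
  assumes "a \<in> carrier R" "b \<in> I" "a \<oplus> b \<in> I"
  shows "a \<in> I"
proof -
  have "b \<in> carrier R" using assms a_subset by blast
  then have "(a \<oplus> b) \<ominus> b = a" using assms(1) by algebra
  then show ?thesis using minus_mem[OF assms(3,2)] by simp
qed

lemma (in primeideal) one_notin: "\<one> \<notin> I"
  using one_imp_carrier I_notcarr by blast

lemma (in ideal) FactRing_zero [simp]: "\<zero>\<^bsub>R Quot I\<^esub> = I"
  by (simp add: FactRing_def)

lemma (in ideal) rcos_eq_zero_iff: "a \<in> carrier R \<Longrightarrow> I +> a = \<zero>\<^bsub>R Quot I\<^esub> \<longleftrightarrow> a \<in> I"
  using rcos_const_imp_mem a_rcos_zero[OF is_ideal] by auto

lemma (in ideal) rcos_surj: "(+>) I ` carrier R = carrier (R Quot I)"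
  unfolding FactRing_def A_RCOSETS_def' by auto

lemma (in noetherian_ring) ideal_acc:
  fixes U :: "nat \<Rightarrow> 'a set"
  assumes "\<And>n. ideal (U n) R" "\<And>n. U n \<subseteq> U (Suc n)"
  shows "\<exists>n. \<forall>m\<ge>n. U m = U n"
proof -
  have mono: "U m \<subseteq> U n" if "m \<le> n" for m n
    by (rule lift_Suc_mono_le[of U]) (use assms(2) that in blast)+
  have "subset.chain {I. ideal I R} (range U)"
    unfolding subset_chain_def using assms(1) mono by (auto, meson nat_le_linear subsetD)
  then have "\<Union>(range U) \<in> range U" using ideal_chain_is_trivial by blast
  then obtain n where "\<Union>(range U) = U n" by blast
  then have "U m = U n" if "m \<ge> n" for m using mono[OF that] by blast
  then show ?thesis by blast
qed

section \<open>Extension and contraction of ideals between \<open>R\<close> and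
  \<open>R[x]\<close>\<close>

definition ext_poly :: "('a, 'm) ring_scheme \<Rightarrow> 'a set \<Rightarrow> (nat \<Rightarrow> 'a) set"
  where "ext_poly R p = {f \<in> carrier (UP R). \<forall>n. up_ring.coeff (UP R) f n \<in> p}"

definition contr_poly :: "('a, 'm) ring_scheme \<Rightarrow> (nat \<Rightarrow> 'a) set \<Rightarrow> 'a set"
  where "contr_poly R Q = {a \<in> carrier R. up_ring.monom (UP R) a 0 \<in> Q}"

context UP_cring
begin

abbreviation "cf \<equiv> up_ring.coeff P"
abbreviation "mn \<equiv> up_ring.monom P"
abbreviation "cst a \<equiv> mn a 0"
abbreviation "scalars \<equiv> cst ` carrier R"
abbreviation "indet \<equiv> mn \<one> (Suc 0)"
abbreviation "ext p \<equiv> ext_poly R p"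
abbreviation "contr Q \<equiv> contr_poly R Q"

lemma ext_def: "ext p = {f \<in> carrier P. \<forall>n. cf f n \<in> p}"
  by (simp add: ext_poly_def P_def)

lemma contr_def: "contr Q = {a \<in> carrier R. cst a \<in> Q}"
  by (simp add: contr_poly_def P_def)

lemma cst_hom: "ring_hom_ring R P cst"
  by (rule ring_hom_ringI2[OF R.ring_axioms P.ring_axioms const_ring_hom])

lemma coeff_cst_mult: "a \<in> carrier R \<Longrightarrow> f \<in> carrier P \<Longrightarrow> cf (cst a \<otimes>\<^bsub>P\<^esub> f) n = a \<otimes> cf f n"
  by (simp add: monom_mult_is_smult)

lemma cst_mult_monom: "a \<in> carrier R \<Longrightarrow> cst a \<otimes>\<^bsub>P\<^esub> mn b n = mn (a \<otimes> b) n" if "b \<in> carrier R"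
  using that monom_mult[of a b 0 n] by simp

lemma X_pow: "indet [^]\<^bsub>P\<^esub> n = mn \<one> n"
  using monom_pow[of \<one> "Suc 0" n] by simp

lemma power_basis_UP: "power_basis P scalars indet"
  by (intro power_basis.intro power_basis_axioms.intro P.is_cring
      ring_hom_ring.img_is_subring[OF cst_hom R.carrier_is_subring]) simp

text \<open>In the polynomial ring, unlike in its quotients, expressions in the powers of the
  indeterminate are unique, so the degree bound can be read off the coefficients.\<close>

lemma span_pow_eq: "span_pow P scalars indet n = {f \<in> carrier P. \<forall>i\<ge>n. cf f i = \<zero>}"
proof (induction n)
  case 0
  have "f = \<zero>\<^bsub>P\<^esub>" if "f \<in> carrier P" "\<forall>i. cf f i = \<zero>" for f
    by (rule up_eqI) (use that in auto)
  then show ?case by auto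
next
  case (Suc n)
  show ?case
  proof (rule subset_antisym; rule subsetI)
    fix f assume "f \<in> span_pow P scalars indet (Suc n)"
    then obtain g a where *: "f = g \<oplus>\<^bsub>P\<^esub> cst a \<otimes>\<^bsub>P\<^esub> indet [^]\<^bsub>P\<^esub> n" "g \<in> span_pow P scalars indet n" "a \<in> carrier R"
      by auto
    then show "f \<in> {f \<in> carrier P. \<forall>i\<ge>Suc n. cf f i = \<zero>}"
      unfolding X_pow Suc by (auto simp: cst_mult_monom)
  next
    fix f assume "f \<in> {f \<in> carrier P. \<forall>i\<ge>Suc n. cf f i = \<zero>}"
    then have f: "f \<in> carrier P" "\<And>i. i \<ge> Suc n \<Longrightarrow> cf f i = \<zero>" by auto
    let ?a = "cf f n"
    let ?g = "f \<ominus>\<^bsub>P\<^esub> mn ?a n"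
    have "cf ?g i = \<zero>" if "i \<ge> n" for i
      using f that by (cases "i = n") (auto simp: R.minus_eq R.r_neg)
    moreover have g: "?g \<in> carrier P" using f by simp
    ultimately have "?g \<in> span_pow P scalars indet n" unfolding Suc by blast
    moreover have "f = ?g \<oplus>\<^bsub>P\<^esub> cst ?a \<otimes>\<^bsub>P\<^esub> indet [^]\<^bsub>P\<^esub> n"
    proof -
      have "f = ?g \<oplus>\<^bsub>P\<^esub> mn ?a n" using f(1) monom_closed[OF coeff_closed[OF f(1)], of n n] by algebra
      then show ?thesis unfolding X_pow using f by (simp add: cst_mult_monom)
    qed
    ultimately show "f \<in> span_pow P scalars indet (Suc n)"
      using power_basis.span_pow_SucI[OF power_basis_UP, of ?g n "cst ?a"] f(1) by simp
  qed
qed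

lemma ex_span_pow: "f \<in> carrier P \<Longrightarrow> \<exists>n. f \<in> span_pow P scalars indet n"
  unfolding span_pow_eq using deg_aboveD by (auto intro!: exI[of _ "Suc (deg R f)"])

lemma ext_ideal:
  assumes "ideal p R"
  shows "ideal (ext p) P"
proof (rule P.ideal_if_submod[OF submodI])
  interpret p: ideal p R by fact
  show "ext p \<subseteq> carrier P" "\<zero>\<^bsub>P\<^esub> \<in> ext p" unfolding ext_def by auto
  show "f \<oplus>\<^bsub>P\<^esub> g \<in> ext p" if "f \<in> ext p" "g \<in> ext p" for f g
    using that unfolding ext_def by auto
  fix a x assume a: "a \<in> ext p" and x: "x \<in> carrier P"
  then have a': "a \<in> carrier P" "\<And>n. cf a n \<in> p" unfolding ext_def by auto
  have "cf (x \<otimes>\<^bsub>P\<^esub> a) n \<in> p" for n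
    using a' x by (auto intro!: p.finsum_mem p.I_l_closed)
  then show "x \<otimes>\<^bsub>P\<^esub> a \<in> ext p" unfolding ext_def using a' x by auto
qed

lemma ext_primeideal:
  assumes "primeideal p R"
  shows "primeideal (ext p) P"
proof -
  interpret p: primeideal p R by fact
  show ?thesis
  proof (rule primeidealI[OF ext_ideal[OF p.is_ideal] P.is_cring])
    have "cf \<one>\<^bsub>P\<^esub> 0 \<notin> p" using p.one_notin by simp
    then have "\<one>\<^bsub>P\<^esub> \<notin> ext p" unfolding ext_def by blast
    then show "carrier P \<noteq> ext p" by blast
  next
    fix f g assume fg: "f \<in> carrier P" "g \<in> carrier P" "f \<otimes>\<^bsub>P\<^esub> g \<in> ext p"
    show "f \<in> ext p \<or> g \<in> ext p"
    proof (rule ccontr)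
      assume "\<not> ?thesis"
      then have ex: "\<exists>n. cf f n \<notin> p" "\<exists>n. cf g n \<notin> p" unfolding ext_def using fg by auto
      \<comment> \<open>The lowest coefficients outside \<open>p\<close>. In degree
        \<open>i + j\<close> of the product, every summand except the one at \<open>i\<close> has a
        factor in \<open>p\<close>.\<close>
      define i where "i = (LEAST n. cf f n \<notin> p)"
      define j where "j = (LEAST n. cf g n \<notin> p)"
      have i: "cf f i \<notin> p" "\<And>k. k < i \<Longrightarrow> cf f k \<in> p"
        unfolding i_def using LeastI_ex[OF ex(1)] not_less_Least by blast+
      have j: "cf g j \<notin> p" "\<And>k. k < j \<Longrightarrow> cf g k \<in> p"
        unfolding j_def using LeastI_ex[OF ex(2)] not_less_Least by blast+
      let ?t = "\<lambda>k. cf f k \<otimes> cf g (i + j - k)"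
      have t: "?t k \<in> p" if "k \<in> {..i + j} - {i}" for k
      proof (cases "k < i")
        case True then show ?thesis using i fg by (auto intro: p.I_r_closed)
      next
        case False
        then have "i + j - k < j" using that by auto
        then show ?thesis using j fg by (auto intro: p.I_l_closed)
      qed
      have eq: "{..i + j} = insert i ({..i + j} - {i})" by auto
      have "cf (f \<otimes>\<^bsub>P\<^esub> g) (i + j) = (\<Oplus>k\<in>insert i ({..i + j} - {i}). ?t k)"
        using fg eq by simp
      also have "\<dots> = ?t i \<oplus> (\<Oplus>k\<in>{..i + j} - {i}. ?t k)"
        by (subst R.finsum_insert) (use fg in auto)
      finally have "?t i \<oplus> (\<Oplus>k\<in>{..i + j} - {i}. ?t k) = cf (f \<otimes>\<^bsub>P\<^esub> g) (i + j)" by (rule sym)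
      moreover have "cf (f \<otimes>\<^bsub>P\<^esub> g) (i + j) \<in> p" using fg(3) unfolding ext_def by blast
      ultimately have "?t i \<oplus> (\<Oplus>k\<in>{..i + j} - {i}. ?t k) \<in> p" by (simp only:)
      moreover have "(\<Oplus>k\<in>{..i + j} - {i}. ?t k) \<in> p" by (rule p.finsum_mem) (rule t)
      moreover have "?t i \<in> carrier R" using fg by simp
      ultimately have "?t i \<in> p" using p.mem_if_add_mem by blast
      then have "cf f i \<otimes> cf g j \<in> p" by simp
      then show False using p.I_prime[of "cf f i" "cf g j"] i(1) j(1) fg by simp
    qed
  qed
qed

lemma monom_mem_ext: "ideal p R \<Longrightarrow> a \<in> p \<Longrightarrow> mn a n \<in> ext p"
  unfolding ext_def using ideal.Icarr[of p R a] additive_subgroup.zero_closed[OF ideal.axioms(1), of p R]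
  by auto

lemma contr_primeideal: "primeideal Q P \<Longrightarrow> primeideal (contr Q) R"
  unfolding contr_def by (rule ring_hom_ring.primeideal_vimage[OF cst_hom R.is_cring])

lemma contr_ext: "ideal p R \<Longrightarrow> contr (ext p) = p"
proof -
  assume p: "ideal p R"
  interpret p: ideal p R by fact
  have "a \<in> p" if "a \<in> contr (ext p)" for a
  proof -
    have a: "a \<in> carrier R" "cf (cst a) 0 \<in> p" using that unfolding contr_def ext_def by blast+
    show ?thesis using a(2) unfolding coeff_monom[OF a(1)] by simp
  qed
  moreover have "a \<in> contr (ext p)" if "a \<in> p" for a
    using monom_mem_ext[OF p that] that p.Icarr unfolding contr_def by auto
  ultimately show ?thesis by blast
qed

lemma ext_mono: "p \<subseteq> q \<Longrightarrow> ext p \<subseteq> ext q"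
  unfolding ext_def by auto

lemma contr_mono: "p \<subseteq> q \<Longrightarrow> contr p \<subseteq> contr q"
  unfolding contr_def by auto

lemma ext_contr: "ideal Q P \<Longrightarrow> ext (contr Q) \<subseteq> Q"
proof
  fix f assume Q: "ideal Q P" and f: "f \<in> ext (contr Q)"
  interpret Q: ideal Q P by fact
  interpret B: power_basis P scalars indet by (rule power_basis_UP)
  have f': "f \<in> carrier P" "\<And>n. cf f n \<in> contr Q" using f unfolding ext_def by auto
  obtain N where "f \<in> span_pow P scalars indet N" using ex_span_pow f' by blast
  then show "f \<in> Q" using f'
  proof (induction N arbitrary: f)
    case 0 then show ?case by simp
  next
    case (Suc N)
    then obtain g a where *: "f = g \<oplus>\<^bsub>P\<^esub> cst a \<otimes>\<^bsub>P\<^esub> indet [^]\<^bsub>P\<^esub> N" "g \<in> span_pow P scalars indet N" "a \<in> carrier R"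
      by auto
    have g: "g \<in> carrier P" "\<And>i. i \<ge> N \<Longrightarrow> cf g i = \<zero>" using *(2) unfolding span_pow_eq by auto
    have f: "f = g \<oplus>\<^bsub>P\<^esub> mn a N" using * unfolding X_pow by (simp add: cst_mult_monom)
    have cfN: "cf f N = a" using g *(3) unfolding f by simp
    have cfi: "cf f i = cf g i" if "i \<noteq> N" for i using g *(3) that unfolding f by simp
    have "cf g i \<in> contr Q" for i
    proof (cases "i \<ge> N")
      case True
      then show ?thesis using g(2) Q.zero_closed unfolding contr_def by simp
    next
      case False
      then show ?thesis using cfi[of i] Suc.prems(3)[of i] by simp
    qed
    then have "g \<in> Q" using Suc.IH *(2) g by blast
    moreover have "cst a \<in> Q" using Suc.prems(3)[of N] unfolding cfN contr_def by blast
    then have "cst a \<otimes>\<^bsub>P\<^esub> indet [^]\<^bsub>P\<^esub> N \<in> Q" by (rule Q.I_r_closed) simp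
    ultimately show ?case unfolding *(1) by (rule Q.a_closed)
  qed
qed

text \<open>Leading terms with coefficient in \<open>q\<close> lie in
  \<open>ext q \<subseteq> Q\<close> and can be stripped without leaving \<open>Q\<close>. As
  \<open>f\<close> is not in \<open>ext q\<close>, the stripping must stop at a leading coefficient
  outside \<open>q\<close>.\<close>

lemma ex_lead_notin:
  assumes q: "ideal q R" and Q: "ideal Q P" and sub: "ext q \<subseteq> Q" and f: "f \<in> Q" "f \<notin> ext q"
    "f \<in> span_pow P scalars indet N"
  obtains d f0 c where "d < N" "f0 \<in> span_pow P scalars indet d" "c \<in> carrier R" "c \<notin> q"
    "f0 \<oplus>\<^bsub>P\<^esub> mn c d \<in> Q"
  using f
proof (induction N arbitrary: f thesis)
  case 0
  interpret e: ideal "ext q" P by (rule ext_ideal[OF q])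
  from 0 show ?case using e.zero_closed by simp
next
  case (Suc N)
  interpret Q: ideal Q P by fact
  interpret e: ideal "ext q" P by (rule ext_ideal[OF q])
  from Suc.prems obtain g a where *: "f = g \<oplus>\<^bsub>P\<^esub> cst a \<otimes>\<^bsub>P\<^esub> indet [^]\<^bsub>P\<^esub> N" "g \<in> span_pow P scalars indet N" "a \<in> carrier R"
    by auto
  have g: "g \<in> carrier P" using *(2) unfolding span_pow_eq by auto
  have f: "f = g \<oplus>\<^bsub>P\<^esub> mn a N" using * unfolding X_pow by (simp add: cst_mult_monom)
  show ?case
  proof (cases "a \<in> q")
    case False
    then show ?thesis using Suc.prems(1)[of N g a] * Suc.prems(2) f by simp
  next
    case True
    then have m: "mn a N \<in> ext q" by (rule monom_mem_ext[OF q])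
    have "g \<in> Q" using Q.mem_if_add_mem[OF g] Suc.prems(2) m sub f by blast
    moreover have "g \<notin> ext q" using Suc.prems(3) m e.a_closed f by blast
    ultimately obtain d f0 c where **: "d < N" "f0 \<in> span_pow P scalars indet d" "c \<in> carrier R" "c \<notin> q"
      "f0 \<oplus>\<^bsub>P\<^esub> mn c d \<in> Q" using Suc.IH[OF _ _ _ *(2)] by blast
    show ?thesis by (rule Suc.prems(1)[OF _ **(2-5)]) (use **(1) in simp)
  qed
qed

lemma contr_pow_notin:
  assumes "primeideal Q P" "c \<in> carrier R" "c \<notin> contr Q"
  shows "cst c [^]\<^bsub>P\<^esub> (k::nat) \<notin> Q"
proof -
  interpret Q: primeideal Q P by fact
  show ?thesis
  proof (induction k)
    case 0 then show ?case using Q.one_notin by simp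
  next
    case (Suc k)
    then show ?case using Q.I_prime[of "cst c [^]\<^bsub>P\<^esub> k" "cst c"] assms unfolding contr_def by auto
  qed
qed

text \<open>The primes over \<open>p\<close> are those of a polynomial ring over the residue field
  of \<open>p\<close>, where nonzero primes are maximal. Elements outside \<open>p\<close> are not
  inverted here: division by a polynomial of least degree in \<open>Q'\<close> is done up to powers
  of its leading coefficient, which stay outside both primes.\<close>

lemma no_three_primes:
  assumes p: "primeideal p R" and Q: "primeideal Q P" and Q': "primeideal Q' P"
    and lt: "ext p \<subset> Q" "Q \<subset> Q'" and contr: "contr Q' = p"
  shows False
proof -
  interpret p: primeideal p R by fact
  interpret Q: primeideal Q P by fact
  interpret Q': primeideal Q' P by fact
  interpret B: power_basis P scalars indet by (rule power_basis_UP)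
  interpret e: primeideal "ext p" P by (rule ext_primeideal[OF p])
  have contrQ: "contr Q = p"
    using contr_mono[of Q Q'] contr_mono[of "ext p" Q] lt contr contr_ext[OF p.is_ideal] by auto
  \<comment> \<open>The least \<open>n\<close> with \<open>L Z n\<close> exceeds by one the minimal
    degree of an element of \<open>Z\<close> outside \<open>ext p\<close>.\<close>
  define L where "L Z n \<longleftrightarrow> (\<exists>f\<in>Z - ext p. f \<in> B.G n)" for Z n
  have exL: "\<exists>n. L Z n" if "ext p \<subset> Z" "Z \<subseteq> carrier P" for Z
    unfolding L_def using that ex_span_pow by blast
  define d' where "d' = (LEAST n. L Q' n)"
  have sub: "ext p \<subset> Q'" "Q \<subseteq> carrier P" "Q' \<subseteq> carrier P" using lt Q.a_subset Q'.a_subset by auto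
  have d': "L Q' d'" "\<And>n. n < d' \<Longrightarrow> \<not> L Q' n"
    unfolding d'_def using LeastI_ex[OF exL[OF sub(1,3)]] not_less_Least by blast+
  from d'(1) obtain f1 where "f1 \<in> Q'" "f1 \<notin> ext p" "f1 \<in> B.G d'" unfolding L_def by blast
  then obtain d f0 c where f: "d < d'" "f0 \<in> B.G d" "c \<in> carrier R" "c \<notin> p" "f0 \<oplus>\<^bsub>P\<^esub> mn c d \<in> Q'"
    using ex_lead_notin[OF p.is_ideal Q'.is_ideal _ ] sub(1) by blast
  define f where "f = f0 \<oplus>\<^bsub>P\<^esub> mn c d"
  have f': "f = f0 \<oplus>\<^bsub>P\<^esub> cst c \<otimes>\<^bsub>P\<^esub> indet [^]\<^bsub>P\<^esub> d" "f \<in> Q'" using f unfolding f_def X_pow by (simp_all add: cst_mult_monom)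
  then have fP: "f \<in> carrier P" using Q'.Icarr by blast
  have low: "r \<in> ext p" if "r \<in> Q'" "r \<in> B.G d" for r
    using d'(2)[OF f(1)] that unfolding L_def by blast
  \<comment> \<open>The remainder of a pseudo-division by \<open>f\<close> stays in
    \<open>Q'\<close> and has degree below \<open>d\<close>, so minimality places it in
    \<open>ext p\<close>.\<close>
  have divs: "\<exists>k u r. u \<in> B.G (n - d) \<and> r \<in> ext p \<and> cst c [^]\<^bsub>P\<^esub> (k::nat) \<otimes>\<^bsub>P\<^esub> g = u \<otimes>\<^bsub>P\<^esub> f \<oplus>\<^bsub>P\<^esub> r"
    if g: "g \<in> Q'" "g \<in> B.G n" for g n
  proof -
    obtain u r k where *: "u \<in> B.G (n - d)" "r \<in> B.G d" "cst c [^]\<^bsub>P\<^esub> (k::nat) \<otimes>\<^bsub>P\<^esub> g = u \<otimes>\<^bsub>P\<^esub> f \<oplus>\<^bsub>P\<^esub> r"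
      using B.pseudo_division[OF f'(1) f(2) _ g(2)] f(3) by blast
    have cl: "u \<in> carrier P" "r \<in> carrier P" "g \<in> carrier P" using * B.span_pow_closed g Q'.Icarr by blast+
    have "u \<otimes>\<^bsub>P\<^esub> f \<in> Q'" using f'(2) cl by (simp add: Q'.I_l_closed)
    moreover have "r \<oplus>\<^bsub>P\<^esub> u \<otimes>\<^bsub>P\<^esub> f = cst c [^]\<^bsub>P\<^esub> (k::nat) \<otimes>\<^bsub>P\<^esub> g" using *(3) cl fP by (simp add: P.a_comm)
    moreover have "cst c [^]\<^bsub>P\<^esub> (k::nat) \<otimes>\<^bsub>P\<^esub> g \<in> Q'" using g f(3) by (simp add: Q'.I_l_closed)
    ultimately have "r \<in> Q'" using Q'.mem_if_add_mem cl(2) by metis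
    then show ?thesis using * low by blast
  qed
  have fQ: "f \<notin> Q"
  proof
    assume fQ: "f \<in> Q"
    have "g \<in> Q" if g: "g \<in> Q'" for g
    proof -
      obtain n where "g \<in> B.G n" using ex_span_pow sub g by blast
      then obtain k u r n where *: "u \<in> B.G (n - d)" "r \<in> ext p" "cst c [^]\<^bsub>P\<^esub> (k::nat) \<otimes>\<^bsub>P\<^esub> g = u \<otimes>\<^bsub>P\<^esub> f \<oplus>\<^bsub>P\<^esub> r"
        using divs[OF g] by blast
      have "u \<otimes>\<^bsub>P\<^esub> f \<oplus>\<^bsub>P\<^esub> r \<in> Q" using fQ * lt B.span_pow_closed
        by (intro Q.a_closed Q.I_l_closed) blast+
      then have "cst c [^]\<^bsub>P\<^esub> k \<otimes>\<^bsub>P\<^esub> g \<in> Q" using *(3) by simp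
      moreover have "cst c [^]\<^bsub>P\<^esub> k \<notin> Q" using contr_pow_notin[OF Q f(3), of k] contrQ f(4) by simp
      ultimately show ?thesis using Q.I_prime[of "cst c [^]\<^bsub>P\<^esub> k" g] f(3) Q'.Icarr[OF g] by simp
    qed
    then show False using lt(2) by blast
  qed
  \<comment> \<open>A minimal \<open>g\<close> in \<open>Q\<close> outside \<open>ext p\<close> is,
    up to a power of \<open>c\<close>, equal to \<open>u f\<close> modulo \<open>ext p\<close>. As
    \<open>f \<notin> Q\<close>, the factor \<open>u\<close> lies in \<open>Q\<close>; its smaller
    degree bound then forces it into \<open>ext p\<close>, and \<open>g\<close> follows.\<close>
  define e where "e = (LEAST n. L Q n)"
  have e: "L Q e" "\<And>n. n < e \<Longrightarrow> \<not> L Q n"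
    unfolding e_def using LeastI_ex[OF exL[OF lt(1) sub(2)]] not_less_Least by blast+
  from e(1) obtain g where g: "g \<in> Q" "g \<notin> ext p" "g \<in> B.G e" unfolding L_def by blast
  then have "g \<in> Q'" using lt(2) by blast
  from divs[OF this g(3)]
  obtain k u r where *: "u \<in> B.G (e - d)" "r \<in> ext p" "cst c [^]\<^bsub>P\<^esub> (k::nat) \<otimes>\<^bsub>P\<^esub> g = u \<otimes>\<^bsub>P\<^esub> f \<oplus>\<^bsub>P\<^esub> r"
    by blast
  have cl: "u \<in> carrier P" "g \<in> carrier P" using * B.span_pow_closed g sub by blast+
  have "cst c [^]\<^bsub>P\<^esub> k \<otimes>\<^bsub>P\<^esub> g \<in> Q" using g f(3) by (simp add: Q.I_l_closed)
  then have "u \<otimes>\<^bsub>P\<^esub> f \<in> Q" using Q.mem_if_add_mem[of "u \<otimes>\<^bsub>P\<^esub> f" r] *(2,3) lt(1) cl fP by auto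
  then have uQ: "u \<in> Q" using Q.I_prime[OF cl(1) fP] fQ by blast
  have "u \<in> ext p"
  proof (cases "d = 0")
    \<comment> \<open>A polynomial \<open>f\<close> of degree zero would be the constant
      \<open>c\<close>, which would then lie in the contraction \<open>p\<close> of
      \<open>Q'\<close>.\<close>
    case True
    then have "f0 = \<zero>\<^bsub>P\<^esub>" using f(2) by simp
    then have "cst c \<in> Q'" using f(3,5) True by simp
    then have "c \<in> p" using contr f(3) unfolding contr_def by blast
    then show ?thesis using f(4) by blast
  next
    case False
    have "e > 0"
    proof (rule ccontr)
      assume "\<not> e > 0"
      then have "g = \<zero>\<^bsub>P\<^esub>" using g(3) by simp
      then show False using g(2) e.zero_closed by simp
    qed
    then have "e - d < e" using False by simp
    then show ?thesis using e(2) uQ *(1) unfolding L_def by blast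
  qed
  then have "u \<otimes>\<^bsub>P\<^esub> f \<oplus>\<^bsub>P\<^esub> r \<in> ext p" using *(2) fP by (intro e.a_closed e.I_r_closed)
  then have "cst c [^]\<^bsub>P\<^esub> k \<otimes>\<^bsub>P\<^esub> g \<in> ext p" using *(3) by simp
  then have "g \<in> ext p"
    using e.I_prime[of "cst c [^]\<^bsub>P\<^esub> k" g] contr_pow_notin[OF e.primeideal f(3), of k]
      contr_ext[OF p.is_ideal] f(3,4) cl by auto
  then show False using g by blast
qed

end

section \<open>Primes between the extensions of adjacent primes\<close>

lemma span_pow_image:
  assumes "ring_hom_cring P D h" "K \<subseteq> carrier P" "x \<in> carrier P"
  shows "span_pow D (h ` K) (h x) n = h ` span_pow P K x n \<and> span_pow P K x n \<subseteq> carrier P"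
proof -
  interpret h: ring_hom_cring P D h by fact
  show ?thesis
  proof (induction n)
    case 0
    show ?case by simp
  next
    case (Suc n)
    have sub: "span_pow P K x (Suc n) \<subseteq> carrier P" using Suc assms by auto
    have eq: "h (g \<oplus>\<^bsub>P\<^esub> k \<otimes>\<^bsub>P\<^esub> x [^]\<^bsub>P\<^esub> n) = h g \<oplus>\<^bsub>D\<^esub> h k \<otimes>\<^bsub>D\<^esub> h x [^]\<^bsub>D\<^esub> n"
      if "g \<in> span_pow P K x n" "k \<in> K" for g k
    proof -
      have "g \<in> carrier P" "k \<in> carrier P" using that Suc assms(2) by blast+
      then show ?thesis using assms(3) by simp
    qed
    have "span_pow D (h ` K) (h x) (Suc n) = h ` span_pow P K x (Suc n)"
    proof (rule subset_antisym; rule subsetI)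
      fix y assume "y \<in> span_pow D (h ` K) (h x) (Suc n)"
      then obtain g k where gk: "y = g \<oplus>\<^bsub>D\<^esub> k \<otimes>\<^bsub>D\<^esub> h x [^]\<^bsub>D\<^esub> n" "g \<in> span_pow D (h ` K) (h x) n" "k \<in> h ` K" by auto
      then obtain g' k' where "g = h g'" "k = h k'" "g' \<in> span_pow P K x n" "k' \<in> K" using Suc by blast
      then show "y \<in> h ` span_pow P K x (Suc n)"
        using gk eq[of g' k'] by (intro image_eqI[of _ _ "g' \<oplus>\<^bsub>P\<^esub> k' \<otimes>\<^bsub>P\<^esub> x [^]\<^bsub>P\<^esub> n"]) auto
    next
      fix y assume "y \<in> h ` span_pow P K x (Suc n)"
      then obtain g k where "y = h (g \<oplus>\<^bsub>P\<^esub> k \<otimes>\<^bsub>P\<^esub> x [^]\<^bsub>P\<^esub> n)" "g \<in> span_pow P K x n" "k \<in> K" by auto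
      then show "y \<in> span_pow D (h ` K) (h x) (Suc n)" using eq[of g k] Suc by auto
    qed
    then show ?case using sub by blast
  qed
qed

context UP_cring
begin

text \<open>Adjacency of \<open>q\<close> and \<open>p\<close> becomes \<open>p_min\<close>,
  Noetherianity becomes \<open>acc\<close>, and \<open>Q \<noteq> ext q\<close> becomes
  \<open>alg\<close>. The inclusion \<open>Q \<subseteq> ext p\<close> is used to identify the
  contraction of \<open>Q\<close> and again for the final contradiction.\<close>

lemma no_prime_between:
  assumes noeth: "noetherian_ring R" and q: "primeideal q R" and p: "primeideal p R" and qp: "q \<subset> p"
    and adj: "\<And>r. primeideal r R \<Longrightarrow> q \<subset> r \<Longrightarrow> r \<subset> p \<Longrightarrow> False"
    and Q: "primeideal Q P" and lt: "ext q \<subset> Q" "Q \<subset> ext p"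
  shows False
proof -
  define D where "D = P Quot Q"
  define phi where "phi = (+>\<^bsub>P\<^esub>) Q"
  define psi where "psi a = phi (cst a)" for a
  have Qi: "ideal Q P" and qi: "ideal q R" and pi: "ideal p R" using Q q p by (auto simp: primeideal_def)
  \<comment> \<open>The contraction lies between the adjacent primes \<open>q\<close> and
    \<open>p\<close>; if it were \<open>p\<close>, then \<open>Q\<close> would contain
    \<open>ext p\<close>.\<close>
  have contrQ: "contr Q = q"
  proof (rule ccontr)
    assume ne: "contr Q \<noteq> q"
    have 1: "q \<subseteq> contr Q" "contr Q \<subseteq> p"
      using contr_mono[of "ext q" Q] contr_mono[of Q "ext p"] lt contr_ext[OF qi] contr_ext[OF pi] by auto
    have "contr Q = p" using adj[OF contr_primeideal[OF Q]] 1 ne by blast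
    then show False using ext_contr[OF Qi] lt by blast
  qed
  interpret D: "domain" D unfolding D_def by (rule primeideal.quotient_is_domain[OF Q])
  interpret phi: ring_hom_cring P D phi
    unfolding D_def phi_def by (rule ideal.rcos_ring_hom_cring[OF Qi P.is_cring])
  have phi_zero: "phi f = \<zero>\<^bsub>D\<^esub> \<longleftrightarrow> f \<in> Q" if "f \<in> carrier P" for f
    unfolding D_def phi_def by (rule ideal.rcos_eq_zero_iff[OF Qi that])
  have phi_surj: "phi ` carrier P = carrier D"
    unfolding D_def phi_def by (rule ideal.rcos_surj[OF Qi])
  have psi_hom: "psi \<in> ring_hom R D"
    using ring_hom_trans[OF const_ring_hom phi.homh] unfolding psi_def comp_def by simp
  interpret psi: ring_hom_cring R D psi
    by (intro ring_hom_cringI R.is_cring D.is_cring psi_hom)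
  have psi_zero: "psi a = \<zero>\<^bsub>D\<^esub> \<longleftrightarrow> a \<in> q" if "a \<in> carrier R" for a
    using that phi_zero[of "cst a"] contrQ unfolding psi_def contr_def by auto
  \<comment> \<open>The kernel of \<open>psi\<close> is \<open>q\<close>, which is contained in
    \<open>p\<close>, so membership in \<open>p\<close> can be tested on images.\<close>
  have psi_p: "a \<in> p" if a: "a \<in> carrier R" "psi a \<in> psi ` p" for a
  proof -
    from a(2) obtain b where b: "psi a = psi b" "b \<in> p" by blast
    have bR: "b \<in> carrier R" using ideal.Icarr[OF pi b(2)] .
    have "psi (a \<ominus> b) = psi a \<ominus>\<^bsub>D\<^esub> psi b" using a bR by (simp add: a_minus_def)
    also have "\<dots> = \<zero>\<^bsub>D\<^esub>" using b a bR by (simp add: D.r_right_minus_eq)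
    finally have "psi (a \<ominus> b) = \<zero>\<^bsub>D\<^esub>" .
    then have "a \<ominus> b \<in> q" using psi_zero[OF R.minus_closed[OF a(1) bR]] by blast
    then have "a \<ominus> b \<in> p" using qp by blast
    then have "(a \<ominus> b) \<oplus> b \<in> p" using b(2) additive_subgroup.a_closed[OF ideal.axioms(1)[OF pi]] by blast
    moreover have "(a \<ominus> b) \<oplus> b = a" using a(1) bR by algebra
    ultimately show ?thesis by simp
  qed
  define K where "K = psi ` carrier R"
  define x where "x = phi indet"
  have psiK: "psi a \<in> K" if "a \<in> carrier R" for a unfolding K_def using that by (rule imageI)
  have K_eq: "K = phi ` scalars" unfolding K_def psi_def by auto
  have scal: "scalars \<subseteq> carrier P" by (rule image_subsetI) simp
  have span: "span_pow D K x n = phi ` span_pow P scalars indet n" for n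
    unfolding K_eq x_def using span_pow_image[OF phi.ring_hom_cring_axioms scal, of indet n] by simp
  have preim: "ideal {a \<in> carrier R. psi a \<in> U} R" if U: "submod D K U" for U
  proof (rule R.ideal_if_submod[OF submodI])
    note UD = submodD[OF U]
    show "{a \<in> carrier R. psi a \<in> U} \<subseteq> carrier R" by blast
    show "\<zero> \<in> {a \<in> carrier R. psi a \<in> U}" using UD(2) by simp
    show "a \<oplus> b \<in> {a \<in> carrier R. psi a \<in> U}"
      if "a \<in> {a \<in> carrier R. psi a \<in> U}" "b \<in> {a \<in> carrier R. psi a \<in> U}" for a b
      using that UD(3)[of "psi a" "psi b"] by simp
    fix r a assume r: "r \<in> carrier R" and a: "a \<in> {a \<in> carrier R. psi a \<in> U}"
    then have "psi r \<otimes>\<^bsub>D\<^esub> psi a \<in> U" using UD(4)[OF psiK[OF r], of "psi a"] by simp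
    then show "r \<otimes> a \<in> {a \<in> carrier R. psi a \<in> U}" using a r by simp
  qed
  have img: "U = psi ` {a \<in> carrier R. psi a \<in> U}" if "U \<subseteq> K" for U
    using that unfolding K_def by blast
  interpret H: height_one D K x "psi ` p"
  proof (intro height_one.intro height_one_axioms.intro power_basis.intro power_basis_axioms.intro)
    show "domain D" "cring D" by (rule D.domain_axioms D.is_cring)+
    show "subring K D" unfolding K_def
      by (rule ring_hom_ring.img_is_subring[OF psi.ring.ring_hom_ring_axioms R.carrier_is_subring])
    show "x \<in> carrier D" unfolding x_def by simp
    show "psi ` p \<subseteq> K" unfolding K_def using ideal.Icarr[OF pi] by blast
    show "submod D K (psi ` p)"
    proof (rule submodI)
      interpret p: ideal p R by fact
      show "psi ` p \<subseteq> carrier D" using p.Icarr by auto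
      have "psi \<zero> = \<zero>\<^bsub>D\<^esub>" by simp
      then show "\<zero>\<^bsub>D\<^esub> \<in> psi ` p" using p.zero_closed by (metis imageI)
      show "u \<oplus>\<^bsub>D\<^esub> v \<in> psi ` p" if uv: "u \<in> psi ` p" "v \<in> psi ` p" for u v
      proof -
        from uv obtain a b where *: "u = psi a" "v = psi b" "a \<in> p" "b \<in> p" by blast
        then have "u \<oplus>\<^bsub>D\<^esub> v = psi (a \<oplus> b)" using p.Icarr by simp
        then show ?thesis using * p.a_closed by blast
      qed
      show "k \<otimes>\<^bsub>D\<^esub> u \<in> psi ` p" if ku: "k \<in> K" "u \<in> psi ` p" for k u
      proof -
        from ku obtain a b where *: "k = psi a" "u = psi b" "a \<in> carrier R" "b \<in> p" unfolding K_def by blast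
        then have "k \<otimes>\<^bsub>D\<^esub> u = psi (a \<otimes> b)" using p.Icarr by simp
        then show ?thesis using * p.I_l_closed by blast
      qed
    qed
    show "\<one>\<^bsub>D\<^esub> \<notin> psi ` p"
    proof
      assume "\<one>\<^bsub>D\<^esub> \<in> psi ` p"
      then have "\<one> \<in> p" using psi_p[of \<one>] by simp
      then show False using primeideal.one_notin[OF p] by blast
    qed
    show "a \<in> psi ` p \<or> b \<in> psi ` p" if ab: "a \<in> K" "b \<in> K" "a \<otimes>\<^bsub>D\<^esub> b \<in> psi ` p" for a b
    proof -
      from ab obtain u v where *: "a = psi u" "b = psi v" "u \<in> carrier R" "v \<in> carrier R" unfolding K_def by blast
      then have "u \<otimes> v \<in> p" using psi_p[of "u \<otimes> v"] ab(3) by simp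
      then show ?thesis using primeideal.I_prime[OF p *(3,4)] * by blast
    qed
    show "U = psi ` p" if U: "submod D K U" "U \<subseteq> psi ` p" "U \<noteq> {\<zero>\<^bsub>D\<^esub>}"
      "\<And>a b. a \<in> K \<Longrightarrow> b \<in> K \<Longrightarrow> a \<otimes>\<^bsub>D\<^esub> b \<in> U \<Longrightarrow> a \<in> U \<or> b \<in> U" for U
    proof -
      let ?A = "{a \<in> carrier R. psi a \<in> U}"
      have Ap: "?A \<subseteq> p" using U(2) psi_p by blast
      have UK: "U \<subseteq> K" using U(2) unfolding K_def using ideal.Icarr[OF pi] by blast
      have prime: "primeideal ?A R"
      proof (rule primeidealI[OF preim[OF U(1)] R.is_cring])
        show "carrier R \<noteq> ?A" using Ap primeideal.one_notin[OF p] by blast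
        fix a b assume ab: "a \<in> carrier R" "b \<in> carrier R" "a \<otimes> b \<in> ?A"
        then have "psi a \<in> U \<or> psi b \<in> U" using U(4)[OF psiK[OF ab(1)] psiK[OF ab(2)]] by simp
        then show "a \<in> ?A \<or> b \<in> ?A" using ab by blast
      qed
      have qA: "q \<subseteq> ?A"
      proof
        fix a assume "a \<in> q"
        then have "a \<in> carrier R" "psi a = \<zero>\<^bsub>D\<^esub>" using psi_zero ideal.Icarr[OF qi] by blast+
        then show "a \<in> ?A" using submodD(2)[OF U(1)] by simp
      qed
      have "?A \<noteq> q"
      proof
        assume A: "?A = q"
        have "u = \<zero>\<^bsub>D\<^esub>" if uU: "u \<in> U" for u
        proof -
          have "u \<in> psi ` ?A" using img[OF UK] uU by (rule subst)
          then obtain a where a: "u = psi a" "a \<in> ?A" by (rule imageE)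
          then have "a \<in> q" using A by (simp only:)
          then have "a \<in> q" "a \<in> carrier R" using ideal.Icarr[OF qi] by blast+
          then show ?thesis using psi_zero a(1) by simp
        qed
        then show False using U(3) submodD(2)[OF U(1)] by blast
      qed
      then have "?A = p" using adj[OF prime] qA Ap by blast
      then show ?thesis using img[OF UK] by simp
    qed
    show "\<exists>n. \<forall>m\<ge>n. U m = U n" if U: "\<And>n. submod D K (U n)" "\<And>n. U n \<subseteq> K" "\<And>n. U n \<subseteq> U (Suc n)"
      for U :: "nat \<Rightarrow> _"
    proof -
      have "\<exists>n. \<forall>m\<ge>n. {a \<in> carrier R. psi a \<in> U m} = {a \<in> carrier R. psi a \<in> U n}"
      proof (rule noetherian_ring.ideal_acc[OF noeth])
        fix n
        show "ideal {a \<in> carrier R. psi a \<in> U n} R" by (rule preim[OF U(1)])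
        show "{a \<in> carrier R. psi a \<in> U n} \<subseteq> {a \<in> carrier R. psi a \<in> U (Suc n)}"
          using subsetD[OF U(3)[of n]] by (intro Collect_mono) simp
      qed
      then obtain n where n: "\<And>m. m \<ge> n \<Longrightarrow> {a \<in> carrier R. psi a \<in> U m} = {a \<in> carrier R. psi a \<in> U n}" by blast
      have "U m = U n" if "m \<ge> n" for m
        using img[OF U(2)[of m]] img[OF U(2)[of n]] n[OF that] by simp
      then show ?thesis by blast
    qed
    show "\<exists>n. g \<in> span_pow D K x n" if g: "g \<in> carrier D" for g
    proof -
      obtain f where f: "f \<in> carrier P" "g = phi f" using phi_surj g by blast
      obtain n where "f \<in> span_pow P scalars indet n" using ex_span_pow[OF f(1)] by blast
      then show ?thesis unfolding span f(2) by blast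
    qed
    \<comment> \<open>An element of \<open>Q\<close> outside \<open>ext q\<close> gives, after
      stripping, a relation for \<open>x\<close> whose leading coefficient does not vanish in
      \<open>D\<close>.\<close>
    show "\<exists>c\<in>K. \<exists>d. c \<noteq> \<zero>\<^bsub>D\<^esub> \<and> c \<otimes>\<^bsub>D\<^esub> x [^]\<^bsub>D\<^esub> d \<in> span_pow D K x d"
    proof -
      obtain f where f: "f \<in> Q" "f \<notin> ext q" using lt by blast
      obtain N where fN: "f \<in> span_pow P scalars indet N" using ex_span_pow[OF ideal.Icarr[OF Qi f(1)]] by blast
      obtain d f0 c where *: "f0 \<in> span_pow P scalars indet d" "c \<in> carrier R" "c \<notin> q"
        "f0 \<oplus>\<^bsub>P\<^esub> mn c d \<in> Q"
        by (rule ex_lead_notin[OF qi Qi psubset_imp_subset[OF lt(1)] f fN])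
      interpret B: power_basis P scalars indet by (rule power_basis_UP)
      have f0: "f0 \<in> carrier P" using *(1) B.span_pow_closed by blast
      have "\<zero>\<^bsub>D\<^esub> = phi (f0 \<oplus>\<^bsub>P\<^esub> cst c \<otimes>\<^bsub>P\<^esub> indet [^]\<^bsub>P\<^esub> d)"
        using phi_zero[of "f0 \<oplus>\<^bsub>P\<^esub> mn c d"] * f0 unfolding X_pow by (simp add: cst_mult_monom)
      also have "\<dots> = phi f0 \<oplus>\<^bsub>D\<^esub> psi c \<otimes>\<^bsub>D\<^esub> x [^]\<^bsub>D\<^esub> d" unfolding psi_def x_def using f0 *(2) by simp
      finally have "phi f0 \<oplus>\<^bsub>D\<^esub> psi c \<otimes>\<^bsub>D\<^esub> x [^]\<^bsub>D\<^esub> d = \<zero>\<^bsub>D\<^esub>" by simp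
      then have "psi c \<otimes>\<^bsub>D\<^esub> x [^]\<^bsub>D\<^esub> d = \<ominus>\<^bsub>D\<^esub> phi f0"
        using f0 *(2) unfolding x_def by (intro D.minus_equality[symmetric]) (simp_all add: D.a_comm)
      also have "\<dots> = phi (cst (\<ominus> \<one>) \<otimes>\<^bsub>P\<^esub> f0)"
        using f0 by (simp add: P.l_minus)
      also have "\<dots> \<in> span_pow D K x d" unfolding span
        by (intro imageI submodD(4)[OF B.span_pow_submod _ *(1)] R.a_inv_closed R.one_closed)
      finally have "psi c \<otimes>\<^bsub>D\<^esub> x [^]\<^bsub>D\<^esub> d \<in> span_pow D K x d" .
      moreover have "psi c \<noteq> \<zero>\<^bsub>D\<^esub>" using psi_zero[OF *(2)] *(3) by simp
      ultimately show ?thesis using psiK[OF *(2)] by blast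
    qed
  qed
  obtain a where a: "a \<in> p" "a \<notin> q" using qp by blast
  have aR: "a \<in> carrier R" using ideal.Icarr[OF pi a(1)] .
  have "psi a \<in> psi ` p" "psi a \<noteq> \<zero>\<^bsub>D\<^esub>" using a psi_zero[OF aR] by simp_all
  from H.bounded_generation[OF this] obtain N where
    N: "\<forall>g\<in>carrier D. \<exists>s\<in>K - psi ` p. \<exists>g'\<in>carrier D. \<exists>r\<in>span_pow D K x N. s \<otimes>\<^bsub>D\<^esub> g = psi a \<otimes>\<^bsub>D\<^esub> g' \<oplus>\<^bsub>D\<^esub> r" ..
  \<comment> \<open>The bound \<open>N\<close> is contradicted by the next power \<open>x^N\<close>.
    Lifted to \<open>P\<close>, the relation lies in \<open>Q \<subseteq> ext p\<close>; at degree
    \<open>N\<close> the remainder \<open>r'\<close> contributes nothing, so \<open>s'\<close> would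
    lie in \<open>p\<close>.\<close>
  have "x [^]\<^bsub>D\<^esub> N \<in> carrier D" unfolding x_def by simp
  from bspec[OF N this] obtain s g r where *: "s \<in> K" "s \<notin> psi ` p" "g \<in> carrier D" "r \<in> span_pow D K x N"
    "s \<otimes>\<^bsub>D\<^esub> x [^]\<^bsub>D\<^esub> N = psi a \<otimes>\<^bsub>D\<^esub> g \<oplus>\<^bsub>D\<^esub> r" by blast
  obtain s' where s': "s' \<in> carrier R" "s = psi s'" "s' \<notin> p" using *(1,2) unfolding K_def by blast
  obtain g' where g': "g' \<in> carrier P" "g = phi g'" using *(3) phi_surj by blast
  obtain r' where r': "r' \<in> span_pow P scalars indet N" "r = phi r'" using *(4) unfolding span by blast
  have r'P: "r' \<in> carrier P" "cf r' N = \<zero>" using r'(1) unfolding span_pow_eq by auto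
  define f where "f = cst a \<otimes>\<^bsub>P\<^esub> g' \<oplus>\<^bsub>P\<^esub> r'"
  have f: "f \<in> carrier P" "cf f N = a \<otimes> cf g' N"
    unfolding f_def using aR g' r'P by (simp_all add: coeff_cst_mult del: coeff_mult)
  have "phi (mn s' N) = phi f"
  proof -
    have "phi (mn s' N) = phi (cst s' \<otimes>\<^bsub>P\<^esub> indet [^]\<^bsub>P\<^esub> N)" unfolding X_pow using s' by (simp add: cst_mult_monom)
    also have "\<dots> = s \<otimes>\<^bsub>D\<^esub> x [^]\<^bsub>D\<^esub> N" unfolding s'(2) psi_def x_def using s'(1) by simp
    also have "\<dots> = phi f" unfolding *(5) f_def psi_def g'(2) r'(2) using aR g' r'P by simp
    finally show ?thesis .
  qed
  then have "phi (mn s' N \<ominus>\<^bsub>P\<^esub> f) = \<zero>\<^bsub>D\<^esub>"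
    using f s' by (simp add: P.minus_eq D.r_neg)
  then have "mn s' N \<ominus>\<^bsub>P\<^esub> f \<in> ext p" using phi_zero[of "mn s' N \<ominus>\<^bsub>P\<^esub> f"] f s' lt by auto
  then have "cf (mn s' N \<ominus>\<^bsub>P\<^esub> f) N \<in> p" unfolding ext_def by blast
  then have "s' \<ominus> a \<otimes> cf g' N \<in> p" using f s' by simp
  moreover have ag: "a \<otimes> cf g' N \<in> p" using ideal.I_r_closed[OF pi a(1)] g' by simp
  ultimately have "(s' \<ominus> a \<otimes> cf g' N) \<oplus> a \<otimes> cf g' N \<in> p"
    using additive_subgroup.a_closed[OF ideal.axioms(1)[OF pi]] by blast
  moreover have "(s' \<ominus> a \<otimes> cf g' N) \<oplus> a \<otimes> cf g' N = s'"
  proof -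
    have "a \<otimes> cf g' N \<in> carrier R" using aR g' by simp
    then show ?thesis using s'(1) by algebra
  qed
  ultimately show False using s'(3) by simp
qed

end

section \<open>Chains of primes\<close>

text \<open>The chain is described from its largest member \<open>P\<close> downwards, so that
  inductions can speak about the contraction of \<open>P\<close>. The bound \<open>I\<close> is
  imposed on the smallest member and thereby on all; \<open>I = {}\<close> imposes nothing.\<close>

primrec pchain :: "('a, 'm) ring_scheme \<Rightarrow> 'a set \<Rightarrow> nat \<Rightarrow> 'a set \<Rightarrow> bool"
  where "pchain R I 0 P \<longleftrightarrow> primeideal P R \<and> I \<subseteq> P"
  | "pchain R I (Suc n) P \<longleftrightarrow> primeideal P R \<and> (\<exists>Q. Q \<subset> P \<and> pchain R I n Q)"

lemma pchain_primeideal: "pchain R I n P \<Longrightarrow> primeideal P R"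
  by (cases n) auto

lemma pchain_supset: "pchain R I n P \<Longrightarrow> I \<subseteq> P"
  by (induction n arbitrary: P) (simp, metis order_trans pchain.simps(2) psubset_imp_subset)

lemma pchain_smaller: "pchain R I n P \<Longrightarrow> I' \<subseteq> I \<Longrightarrow> pchain R I' n P"
  by (induction n arbitrary: P) auto

lemma pchain_Suc_imp: "pchain R I (Suc n) P \<Longrightarrow> pchain R I n P"
proof (induction n arbitrary: P)
  case 0
  then obtain Q where "Q \<subset> P" "I \<subseteq> Q" by auto
  then have "I \<subseteq> P" by blast
  with 0 show ?case by simp
next
  case (Suc n)
  then obtain Q where "primeideal P R" "Q \<subset> P" "pchain R I (Suc n) Q" by auto
  then show ?case using Suc.IH[of Q] by auto
qed

lemma pchain_iff_chain:
  "(\<exists>P. pchain R {} n P) \<longleftrightarrow> (\<exists>P. (\<forall>i\<le>n. primeideal (P i) R) \<and> (\<forall>i<n. P i \<subset> P (Suc i)))"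
proof
  assume "\<exists>P. pchain R {} n P"
  then obtain P where P: "pchain R {} n P" by blast
  have "\<exists>f. (\<forall>i\<le>n. primeideal (f i) R) \<and> (\<forall>i<n. f i \<subset> f (Suc i)) \<and> f n = P"
    using P
  proof (induction n arbitrary: P)
    case 0
    then show ?case by (intro exI[of _ "\<lambda>_. P"]) simp
  next
    case (Suc n)
    then obtain Q where Q: "primeideal P R" "Q \<subset> P" "pchain R {} n Q" by auto
    with Suc.IH obtain f where f: "\<forall>i\<le>n. primeideal (f i) R" "\<forall>i<n. f i \<subset> f (Suc i)" "f n = Q" by blast
    show ?case
      by (intro exI[of _ "f(Suc n := P)"]) (use f Q in \<open>auto simp: le_Suc_eq less_Suc_eq\<close>)
  qed
  then show "\<exists>P. (\<forall>i\<le>n. primeideal (P i) R) \<and> (\<forall>i<n. P i \<subset> P (Suc i))" by blast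
next
  assume "\<exists>P. (\<forall>i\<le>n. primeideal (P i) R) \<and> (\<forall>i<n. P i \<subset> P (Suc i))"
  then obtain P where P: "\<forall>i\<le>n. primeideal (P i) R" "\<forall>i<n. P i \<subset> P (Suc i)" by blast
  have "pchain R {} k (P k)" if "k \<le> n" for k
    using that
  proof (induction k)
    case 0 then show ?case using P by simp
  next
    case (Suc k)
    then have "primeideal (P (Suc k)) R" "P k \<subset> P (Suc k)" "pchain R {} k (P k)"
      using P by simp_all
    then show ?case unfolding pchain.simps by blast
  qed
  then show "\<exists>P. pchain R {} n P" by blast
qed

lemma krull_dim_pchain: "krull_dim R = Sup {enat n | n. \<exists>P. pchain R {} n P}"
  unfolding krull_dim_def pchain_iff_chain ..

section \<open>Primes under surjective homomorphisms\<close>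

locale ring_epi = ring_hom_cring R S h for R (structure) and S (structure) and h +
  assumes surj: "h ` carrier R = carrier S"
begin

definition "ker = {a \<in> carrier R. h a = \<zero>\<^bsub>S\<^esub>}"

lemma image_mem_iff:
  assumes P: "ideal P R" "ker \<subseteq> P" and a: "a \<in> carrier R"
  shows "h a \<in> h ` P \<longleftrightarrow> a \<in> P"
proof
  assume "h a \<in> h ` P"
  then obtain b where b: "b \<in> P" "h a = h b" by blast
  interpret P: ideal P R by fact
  have bR: "b \<in> carrier R" using P.Icarr b by blast
  have "h (a \<ominus> b) = h a \<ominus>\<^bsub>S\<^esub> h b" using a bR by (simp add: a_minus_def)
  also have "\<dots> = \<zero>\<^bsub>S\<^esub>" using b a bR by (simp add: S.r_right_minus_eq)
  finally have "a \<ominus> b \<in> ker" unfolding ker_def using a bR by simp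
  then have "(a \<ominus> b) \<oplus> b \<in> P" using P(2) b(1) P.a_closed by blast
  moreover have "(a \<ominus> b) \<oplus> b = a" using a bR by algebra
  ultimately show "a \<in> P" by simp
qed simp

lemma image_primeideal:
  assumes P: "primeideal P R" "ker \<subseteq> P"
  shows "primeideal (h ` P) S"
proof -
  interpret P: primeideal P R by fact
  have id: "ideal (h ` P) S"
  proof (rule S.ideal_if_submod[OF submodI])
    show "h ` P \<subseteq> carrier S" using P.Icarr by auto
    have "h \<zero> \<in> h ` P" using P.zero_closed by (rule imageI)
    then show "\<zero>\<^bsub>S\<^esub> \<in> h ` P" by simp
    show "u \<oplus>\<^bsub>S\<^esub> v \<in> h ` P" if uv: "u \<in> h ` P" "v \<in> h ` P" for u v
    proof -
      from uv obtain a b where *: "u = h a" "v = h b" "a \<in> P" "b \<in> P" by blast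
      then have "h (a \<oplus> b) \<in> h ` P" using P.a_closed by blast
      then show ?thesis using * P.Icarr by simp
    qed
    show "r \<otimes>\<^bsub>S\<^esub> u \<in> h ` P" if ru: "r \<in> carrier S" "u \<in> h ` P" for r u
    proof -
      from ru surj obtain a b where *: "u = h a" "a \<in> P" "r = h b" "b \<in> carrier R" by blast
      then have "h (b \<otimes> a) \<in> h ` P" using P.I_l_closed by blast
      then show ?thesis using * P.Icarr by simp
    qed
  qed
  show ?thesis
  proof (rule primeidealI[OF id S.is_cring])
    have "h \<one> \<notin> h ` P" using image_mem_iff[OF P.is_ideal P(2) R.one_closed] P.one_notin by blast
    then show "carrier S \<noteq> h ` P" by auto
    fix u v assume uv: "u \<in> carrier S" "v \<in> carrier S" "u \<otimes>\<^bsub>S\<^esub> v \<in> h ` P"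
    then obtain a b where *: "u = h a" "v = h b" "a \<in> carrier R" "b \<in> carrier R" using surj by (metis imageE)
    then have "h (a \<otimes> b) \<in> h ` P" using uv(3) by simp
    then have "a \<otimes> b \<in> P" using image_mem_iff[OF P.is_ideal P(2)] * by blast
    then show "u \<in> h ` P \<or> v \<in> h ` P" using P.I_prime[OF *(3,4)] * by blast
  qed
qed

lemma vimage_primeideal: "primeideal P S \<Longrightarrow> primeideal {a \<in> carrier R. h a \<in> P} R"
  using ring.primeideal_vimage[OF R.is_cring] by blast

lemma ker_sub_vimage: "ideal P S \<Longrightarrow> ker \<subseteq> {a \<in> carrier R. h a \<in> P}"
  unfolding ker_def using additive_subgroup.zero_closed[OF ideal.axioms(1)] by fastforce

lemma image_vimage:
  assumes "P \<subseteq> carrier S"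
  shows "h ` {a \<in> carrier R. h a \<in> P} = P"
proof
  show "P \<subseteq> h ` {a \<in> carrier R. h a \<in> P}"
  proof
    fix y assume y: "y \<in> P"
    then have "y \<in> h ` carrier R" using assms surj by blast
    then obtain a where "a \<in> carrier R" "y = h a" by blast
    then show "y \<in> h ` {a \<in> carrier R. h a \<in> P}" using y by simp
  qed
qed blast

text \<open>Primes of the image correspond to primes above the kernel. Both the quotient of
  \<open>T\<close> and the one-variable polynomial ring are compared with \<open>T\<close> through
  this correspondence.\<close>

lemma ex_pchain_iff: "(\<exists>P. pchain S {} n P) \<longleftrightarrow> (\<exists>P. pchain R ker n P)"
proof
  assume "\<exists>P. pchain S {} n P"
  then obtain P where "pchain S {} n P" ..
  then have "pchain R ker n {a \<in> carrier R. h a \<in> P}"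
  proof (induction n arbitrary: P)
    case 0
    then show ?case using vimage_primeideal ker_sub_vimage by (simp add: primeideal.axioms(1))
  next
    case (Suc n)
    then obtain Q where Q: "primeideal P S" "Q \<subset> P" "pchain S {} n Q" by auto
    have Pc: "P \<subseteq> carrier S" using ideal.Icarr[OF primeideal.axioms(1)[OF Q(1)]] by blast
    have "{a \<in> carrier R. h a \<in> Q} \<subset> {a \<in> carrier R. h a \<in> P}"
    proof
      show "{a \<in> carrier R. h a \<in> Q} \<subseteq> {a \<in> carrier R. h a \<in> P}" using Q(2) by blast
      show "{a \<in> carrier R. h a \<in> Q} \<noteq> {a \<in> carrier R. h a \<in> P}"
        using image_vimage[of P] image_vimage[of Q] Pc Q(2) by auto
    qed
    then show ?case using Suc.IH[OF Q(3)] vimage_primeideal[OF Q(1)] unfolding pchain.simps by blast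
  qed
  then show "\<exists>P. pchain R ker n P" by blast
next
  assume "\<exists>P. pchain R ker n P"
  then obtain P where "pchain R ker n P" ..
  then have "pchain S {} n (h ` P)"
  proof (induction n arbitrary: P)
    case 0
    then show ?case using image_primeideal by simp
  next
    case (Suc n)
    then obtain Q where Q: "primeideal P R" "Q \<subset> P" "pchain R ker n Q" by auto
    note Q' = pchain_primeideal[OF Q(3)] pchain_supset[OF Q(3)]
    from Q(2) obtain a where a: "a \<in> P" "a \<notin> Q" by blast
    have "a \<in> carrier R" using ideal.Icarr[OF primeideal.axioms(1)[OF Q(1)] a(1)] .
    then have "h a \<notin> h ` Q" using image_mem_iff[OF primeideal.axioms(1)[OF Q'(1)] Q'(2)] a(2) by blast
    then have "h ` Q \<subset> h ` P" using Q(2) a(1) by blast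
    moreover have "ker \<subseteq> P" using Q'(2) Q(2) by blast
    ultimately show ?case using Suc.IH[OF Q(3)] image_primeideal[OF Q(1)] unfolding pchain.simps by blast
  qed
  then show "\<exists>P. pchain S {} n P" by blast
qed

end

lemma (in cring) Quot_ring_epi:
  assumes "ideal I R"
  shows "ring_epi R (R Quot I) ((+>) I)" "ring_epi.ker R (R Quot I) ((+>) I) = I"
proof -
  interpret I: ideal I R by fact
  show epi: "ring_epi R (R Quot I) ((+>) I)"
    by (intro ring_epi.intro ring_epi_axioms.intro I.rcos_ring_hom_cring is_cring I.rcos_surj)
  show "ring_epi.ker R (R Quot I) ((+>) I) = I"
    unfolding ring_epi.ker_def[OF epi] using I.rcos_eq_zero_iff I.Icarr by blast
qed

section \<open>Chains of primes in \<open>R\<close> and in \<open>R[x]\<close>\<close>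

context UP_cring
begin

lemma ext_strict_mono:
  assumes "ideal p R" "ideal q R" "p \<subset> q"
  shows "ext p \<subset> ext q"
proof -
  have "ext p \<noteq> ext q"
  proof
    assume "ext p = ext q"
    then have "contr (ext p) = contr (ext q)" by (rule arg_cong)
    then show False using assms(3) unfolding contr_ext[OF assms(1)] contr_ext[OF assms(2)] by blast
  qed
  then show ?thesis using ext_mono[of p q] assms(3) by blast
qed

lemma pchain_ext: "pchain R {} n p \<Longrightarrow> pchain P {} n (ext p)"
proof (induction n arbitrary: p)
  case 0
  then show ?case using ext_primeideal by simp
next
  case (Suc n)
  then obtain q where q: "primeideal p R" "q \<subset> p" "pchain R {} n q" by auto
  then have "ext q \<subset> ext p" using ext_strict_mono pchain_primeideal[OF q(3)] by (simp add: primeideal.axioms(1))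
  then show ?case using Suc.IH[OF q(3)] ext_primeideal[OF q(1)] unfolding pchain.simps by blast
qed

lemma primeideal_coeff0:
  assumes "primeideal p R"
  shows "primeideal {f \<in> carrier P. cf f 0 \<in> p} P" (is "primeideal ?Q P")
proof -
  interpret p: primeideal p R by fact
  have id: "ideal ?Q P"
    by (rule P.ideal_if_submod[OF submodI]) (use p.zero_closed p.a_closed p.I_l_closed in auto)
  show ?thesis
  proof (rule primeidealI[OF id P.is_cring])
    have "\<one>\<^bsub>P\<^esub> \<notin> ?Q" using p.one_notin by simp
    then show "carrier P \<noteq> ?Q" using P.one_closed by blast
    fix f g assume fg: "f \<in> carrier P" "g \<in> carrier P" "f \<otimes>\<^bsub>P\<^esub> g \<in> ?Q"
    then have "cf f 0 \<otimes> cf g 0 \<in> p" by simp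
    then have "cf f 0 \<in> p \<or> cf g 0 \<in> p" using p.I_prime fg(1,2) coeff_closed by blast
    then show "f \<in> ?Q \<or> g \<in> ?Q" using fg(1,2) by simp
  qed
qed

text \<open>The extended chain is prolonged at the top by the prime generated by \<open>p\<close>
  and the indeterminate, that is, by the polynomials with constant coefficient in
  \<open>p\<close>.\<close>

lemma pchain_UP_lower:
  assumes "pchain R {} n p"
  shows "\<exists>Q. pchain P {} (Suc n) Q"
proof -
  have p: "primeideal p R" by (rule pchain_primeideal[OF assms])
  interpret p: primeideal p R by fact
  let ?Q = "{f \<in> carrier P. cf f 0 \<in> p}"
  have "cf indet (Suc 0) = \<one>" by simp
  then have "indet \<notin> ext p" unfolding ext_def using p.one_notin by (metis (no_types, lifting) mem_Collect_eq)
  moreover have "indet \<in> ?Q" using p.zero_closed by simp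
  moreover have "ext p \<subseteq> ?Q" unfolding ext_def by blast
  ultimately have "ext p \<subset> ?Q" by blast
  then show ?thesis using primeideal_coeff0[OF p] pchain_ext[OF assms] unfolding pchain.simps by blast
qed

text \<open>A chain that ends in an extended prime loses no step under contraction, any other chain
  at most one. The two clauses feed each other and have to be proved together.\<close>

lemma pchain_UP_upper:
  assumes noeth: "noetherian_ring R" and "pchain P {} n Q"
  shows "(Q = ext (contr Q) \<longrightarrow> pchain R {} n (contr Q)) \<and> (\<forall>m. n = Suc m \<longrightarrow> pchain R {} m (contr Q))"
  using assms(2)
proof (induction n arbitrary: Q)
  case 0
  then show ?case using contr_primeideal by simp
next
  case (Suc n)
  then obtain Q' where Q': "primeideal Q P" "Q' \<subset> Q" "pchain P {} n Q'" by auto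
  have pQ': "primeideal Q' P" by (rule pchain_primeideal[OF Q'(3)])
  define p where "p = contr Q"
  define p' where "p' = contr Q'"
  have p: "primeideal p R" "primeideal p' R" unfolding p_def p'_def using contr_primeideal Q'(1) pQ' by auto
  have i: "ideal p R" "ideal p' R" "ideal Q P" "ideal Q' P" using p Q'(1) pQ' primeideal.axioms(1) by blast+
  have p'p: "p' \<subseteq> p" unfolding p_def p'_def using contr_mono Q'(2) by blast
  note IH = Suc.IH[OF Q'(3), folded p'_def]
  have ext': "ext p' \<subseteq> Q'" unfolding p'_def by (rule ext_contr[OF i(4)])
  have 1: "pchain R {} (Suc n) p" if Qp: "Q = ext p"
  proof -
    have "p' \<noteq> p" using ext' Qp Q'(2) by blast
    then have lt: "p' \<subset> p" using p'p by blast
    show ?thesis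
    proof (cases "Q' = ext p'")
      case True
      then have "pchain R {} n p'" using IH by blast
      then show ?thesis using lt p(1) unfolding pchain.simps by blast
    next
      case False
      \<comment> \<open>The step that may have been lost over \<open>p'\<close> is regained:
        \<open>p'\<close> and \<open>p\<close> cannot be adjacent, so a prime \<open>r\<close> fits
        strictly between them.\<close>
      then have "ext p' \<subset> Q'" using ext' by blast
      then obtain r where r: "primeideal r R" "p' \<subset> r" "r \<subset> p"
        using no_prime_between[OF noeth p(2,1) lt _ pQ'] Q'(2) Qp by blast
      show ?thesis
      proof (cases n)
        case 0
        then show ?thesis using p lt by (auto intro!: exI[of _ p'])
      next
        case (Suc m)
        then have "pchain R {} m p'" using IH by blast
        then have "pchain R {} (Suc m) r" using r unfolding pchain.simps by blast
        then have "pchain R {} n r" unfolding Suc .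
        then show ?thesis using r p(1) unfolding pchain.simps by blast
      qed
    qed
  qed
  have 2: "pchain R {} n p"
  proof (cases "Q = ext p")
    case True
    then show ?thesis using 1 pchain_Suc_imp by blast
  next
    case False
    show ?thesis
    proof (cases "p' = p")
      case True
      \<comment> \<open>Two members of the chain lie over the same prime, so the lower one is the
        extended prime, and for it nothing has been lost so far.\<close>
      have "Q' = ext p'"
      proof (rule ccontr)
        assume "Q' \<noteq> ext p'"
        then have "ext p \<subset> Q'" using ext' True by blast
        then show False using no_three_primes[OF p(1) pQ' Q'(1) _ Q'(2)] p_def by blast
      qed
      then show ?thesis using IH True by blast
    next
      case False
      then have lt: "p' \<subset> p" using p'p by blast
      show ?thesis
      proof (cases n)
        case 0
        then show ?thesis using p by simp
      next
        case (Suc m)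
        then have "pchain R {} m p'" using IH by blast
        then show ?thesis using lt p(1) unfolding Suc pchain.simps by blast
      qed
    qed
  qed
  from 1 2 show ?case unfolding p_def by blast
qed

theorem ex_pchain_UP_iff:
  assumes "noetherian_ring R"
  shows "(\<exists>Q. pchain P {} (Suc n) Q) \<longleftrightarrow> (\<exists>p. pchain R {} n p)"
  using pchain_UP_lower pchain_UP_upper[OF assms] by blast

end

section \<open>The polynomial ring over a set of variables\<close>

text \<open>Makes the sums in \<open>mpoly_mult\<close> finite.\<close>

lemma finite_submultisets: "finite {k. k \<subseteq># m}"
proof (induction m)
  case empty
  then show ?case by simp
next
  case (add x m)
  have "{k. k \<subseteq># add_mset x m} \<subseteq> {k. k \<subseteq># m} \<union> add_mset x ` {k. k \<subseteq># m}"
  proof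
    fix k assume "k \<in> {k. k \<subseteq># add_mset x m}"
    then have k: "k \<subseteq># add_mset x m" by simp
    show "k \<in> {k. k \<subseteq># m} \<union> add_mset x ` {k. k \<subseteq># m}"
    proof (cases "x \<in># k")
      case True
      then have "k = add_mset x (k - {#x#})" by simp
      moreover have "k - {#x#} \<subseteq># m" using k by (simp add: subset_eq_diff_conv)
      ultimately show ?thesis by blast
    next
      case False
      have "count k a \<le> count m a" for a
        using mset_subset_eq_count[OF k, of a] False by (cases "a = x") (auto simp: not_in_iff)
      then have "k \<subseteq># m" by (rule mset_subset_eqI)
      then show ?thesis by blast
    qed
  qed
  then show ?case using add finite_subset by blast
qed

text \<open>Serves the double sums in the associativity of the product.\<close>

lemma (in abelian_monoid) finsum_Sigma:
  assumes "finite A" "\<And>a. a \<in> A \<Longrightarrow> finite (B a)"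
    and "\<And>a b. a \<in> A \<Longrightarrow> b \<in> B a \<Longrightarrow> f a b \<in> carrier G"
  shows "(\<Oplus>a\<in>A. \<Oplus>b\<in>B a. f a b) = finsum G (\<lambda>(a, b). f a b) (Sigma A B)"
  using assms
proof (induction A rule: finite_induct)
  case empty
  then show ?case by simp
next
  case (insert a A)
  have eq: "Sigma (insert a A) B = Pair a ` B a \<union> Sigma A B" by auto
  have "finsum G (\<lambda>(a, b). f a b) (Sigma (insert a A) B) = finsum G (\<lambda>(a, b). f a b) (Pair a ` B a) \<oplus> finsum G (\<lambda>(a, b). f a b) (Sigma A B)"
    unfolding eq by (rule finsum_Un_disjoint) (use insert in auto)
  also have "finsum G (\<lambda>(a, b). f a b) (Pair a ` B a) = (\<Oplus>b\<in>B a. f a b)"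
    by (subst finsum_reindex) (use insert in \<open>auto simp: inj_on_def\<close>)
  finally show ?case using insert by (subst finsum_insert) (auto intro!: finsum_closed)
qed

locale mpoly_cring = cring K for K (structure) +
  fixes S :: "'i set" and T
  defines T_def: "T \<equiv> mpoly_ring K S"
begin

abbreviation "ind \<equiv> indexed_var"

definition mterm :: "'a \<Rightarrow> 'i multiset \<Rightarrow> ('i multiset \<Rightarrow> 'a)"
  where "mterm c m = (\<lambda>n. if n = m then c else \<zero>)"

lemma T_simps:
  "P \<otimes>\<^bsub>T\<^esub> Q = (\<lambda>m. \<Oplus>k\<in>{k. k \<subseteq># m}. P k \<otimes> Q (m - k))"
  "P \<oplus>\<^bsub>T\<^esub> Q = (\<lambda>m. P m \<oplus> Q m)"
  "\<one>\<^bsub>T\<^esub> = mterm \<one> {#}" "\<zero>\<^bsub>T\<^esub> = (\<lambda>m. \<zero>)"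
  by (simp_all add: T_def mpoly_ring_def mpoly_mult_def indexed_padd_def indexed_const_def mterm_def)

lemma mterm_in_pset:
  assumes "c \<in> carrier K" "set_mset m \<subseteq> S"
  shows "mterm c m \<in> indexed_pset S (carrier K)"
  using assms(2)
proof (induction m)
  case empty
  have "mterm c {#} = indexed_const c" unfolding mterm_def indexed_const_def ..
  then show ?case using indexed_pset.indexed_const[OF assms(1)] by simp
next
  case (add i m)
  have "mterm c (add_mset i m) = indexed_pmult (mterm c m) i"
    unfolding mterm_def indexed_pmult_def by (auto simp: fun_eq_iff)
  then show ?case using indexed_pset.indexed_pmult[of "mterm c m" S "carrier K" i] add by simp
qed

text \<open>Replaces the inductive generation of the carrier by a condition on coefficients and
  support. Conversely, a function with finite support is assembled term by term.\<close>

lemma carrier_T: "carrier T = {P. (\<forall>m. P m \<in> carrier K) \<and> finite {m. P m \<noteq> \<zero>} \<and> (\<forall>m. P m \<noteq> \<zero> \<longrightarrow> set_mset m \<subseteq> S)}"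
  (is "_ = ?C")
proof -
  have c: "carrier T = indexed_pset S (carrier K)" by (simp add: T_def mpoly_ring_def)
  have "P \<in> ?C" if "P \<in> indexed_pset S (carrier K)" for P
    using that
  proof induction
    case (indexed_const k)
    have "finite {m. indexed_const k m \<noteq> \<zero>}"
      by (rule finite_subset[of _ "{{#}}"]) (auto simp: indexed_const_def)
    then show ?case using indexed_const by (auto simp: indexed_const_def)
  next
    case (indexed_padd P Q)
    have "finite {m. indexed_padd P Q m \<noteq> \<zero>}"
      by (rule finite_subset[of _ "{m. P m \<noteq> \<zero>} \<union> {m. Q m \<noteq> \<zero>}"])
        (use indexed_padd in \<open>auto simp: indexed_padd_def\<close>)
    moreover have "set_mset m \<subseteq> S" if "indexed_padd P Q m \<noteq> \<zero>" for m
    proof -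
      have "P m \<noteq> \<zero> \<or> Q m \<noteq> \<zero>" using that unfolding indexed_padd_def by auto
      then show ?thesis using indexed_padd by blast
    qed
    ultimately show ?case using indexed_padd by (simp add: indexed_padd_def)
  next
    case (indexed_pmult P i)
    have "finite {m. indexed_pmult P i m \<noteq> \<zero>}"
    proof (rule finite_subset[of _ "add_mset i ` {m. P m \<noteq> \<zero>}"])
      show "{m. indexed_pmult P i m \<noteq> \<zero>} \<subseteq> add_mset i ` {m. P m \<noteq> \<zero>}"
      proof
        fix m assume "m \<in> {m. indexed_pmult P i m \<noteq> \<zero>}"
        then have "i \<in># m" "P (m - {#i#}) \<noteq> \<zero>" by (auto simp: indexed_pmult_def split: if_splits)
        then show "m \<in> add_mset i ` {m. P m \<noteq> \<zero>}" by (intro image_eqI[of _ _ "m - {#i#}"]) auto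
      qed
    qed (use indexed_pmult in simp)
    moreover have "set_mset m \<subseteq> S" if "indexed_pmult P i m \<noteq> \<zero>" for m
    proof -
      have "i \<in># m" "P (m - {#i#}) \<noteq> \<zero>" using that by (auto simp: indexed_pmult_def split: if_splits)
      then have "set_mset (m - {#i#}) \<subseteq> S" "m = add_mset i (m - {#i#})" using indexed_pmult by auto
      then show ?thesis using indexed_pmult(2) by (metis insert_subset set_mset_add_mset_insert)
    qed
    ultimately show ?case using indexed_pmult by (simp add: indexed_pmult_def)
  qed
  moreover have "P \<in> indexed_pset S (carrier K)" if "P \<in> ?C" for P
  proof -
    have "\<forall>P. {m. P m \<noteq> \<zero>} = A \<longrightarrow> (\<forall>m. P m \<in> carrier K) \<longrightarrow> (\<forall>m. P m \<noteq> \<zero> \<longrightarrow> set_mset m \<subseteq> S)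
        \<longrightarrow> P \<in> indexed_pset S (carrier K)" if "finite A" for A
      using that
    proof (induction A)
      case empty
      have "P = indexed_const \<zero>" if "{m. P m \<noteq> \<zero>} = {}" for P
        using that by (auto simp: indexed_const_def fun_eq_iff)
      then show ?case using indexed_pset.indexed_const[of \<zero> "carrier K" S] zero_closed by metis
    next
      case (insert m A)
      show ?case
      proof (intro allI impI)
        fix P assume P: "{m. P m \<noteq> \<zero>} = insert m A" "\<forall>m. P m \<in> carrier K" "\<forall>m. P m \<noteq> \<zero> \<longrightarrow> set_mset m \<subseteq> S"
        have "m \<in> {m. P m \<noteq> \<zero>}" using P(1) by blast
        then have m: "set_mset m \<subseteq> S" using P(3) by blast
        have "{n. (P(m := \<zero>)) n \<noteq> \<zero>} = A" using P(1) insert(2) by auto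
        then have "P(m := \<zero>) \<in> indexed_pset S (carrier K)" using insert.IH P by simp
        moreover have "P = indexed_padd (P(m := \<zero>)) (mterm (P m) m)"
          using P(2) unfolding indexed_padd_def mterm_def by (auto simp: fun_eq_iff)
        ultimately show "P \<in> indexed_pset S (carrier K)"
          using indexed_pset.indexed_padd[OF _ mterm_in_pset[of "P m" m]] P(2) m by metis
      qed
    qed
    then show ?thesis using that by blast
  qed
  ultimately show ?thesis unfolding c by blast
qed

lemma T_coeff_closed [simp]: "P \<in> carrier T \<Longrightarrow> P m \<in> carrier K"
  unfolding carrier_T by blast

lemma T_mult_closed:
  assumes "P \<in> carrier T" "Q \<in> carrier T"
  shows "P \<otimes>\<^bsub>T\<^esub> Q \<in> carrier T"
proof -
  have ex: "\<exists>k. k \<subseteq># m \<and> P k \<noteq> \<zero> \<and> Q (m - k) \<noteq> \<zero>" if m: "(P \<otimes>\<^bsub>T\<^esub> Q) m \<noteq> \<zero>" for m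
  proof (rule ccontr)
    assume *: "\<not> ?thesis"
    have "P k \<otimes> Q (m - k) = \<zero>" if "k \<in> {k. k \<subseteq># m}" for k
    proof -
      have "P k = \<zero> \<or> Q (m - k) = \<zero>" using * that by blast
      then show ?thesis using assms by auto
    qed
    then have "(P \<otimes>\<^bsub>T\<^esub> Q) m = \<zero>" unfolding T_simps by (rule add.finprod_one_eqI)
    then show False using m by blast
  qed
  have "{m. (P \<otimes>\<^bsub>T\<^esub> Q) m \<noteq> \<zero>} \<subseteq> (\<lambda>(u, v). u + v) ` ({m. P m \<noteq> \<zero>} \<times> {m. Q m \<noteq> \<zero>})"
  proof
    fix m assume "m \<in> {m. (P \<otimes>\<^bsub>T\<^esub> Q) m \<noteq> \<zero>}"
    then obtain k where "k \<subseteq># m" "P k \<noteq> \<zero>" "Q (m - k) \<noteq> \<zero>" using ex by blast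
    then show "m \<in> (\<lambda>(u, v). u + v) ` ({m. P m \<noteq> \<zero>} \<times> {m. Q m \<noteq> \<zero>})"
      by (intro image_eqI[of _ _ "(k, m - k)"]) auto
  qed
  then have "finite {m. (P \<otimes>\<^bsub>T\<^esub> Q) m \<noteq> \<zero>}"
    using assms unfolding carrier_T by (auto intro: finite_subset)
  moreover have "set_mset m \<subseteq> S" if m: "(P \<otimes>\<^bsub>T\<^esub> Q) m \<noteq> \<zero>" for m
  proof -
    obtain k where k: "k \<subseteq># m" "P k \<noteq> \<zero>" "Q (m - k) \<noteq> \<zero>" using ex m by blast
    then have "set_mset k \<subseteq> S" "set_mset (m - k) \<subseteq> S" using assms unfolding carrier_T by blast+
    moreover have "set_mset m = set_mset k \<union> set_mset (m - k)"
      using k(1) by (metis set_mset_union subset_mset.add_diff_inverse)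
    ultimately show ?thesis by blast
  qed
  moreover have "(P \<otimes>\<^bsub>T\<^esub> Q) m \<in> carrier K" for m
    unfolding T_simps using assms by (intro finsum_closed) auto
  ultimately show ?thesis unfolding carrier_T by blast
qed

lemma T_add_closed:
  assumes "P \<in> carrier T" "Q \<in> carrier T"
  shows "P \<oplus>\<^bsub>T\<^esub> Q \<in> carrier T"
  using assms unfolding T_def mpoly_ring_def by (simp add: indexed_pset.indexed_padd)

lemma mterm_closed: "c \<in> carrier K \<Longrightarrow> set_mset m \<subseteq> S \<Longrightarrow> mterm c m \<in> carrier T"
  using mterm_in_pset by (simp add: T_def mpoly_ring_def)

lemma T_mult_comm:
  assumes "P \<in> carrier T" "Q \<in> carrier T"
  shows "P \<otimes>\<^bsub>T\<^esub> Q = Q \<otimes>\<^bsub>T\<^esub> P"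
proof
  fix m :: "'i multiset"
  have im: "(\<lambda>k. m - k) ` {k. k \<subseteq># m} = {k. k \<subseteq># m}"
  proof (rule subset_antisym; rule subsetI)
    fix k assume "k \<in> {k. k \<subseteq># m}"
    then show "k \<in> (\<lambda>k. m - k) ` {k. k \<subseteq># m}"
      by (intro image_eqI[of _ _ "m - k"]) (auto simp: subset_mset.diff_diff_right)
  qed auto
  have inj: "inj_on (\<lambda>k. m - k) {k. k \<subseteq># m}"
    by (rule inj_on_inverseI[of _ "\<lambda>k. m - k"]) (auto simp: subset_mset.diff_diff_right)
  have "(P \<otimes>\<^bsub>T\<^esub> Q) m = (\<Oplus>k\<in>(\<lambda>k. m - k) ` {k. k \<subseteq># m}. P k \<otimes> Q (m - k))"
    unfolding im T_simps ..
  also have "\<dots> = (\<Oplus>k\<in>{k. k \<subseteq># m}. P (m - k) \<otimes> Q (m - (m - k)))"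
    by (rule finsum_reindex[OF _ inj]) (use assms in auto)
  also have "\<dots> = (Q \<otimes>\<^bsub>T\<^esub> P) m"
    unfolding T_simps by (rule finsum_cong') (use assms in \<open>auto simp: m_comm subset_mset.diff_diff_right\<close>)
  finally show "(P \<otimes>\<^bsub>T\<^esub> Q) m = (Q \<otimes>\<^bsub>T\<^esub> P) m" .
qed

lemma T_mult_assoc:
  assumes "P \<in> carrier T" "Q \<in> carrier T" "R \<in> carrier T"
  shows "(P \<otimes>\<^bsub>T\<^esub> Q) \<otimes>\<^bsub>T\<^esub> R = P \<otimes>\<^bsub>T\<^esub> (Q \<otimes>\<^bsub>T\<^esub> R)"
proof
  fix m :: "'i multiset"
  \<comment> \<open>Both sides sum over splittings of \<open>m\<close> into three parts.
    \<open>?A\<close> records the first and second part, \<open>?B\<close> the sum of these two and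
    the first part.\<close>
  let ?A = "SIGMA k:{k. k \<subseteq># m}. {l. l \<subseteq># m - k}"
  let ?B = "SIGMA k:{k. k \<subseteq># m}. {l. l \<subseteq># k}"
  have im: "(\<lambda>(k, l). (k + l, k)) ` ?A = ?B"
  proof (rule subset_antisym; rule subsetI)
    fix z assume "z \<in> (\<lambda>(k, l). (k + l, k)) ` ?A"
    then show "z \<in> ?B" by (auto simp: subset_mset.le_diff_conv2 add.commute)
  next
    fix z assume "z \<in> ?B"
    then obtain k l where "z = (k, l)" "k \<subseteq># m" "l \<subseteq># k" by auto
    then show "z \<in> (\<lambda>(k, l). (k + l, k)) ` ?A"
      by (intro image_eqI[of _ _ "(l, k - l)"])
        (auto intro: subset_mset.order_trans simp: subset_eq_diff_conv subset_mset.order_trans[of l k m])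
  qed
  have inj: "inj_on (\<lambda>(k, l). (k + l, k)) ?A" by (auto simp: inj_on_def)
  have "((P \<otimes>\<^bsub>T\<^esub> Q) \<otimes>\<^bsub>T\<^esub> R) m = (\<Oplus>k\<in>{k. k \<subseteq># m}. \<Oplus>l\<in>{l. l \<subseteq># k}. P l \<otimes> Q (k - l) \<otimes> R (m - k))"
    unfolding T_simps by (rule finsum_cong') (use assms in \<open>auto simp: finsum_ldistr finite_submultisets\<close>)
  also have "\<dots> = finsum K (\<lambda>(k, l). P l \<otimes> Q (k - l) \<otimes> R (m - k)) ?B"
    by (rule finsum_Sigma) (use assms finite_submultisets in auto)
  also have "\<dots> = finsum K (\<lambda>(k, l). P k \<otimes> Q (k + l - k) \<otimes> R (m - (k + l))) ?A"
    unfolding im[symmetric] by (subst finsum_reindex[OF _ inj]) (use assms in \<open>auto intro!: finsum_cong' simp: case_prod_beta\<close>)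
  also have "\<dots> = finsum K (\<lambda>(k, l). P k \<otimes> (Q l \<otimes> R (m - k - l))) ?A"
    by (rule finsum_cong') (use assms in \<open>auto simp: m_assoc\<close>)
  also have "\<dots> = (\<Oplus>k\<in>{k. k \<subseteq># m}. \<Oplus>l\<in>{l. l \<subseteq># m - k}. P k \<otimes> (Q l \<otimes> R (m - k - l)))"
    by (rule finsum_Sigma[symmetric]) (use assms finite_submultisets in auto)
  also have "\<dots> = (P \<otimes>\<^bsub>T\<^esub> (Q \<otimes>\<^bsub>T\<^esub> R)) m"
    unfolding T_simps by (rule finsum_cong') (use assms in \<open>auto simp: finsum_rdistr finite_submultisets\<close>)
  finally show "((P \<otimes>\<^bsub>T\<^esub> Q) \<otimes>\<^bsub>T\<^esub> R) m = (P \<otimes>\<^bsub>T\<^esub> (Q \<otimes>\<^bsub>T\<^esub> R)) m" .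
qed

lemma T_one_mult:
  assumes "P \<in> carrier T"
  shows "\<one>\<^bsub>T\<^esub> \<otimes>\<^bsub>T\<^esub> P = P"
proof
  fix m
  have "(\<one>\<^bsub>T\<^esub> \<otimes>\<^bsub>T\<^esub> P) m = (\<Oplus>k\<in>{k. k \<subseteq># m}. if {#} = k then P (m - k) else \<zero>)"
    unfolding T_simps mterm_def by (rule finsum_cong') (use assms in auto)
  also have "\<dots> = P m"
    using assms by (subst finsum_singleton) (auto simp: finite_submultisets)
  finally show "(\<one>\<^bsub>T\<^esub> \<otimes>\<^bsub>T\<^esub> P) m = P m" .
qed

lemma T_distrib:
  assumes "P \<in> carrier T" "Q \<in> carrier T" "R \<in> carrier T"
  shows "(P \<oplus>\<^bsub>T\<^esub> Q) \<otimes>\<^bsub>T\<^esub> R = P \<otimes>\<^bsub>T\<^esub> R \<oplus>\<^bsub>T\<^esub> Q \<otimes>\<^bsub>T\<^esub> R"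
  unfolding T_simps using assms by (auto simp: fun_eq_iff l_distr finsum_addf)

lemma T_cring: "cring T"
proof (rule cringI)
  show "abelian_group T"
  proof (rule abelian_groupI)
    show "P \<oplus>\<^bsub>T\<^esub> Q \<in> carrier T" if "P \<in> carrier T" "Q \<in> carrier T" for P Q
      using T_add_closed that .
    show "\<zero>\<^bsub>T\<^esub> \<in> carrier T" unfolding carrier_T T_simps by simp
    show "P \<oplus>\<^bsub>T\<^esub> Q \<oplus>\<^bsub>T\<^esub> R = P \<oplus>\<^bsub>T\<^esub> (Q \<oplus>\<^bsub>T\<^esub> R)" if "P \<in> carrier T" "Q \<in> carrier T" "R \<in> carrier T" for P Q R
      unfolding T_simps using that by (auto simp: fun_eq_iff a_assoc)
    show "P \<oplus>\<^bsub>T\<^esub> Q = Q \<oplus>\<^bsub>T\<^esub> P" if "P \<in> carrier T" "Q \<in> carrier T" for P Q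
      unfolding T_simps using that by (auto simp: fun_eq_iff a_comm)
    show "\<zero>\<^bsub>T\<^esub> \<oplus>\<^bsub>T\<^esub> P = P" if "P \<in> carrier T" for P
      unfolding T_simps using that by (auto simp: fun_eq_iff)
    show "\<exists>Q\<in>carrier T. Q \<oplus>\<^bsub>T\<^esub> P = \<zero>\<^bsub>T\<^esub>" if P: "P \<in> carrier T" for P
    proof (intro bexI[of _ "\<lambda>m. \<ominus> P m"])
      show "(\<lambda>m. \<ominus> P m) \<oplus>\<^bsub>T\<^esub> P = \<zero>\<^bsub>T\<^esub>" unfolding T_simps using P by (auto simp: fun_eq_iff l_neg)
      have "{m. \<ominus> P m \<noteq> \<zero>} \<subseteq> {m. P m \<noteq> \<zero>}" "\<And>m. \<ominus> P m \<noteq> \<zero> \<Longrightarrow> P m \<noteq> \<zero>" by auto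
      then show "(\<lambda>m. \<ominus> P m) \<in> carrier T" using P unfolding carrier_T by (auto intro: finite_subset)
    qed
  qed
  show "Group.comm_monoid T"
    by (rule comm_monoidI)
      (use T_mult_closed mterm_closed[of \<one> "{#}"] T_mult_assoc T_one_mult T_mult_comm in \<open>auto simp: T_simps(3)\<close>)
  show "(P \<oplus>\<^bsub>T\<^esub> Q) \<otimes>\<^bsub>T\<^esub> R = P \<otimes>\<^bsub>T\<^esub> R \<oplus>\<^bsub>T\<^esub> Q \<otimes>\<^bsub>T\<^esub> R"
    if "P \<in> carrier T" "Q \<in> carrier T" "R \<in> carrier T" for P Q R
    using T_distrib that .
qed

end

section \<open>Restriction to one coordinate axis\<close>

lemma submultisets_replicate: "{m. m \<subseteq># replicate_mset n k} = (\<lambda>i. replicate_mset i k) ` {..n}"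
proof (rule subset_antisym; rule subsetI)
  fix m assume "m \<in> {m. m \<subseteq># replicate_mset n k}"
  then have m: "m \<subseteq># replicate_mset n k" by simp
  have "set_mset m \<subseteq> {k}" using set_mset_mono[OF m] by (auto split: if_splits)
  then have "m = replicate_mset (size m) k" by (rule set_mset_subset_singletonD)
  moreover have "size m \<le> n" using size_mset_mono[OF m] by simp
  ultimately show "m \<in> (\<lambda>i. replicate_mset i k) ` {..n}" by blast
next
  fix m assume "m \<in> (\<lambda>i. replicate_mset i k) ` {..n}"
  then obtain i where i: "i \<le> n" "m = replicate_mset i k" by auto
  show "m \<in> {m. m \<subseteq># replicate_mset n k}"
    unfolding i mem_Collect_eq by (rule mset_subset_eqI) (use i in simp)
qed

lemma replicate_mset_minus: "replicate_mset n k - replicate_mset i k = replicate_mset (n - i) k"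
  by (rule multiset_eqI) simp

lemma UP_apply:
  "f \<in> up R \<Longrightarrow> g \<in> up R \<Longrightarrow> (f \<otimes>\<^bsub>UP R\<^esub> g) n = (\<Oplus>\<^bsub>R\<^esub>i\<in>{..n}. f i \<otimes>\<^bsub>R\<^esub> g (n - i))"
  "f \<in> up R \<Longrightarrow> g \<in> up R \<Longrightarrow> f \<oplus>\<^bsub>UP R\<^esub> g = (\<lambda>i. f i \<oplus>\<^bsub>R\<^esub> g i)"
  "\<one>\<^bsub>UP R\<^esub> = (\<lambda>i. if i = 0 then \<one>\<^bsub>R\<^esub> else \<zero>\<^bsub>R\<^esub>)" "\<zero>\<^bsub>UP R\<^esub> = (\<lambda>i. \<zero>\<^bsub>R\<^esub>)"
  "carrier (UP R) = up R"
  by (simp_all add: UP_def)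

context mpoly_cring
begin

sublocale T: cring T by (rule T_cring)

text \<open>Evaluation of every variable except \<open>x_k\<close> at zero: only the pure powers of
  \<open>x_k\<close> survive.\<close>

definition proj :: "'i \<Rightarrow> ('i multiset \<Rightarrow> 'a) \<Rightarrow> nat \<Rightarrow> 'a"
  where "proj k P = (\<lambda>n. P (replicate_mset n k))"

lemma proj_up:
  assumes "P \<in> carrier T"
  shows "proj k P \<in> up K"
proof (rule mem_upI)
  show "proj k P n \<in> carrier K" for n using assms by (simp add: proj_def)
  have fin: "finite (size ` {m. P m \<noteq> \<zero>})" using assms unfolding carrier_T by simp
  then obtain N where N: "\<forall>n\<in>size ` {m. P m \<noteq> \<zero>}. n < Suc N" using finite_nat_set_iff_bounded by (metis less_SucI)
  have "proj k P n = \<zero>" if "N < n" for n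
  proof (rule ccontr)
    assume "proj k P n \<noteq> \<zero>"
    then have "size (replicate_mset n k) \<in> size ` {m. P m \<noteq> \<zero>}" unfolding proj_def by blast
    then show False using N that by auto
  qed
  then show "\<exists>n. bound \<zero> n (proj k P)" by (auto intro!: exI[of _ N] simp: bound_def)
qed

text \<open>Divisors of a power of \<open>x_k\<close> are again powers of \<open>x_k\<close>, so the
  coefficients of a product along the axis involve only coefficients along the axis.\<close>

lemma proj_epi:
  assumes k: "k \<in> S"
  shows "ring_epi T (UP K) (proj k)"
proof (intro ring_epi.intro ring_hom_cringI ring_epi_axioms.intro)
  interpret U: UP_cring K "UP K" by unfold_locales
  show "cring T" by (rule T_cring)
  show "cring (UP K)" by (rule U.P.is_cring)
  show "proj k \<in> ring_hom T (UP K)"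
  proof (rule ring_hom_memI)
    show "proj k P \<in> carrier (UP K)" if "P \<in> carrier T" for P
      unfolding UP_apply(5) using proj_up[OF that] .
    show "proj k (P \<otimes>\<^bsub>T\<^esub> Q) = proj k P \<otimes>\<^bsub>UP K\<^esub> proj k Q" if PQ: "P \<in> carrier T" "Q \<in> carrier T" for P Q
    proof
      fix n
      have "proj k (P \<otimes>\<^bsub>T\<^esub> Q) n = (\<Oplus>m\<in>(\<lambda>i. replicate_mset i k) ` {..n}. P m \<otimes> Q (replicate_mset n k - m))"
        unfolding proj_def T_simps submultisets_replicate ..
      also have "\<dots> = (\<Oplus>i\<in>{..n}. P (replicate_mset i k) \<otimes> Q (replicate_mset n k - replicate_mset i k))"
      proof (rule finsum_reindex)
        show "inj_on (\<lambda>i. replicate_mset i k) {..n}" by (rule inj_onI) (metis size_replicate_mset)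
      qed (use PQ in simp)
      also have "\<dots> = (proj k P \<otimes>\<^bsub>UP K\<^esub> proj k Q) n"
        unfolding UP_apply(1)[OF proj_up[OF PQ(1)] proj_up[OF PQ(2)]] unfolding proj_def replicate_mset_minus ..
      finally show "proj k (P \<otimes>\<^bsub>T\<^esub> Q) n = (proj k P \<otimes>\<^bsub>UP K\<^esub> proj k Q) n" .
    qed
    show "proj k (P \<oplus>\<^bsub>T\<^esub> Q) = proj k P \<oplus>\<^bsub>UP K\<^esub> proj k Q" if PQ: "P \<in> carrier T" "Q \<in> carrier T" for P Q
      unfolding UP_apply(2)[OF proj_up[OF PQ(1)] proj_up[OF PQ(2)]] unfolding proj_def T_simps ..
    show "proj k \<one>\<^bsub>T\<^esub> = \<one>\<^bsub>UP K\<^esub>" unfolding T_simps mterm_def UP_apply(3) proj_def by (auto simp: fun_eq_iff)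
  qed
  show "proj k ` carrier T = carrier (UP K)"
  proof
    show "proj k ` carrier T \<subseteq> carrier (UP K)" unfolding UP_apply(5) using proj_up by blast
    show "carrier (UP K) \<subseteq> proj k ` carrier T"
    proof
      fix f assume "f \<in> carrier (UP K)"
      then have f: "f \<in> up K" unfolding UP_apply(5) .
      then obtain N where N: "bound \<zero> N f" by blast
      define P where "P m = (if m = replicate_mset (size m) k then f (size m) else \<zero>)" for m
      have "{m. P m \<noteq> \<zero>} \<subseteq> (\<lambda>n. replicate_mset n k) ` {..N}"
      proof
        fix m assume "m \<in> {m. P m \<noteq> \<zero>}"
        then have m: "m = replicate_mset (size m) k" "f (size m) \<noteq> \<zero>" unfolding P_def by (auto split: if_splits)
        then have "size m \<le> N" using bound.bound[OF N] by (meson not_le)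
        then show "m \<in> (\<lambda>n. replicate_mset n k) ` {..N}" using m(1) by (intro image_eqI[of _ _ "size m"]) auto
      qed
      then have "finite {m. P m \<noteq> \<zero>}" by (rule finite_subset) simp
      moreover have "set_mset m \<subseteq> S" if "P m \<noteq> \<zero>" for m
      proof -
        have "m = replicate_mset (size m) k" using that unfolding P_def by (auto split: if_splits)
        then have "set_mset m \<subseteq> {k}" by (metis set_mset_replicate_mset_subset subset_singleton_iff)
        then show ?thesis using k by blast
      qed
      ultimately have "P \<in> carrier T" unfolding carrier_T using f by (auto simp: P_def)
      moreover have "f = proj k P" by (simp add: proj_def P_def fun_eq_iff)
      ultimately show "f \<in> proj k ` carrier T" by blast
    qed
  qed
qed

section \<open>Terms and monomial ideals\<close>

lemma mterm_mult_apply: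
  assumes "c \<in> carrier K" "g \<in> carrier T"
  shows "(mterm c m \<otimes>\<^bsub>T\<^esub> g) l = (if m \<subseteq># l then c \<otimes> g (l - m) else \<zero>)"
proof -
  have "(mterm c m \<otimes>\<^bsub>T\<^esub> g) l = (\<Oplus>k\<in>{k. k \<subseteq># l}. if m = k then c \<otimes> g (l - k) else \<zero>)"
    unfolding T_simps by (rule finsum_cong') (use assms in \<open>auto simp: mterm_def\<close>)
  also have "\<dots> = (if m \<subseteq># l then c \<otimes> g (l - m) else \<zero>)"
  proof (cases "m \<subseteq># l")
    case True
    have "(\<Oplus>k\<in>{k. k \<subseteq># l}. if m = k then c \<otimes> g (l - k) else \<zero>) = c \<otimes> g (l - m)"
      by (rule finsum_singleton) (use True assms finite_submultisets in auto)
    then show ?thesis using True by simp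
  next
    case False
    have "(\<Oplus>k\<in>{k. k \<subseteq># l}. if m = k then c \<otimes> g (l - k) else \<zero>) = \<zero>"
      by (rule add.finprod_one_eqI) (use False in auto)
    then show ?thesis using False by simp
  qed
  finally show ?thesis .
qed

lemma mterm_mult:
  assumes "c \<in> carrier K" "d \<in> carrier K" "set_mset n \<subseteq> S"
  shows "mterm c m \<otimes>\<^bsub>T\<^esub> mterm d n = mterm (c \<otimes> d) (m + n)"
proof
  fix l
  have eq: "l - m = n \<longleftrightarrow> l = m + n" if "m \<subseteq># l"
    using that by (metis add_diff_cancel_left' subset_mset.add_diff_inverse)
  show "(mterm c m \<otimes>\<^bsub>T\<^esub> mterm d n) l = mterm (c \<otimes> d) (m + n) l"
    unfolding mterm_mult_apply[OF assms(1) mterm_closed[OF assms(2,3)]] using assms eq by (auto simp: mterm_def)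
qed

lemma ind_eq: "ind i = mterm \<one> {#i#}"
  unfolding indexed_var_def indexed_pmult_def indexed_const_def mterm_def
  by (auto simp: fun_eq_iff) (metis insert_DiffM)

lemma ind_closed: "i \<in> S \<Longrightarrow> ind i \<in> carrier T"
  unfolding ind_eq by (rule mterm_closed) auto

lemma ideal_mem_if_mterm_mem:
  assumes L: "ideal L T" and g: "g \<in> carrier T" and mem: "\<And>m. g m \<noteq> \<zero> \<Longrightarrow> mterm (g m) m \<in> L"
  shows "g \<in> L"
proof -
  interpret L: ideal L T by fact
  have "\<forall>g. {m. g m \<noteq> \<zero>} = A \<longrightarrow> (\<forall>m. g m \<in> carrier K) \<longrightarrow> (\<forall>m. g m \<noteq> \<zero> \<longrightarrow> mterm (g m) m \<in> L) \<longrightarrow> g \<in> L"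
    if "finite A" for A
    using that
  proof (induction A)
    case empty
    have "g = \<zero>\<^bsub>T\<^esub>" if "{m. g m \<noteq> \<zero>} = {}" for g using that unfolding T_simps by auto
    then show ?case using L.zero_closed by metis
  next
    case (insert m A)
    show ?case
    proof (intro allI impI)
      fix g assume g: "{m. g m \<noteq> \<zero>} = insert m A" "\<forall>m. g m \<in> carrier K" "\<forall>m. g m \<noteq> \<zero> \<longrightarrow> mterm (g m) m \<in> L"
      have "{n. (g(m := \<zero>)) n \<noteq> \<zero>} = A" using g(1) insert(2) by auto
      then have "g(m := \<zero>) \<in> L" using insert.IH g(2,3) by simp
      moreover have "m \<in> {m. g m \<noteq> \<zero>}" using g(1) by blast
      then have "mterm (g m) m \<in> L" using g(3) by blast
      ultimately have "g(m := \<zero>) \<oplus>\<^bsub>T\<^esub> mterm (g m) m \<in> L" by (rule L.a_closed)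
      moreover have "g(m := \<zero>) \<oplus>\<^bsub>T\<^esub> mterm (g m) m = g"
        using g(2) unfolding T_simps mterm_def by (auto simp: fun_eq_iff)
      ultimately show "g \<in> L" by simp
    qed
  qed
  moreover have "finite {m. g m \<noteq> \<zero>}" "\<forall>m. g m \<in> carrier K" using g unfolding carrier_T by blast+
  ultimately show ?thesis using mem by blast
qed

text \<open>For \<open>A\<close> closed under divisors this is the monomial ideal spanned by the
  terms outside \<open>A\<close>. All ideals of the theorem have this form, so that comparing them
  reduces to comparing sets of monomials.\<close>

definition vanish :: "'i multiset set \<Rightarrow> ('i multiset \<Rightarrow> 'a) set"
  where "vanish A = {g \<in> carrier T. \<forall>m\<in>A. g m = \<zero>}"

lemma vanish_ideal:
  assumes A: "\<And>m k. m \<in> A \<Longrightarrow> k \<subseteq># m \<Longrightarrow> k \<in> A"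
  shows "ideal (vanish A) T"
proof (rule T.ideal_if_submod[OF submodI])
  show "vanish A \<subseteq> carrier T" unfolding vanish_def by auto
  have "\<zero>\<^bsub>T\<^esub> m = \<zero>" for m unfolding T_simps(4) ..
  then show "\<zero>\<^bsub>T\<^esub> \<in> vanish A" unfolding vanish_def using T.zero_closed by simp
  show "f \<oplus>\<^bsub>T\<^esub> g \<in> vanish A" if "f \<in> vanish A" "g \<in> vanish A" for f g
  proof -
    have fg: "f \<in> carrier T" "g \<in> carrier T" "\<And>m. m \<in> A \<Longrightarrow> f m = \<zero>" "\<And>m. m \<in> A \<Longrightarrow> g m = \<zero>"
      using that unfolding vanish_def by blast+
    have "(f \<oplus>\<^bsub>T\<^esub> g) m = \<zero>" if "m \<in> A" for m using fg(3,4)[OF that] unfolding T_simps(2) by simp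
    then show ?thesis using fg(1,2) unfolding vanish_def by simp
  qed
  show "x \<otimes>\<^bsub>T\<^esub> g \<in> vanish A" if xg: "x \<in> carrier T" "g \<in> vanish A" for x g
  proof -
    have "(x \<otimes>\<^bsub>T\<^esub> g) m = \<zero>" if "m \<in> A" for m
      unfolding T_simps
    proof (rule add.finprod_one_eqI)
      fix k assume "k \<in> {k. k \<subseteq># m}"
      have "m - k \<in> A" by (rule A[OF that]) simp
      then have "g (m - k) = \<zero>" using xg(2) unfolding vanish_def by blast
      then show "x k \<otimes> g (m - k) = \<zero>" using xg(1) by simp
    qed
    moreover have "x \<otimes>\<^bsub>T\<^esub> g \<in> carrier T" using xg unfolding vanish_def by simp
    ultimately show ?thesis unfolding vanish_def by blast
  qed
qed

text \<open>A polynomial without terms in \<open>A\<close> is a finite sum of terms, each of which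
  is a multiple of some generator.\<close>

lemma genideal_eq_vanish:
  assumes A: "\<And>m k. m \<in> A \<Longrightarrow> k \<subseteq># m \<Longrightarrow> k \<in> A"
    and G: "G \<subseteq> vanish A"
    and mterm: "\<And>m c. m \<notin> A \<Longrightarrow> set_mset m \<subseteq> S \<Longrightarrow> c \<in> carrier K \<Longrightarrow>
      \<exists>u\<in>carrier T. \<exists>g\<in>G. mterm c m = u \<otimes>\<^bsub>T\<^esub> g"
  shows "Idl\<^bsub>T\<^esub> G = vanish A"
proof
  have Gc: "G \<subseteq> carrier T" using G unfolding vanish_def by blast
  show "Idl\<^bsub>T\<^esub> G \<subseteq> vanish A" by (rule T.genideal_minimal[OF vanish_ideal[OF A] G])
  show "vanish A \<subseteq> Idl\<^bsub>T\<^esub> G"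
  proof
    fix g assume g: "g \<in> vanish A"
    interpret I: ideal "Idl\<^bsub>T\<^esub> G" T by (rule T.genideal_ideal[OF Gc])
    show "g \<in> Idl\<^bsub>T\<^esub> G"
    proof (rule ideal_mem_if_mterm_mem[OF I.is_ideal])
      show gc: "g \<in> carrier T" using g unfolding vanish_def by blast
      fix m assume m: "g m \<noteq> \<zero>"
      then have "m \<notin> A" using g unfolding vanish_def by blast
      moreover have "set_mset m \<subseteq> S" using m gc unfolding carrier_T by blast
      ultimately obtain u h where "u \<in> carrier T" "h \<in> G" "mterm (g m) m = u \<otimes>\<^bsub>T\<^esub> h"
        using mterm[of m "g m"] gc by auto
      then show "mterm (g m) m \<in> Idl\<^bsub>T\<^esub> G" using T.genideal_self[OF Gc] I.I_l_closed by auto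
    qed
  qed
qed

lemma ex_ind_factor:
  assumes "i \<in># m" "set_mset m \<subseteq> S" "c \<in> carrier K"
  shows "\<exists>u\<in>carrier T. mterm c m = u \<otimes>\<^bsub>T\<^esub> ind i"
proof (intro bexI)
  show "mterm c m = mterm c (m - {#i#}) \<otimes>\<^bsub>T\<^esub> ind i"
    unfolding ind_eq using assms subsetD[OF assms(2,1)] by (simp add: mterm_mult)
  show "mterm c (m - {#i#}) \<in> carrier T" using assms by (intro mterm_closed) (auto dest: in_diffD)
qed

definition "axis k = range (\<lambda>n. replicate_mset n k)" for k :: 'i

lemma axis_sub: "m \<in> axis k \<Longrightarrow> l \<subseteq># m \<Longrightarrow> l \<in> axis k"
proof -
  assume "m \<in> axis k" and l: "l \<subseteq># m"
  then obtain n where "m = replicate_mset n k" unfolding axis_def by blast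
  then have "l \<in> (\<lambda>i. replicate_mset i k) ` {..n}" using l submultisets_replicate[of n k] by blast
  then show ?thesis unfolding axis_def by blast
qed

lemma mem_axis_iff: "m \<in> axis k \<longleftrightarrow> set_mset m \<subseteq> {k}"
proof
  show "set_mset m \<subseteq> {k}" if "m \<in> axis k" using that unfolding axis_def by (auto split: if_splits)
  show "m \<in> axis k" if "set_mset m \<subseteq> {k}" using set_mset_subset_singletonD[OF that] unfolding axis_def by blast
qed

lemma genideal_others: "Idl\<^bsub>T\<^esub> {ind i | i. i \<in> S \<and> i \<noteq> k} = vanish (axis k)"
proof (rule genideal_eq_vanish[OF axis_sub])
  show "{ind i | i. i \<in> S \<and> i \<noteq> k} \<subseteq> vanish (axis k)"
  proof
    fix g assume "g \<in> {ind i | i. i \<in> S \<and> i \<noteq> k}"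
    then obtain i where i: "g = ind i" "i \<in> S" "i \<noteq> k" by blast
    have "ind i m = \<zero>" if "m \<in> axis k" for m using that i(3) unfolding mem_axis_iff ind_eq mterm_def by auto
    then show "g \<in> vanish (axis k)" using ind_closed[OF i(2)] unfolding vanish_def i(1) by blast
  qed
  fix m c assume m: "m \<notin> axis k" "set_mset m \<subseteq> S" "c \<in> carrier K"
  then obtain i where i: "i \<in># m" "i \<noteq> k" unfolding mem_axis_iff by blast
  moreover have "i \<in> S" using i m(2) by blast
  ultimately show "\<exists>u\<in>carrier T. \<exists>g\<in>{ind i | i. i \<in> S \<and> i \<noteq> k}. mterm c m = u \<otimes>\<^bsub>T\<^esub> g"
    using ex_ind_factor[OF i(1) m(2,3)] by blast
qed

lemma genideal_all: "Idl\<^bsub>T\<^esub> {ind i | i. i \<in> S} = vanish {{#}}"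
proof (rule genideal_eq_vanish)
  show "k \<in> {{#}}" if "m \<in> {{#}}" "k \<subseteq># m" for m k :: "'i multiset" using that by simp
  show "{ind i | i. i \<in> S} \<subseteq> vanish {{#}}"
  proof
    fix g assume "g \<in> {ind i | i. i \<in> S}"
    then obtain i where i: "g = ind i" "i \<in> S" by blast
    have "ind i {#} = \<zero>" unfolding ind_eq mterm_def by simp
    then show "g \<in> vanish {{#}}" using ind_closed[OF i(2)] unfolding vanish_def i(1) by blast
  qed
  fix m c assume m: "m \<notin> {{#}}" "set_mset m \<subseteq> S" "c \<in> carrier K"
  then have "m \<noteq> {#}" by simp
  then obtain i where i: "i \<in># m" using multiset_nonemptyE by blast
  moreover have "i \<in> S" using i m(2) by blast
  ultimately show "\<exists>u\<in>carrier T. \<exists>g\<in>{ind i | i. i \<in> S}. mterm c m = u \<otimes>\<^bsub>T\<^esub> g"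
    using ex_ind_factor[OF i(1) m(2,3)] by blast
qed

text \<open>A monomial off all axes involves two distinct variables. Nonemptiness of
  \<open>S\<close> guarantees that the constant monomial lies on some axis.\<close>

lemma genideal_pairs:
  assumes "S \<noteq> {}"
  shows "Idl\<^bsub>T\<^esub> {ind i \<otimes>\<^bsub>T\<^esub> ind k | i k. i \<in> S \<and> k \<in> S \<and> i \<noteq> k} = vanish (\<Union>k\<in>S. axis k)"
    (is "Idl\<^bsub>T\<^esub> ?G = _")
proof (rule genideal_eq_vanish)
  show "k \<in> (\<Union>k\<in>S. axis k)" if mk: "m \<in> (\<Union>k\<in>S. axis k)" "k \<subseteq># m" for m k
  proof -
    obtain j where "j \<in> S" "m \<in> axis j" using mk(1) by blast
    then show ?thesis using axis_sub[OF _ mk(2)] by blast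
  qed
  have ii: "ind i \<otimes>\<^bsub>T\<^esub> ind k = mterm \<one> {#i, k#}" if "k \<in> S" for i k
    unfolding ind_eq using that by (subst mterm_mult) (simp_all add: add_mset_commute)
  show "?G \<subseteq> vanish (\<Union>k\<in>S. axis k)"
  proof
    fix g assume "g \<in> ?G"
    then obtain i k where ik: "g = ind i \<otimes>\<^bsub>T\<^esub> ind k" "i \<in> S" "k \<in> S" "i \<noteq> k" by blast
    have "{#i, k#} \<notin> axis j" for j unfolding mem_axis_iff using ik(4) by auto
    then have "g m = \<zero>" if "m \<in> axis j" for m j using that unfolding ik(1) ii[OF ik(3)] mterm_def by metis
    moreover have "g \<in> carrier T" unfolding ik(1) using ind_closed ik by simp
    ultimately show "g \<in> vanish (\<Union>k\<in>S. axis k)" unfolding vanish_def by blast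
  qed
  fix m c assume m: "m \<notin> (\<Union>k\<in>S. axis k)" "set_mset m \<subseteq> S" "c \<in> carrier K"
  have "m \<noteq> {#}" using m(1) assms unfolding UN_iff mem_axis_iff by auto
  then obtain i where i: "i \<in># m" using multiset_nonemptyE by blast
  have iS: "i \<in> S" using i m(2) by blast
  then have "m \<notin> axis i" using m(1) by blast
  then obtain k where k: "k \<in># m" "k \<noteq> i" unfolding mem_axis_iff by blast
  have kS: "k \<in> S" using k m(2) by blast
  let ?m = "m - {#i#} - {#k#}"
  have meq: "m = ?m + {#i, k#}"
  proof -
    have "k \<in># m - {#i#}" using k by (simp add: in_diff_count)
    then have "add_mset k ?m = m - {#i#}" by (rule insert_DiffM)
    then have "add_mset i (add_mset k ?m) = m" using insert_DiffM[OF i] by (simp only:)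
    moreover have "?m + {#i, k#} = add_mset i (add_mset k ?m)" by (simp add: add_mset_commute)
    ultimately show ?thesis by (simp only:)
  qed
  have "mterm c m = mterm c ?m \<otimes>\<^bsub>T\<^esub> (ind i \<otimes>\<^bsub>T\<^esub> ind k)"
    unfolding ii[OF kS] using mterm_mult[OF m(3) one_closed, of "{#i, k#}" ?m] m(3) meq iS kS by simp
  moreover have "mterm c ?m \<in> carrier T" using m by (intro mterm_closed) (auto dest!: in_diffD)
  ultimately show "\<exists>u\<in>carrier T. \<exists>g\<in>?G. mterm c m = u \<otimes>\<^bsub>T\<^esub> g" using iS kS k(2) by blast
qed

end

section \<open>Localization\<close>

locale localize = cring A for A (structure) + fixes M
  assumes M_closed: "M \<subseteq> carrier A" and one_M [simp]: "\<one> \<in> M"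
    and mult_M [simp]: "s \<in> M \<Longrightarrow> t \<in> M \<Longrightarrow> s \<otimes> t \<in> M"
begin

abbreviation "L \<equiv> localization A M"

definition "fraction a s = frac_rel A M `` {(a, s)}"

lemma M_carrier [simp]: "s \<in> M \<Longrightarrow> s \<in> carrier A"
  using M_closed by blast

lemma frac_rel_iff: "((a, s), (b, t)) \<in> frac_rel A M \<longleftrightarrow>
    a \<in> carrier A \<and> s \<in> M \<and> b \<in> carrier A \<and> t \<in> M \<and> (\<exists>u\<in>M. u \<otimes> (a \<otimes> t \<ominus> b \<otimes> s) = \<zero>)"
  unfolding frac_rel_def by auto

lemma equiv_frac_rel: "equiv (carrier A \<times> M) (frac_rel A M)"
proof (rule equivI)
  show "frac_rel A M \<subseteq> (carrier A \<times> M) \<times> (carrier A \<times> M)"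
    unfolding frac_rel_def by blast
  show "refl_on (carrier A \<times> M) (frac_rel A M)"
  proof (rule refl_onI)
    fix z assume "z \<in> carrier A \<times> M"
    then obtain a s where z: "z = (a, s)" "a \<in> carrier A" "s \<in> M" by blast
    then have "\<one> \<otimes> (a \<otimes> s \<ominus> a \<otimes> s) = \<zero>" by (simp add: minus_eq r_neg)
    then show "(z, z) \<in> frac_rel A M" unfolding z(1) frac_rel_iff using z one_M by blast
  qed
  show "sym (frac_rel A M)"
  proof (rule symI)
    fix z w assume "(z, w) \<in> frac_rel A M"
    then obtain a s b t u where *: "z = (a, s)" "w = (b, t)" "a \<in> carrier A" "s \<in> M" "b \<in> carrier A" "t \<in> M" "u \<in> M"
      "u \<otimes> (a \<otimes> t \<ominus> b \<otimes> s) = \<zero>" by (metis frac_rel_iff prod.exhaust)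
    have "u \<otimes> (b \<otimes> s \<ominus> a \<otimes> t) = \<ominus> (u \<otimes> (a \<otimes> t \<ominus> b \<otimes> s))"
      using *(3,5) *(4,6,7)[THEN M_carrier] by algebra
    then have "u \<otimes> (b \<otimes> s \<ominus> a \<otimes> t) = \<zero>" unfolding *(8) by simp
    then show "(w, z) \<in> frac_rel A M" unfolding *(1,2) frac_rel_iff using * by blast
  qed
  show "trans (frac_rel A M)"
  proof (rule transI)
    fix x y z assume "(x, y) \<in> frac_rel A M" "(y, z) \<in> frac_rel A M"
    then obtain a s b t c w u v where *: "x = (a, s)" "y = (b, t)" "z = (c, w)"
      "a \<in> carrier A" "s \<in> M" "b \<in> carrier A" "t \<in> M" "c \<in> carrier A" "w \<in> M" "u \<in> M" "v \<in> M"
      "u \<otimes> (a \<otimes> t \<ominus> b \<otimes> s) = \<zero>" "v \<otimes> (b \<otimes> w \<ominus> c \<otimes> t) = \<zero>" by (metis frac_rel_iff prod.exhaust)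
    have "((u \<otimes> v) \<otimes> t) \<otimes> (a \<otimes> w \<ominus> c \<otimes> s)
        = (v \<otimes> w) \<otimes> (u \<otimes> (a \<otimes> t \<ominus> b \<otimes> s)) \<oplus> (u \<otimes> s) \<otimes> (v \<otimes> (b \<otimes> w \<ominus> c \<otimes> t))"
      using *(4,6,8) *(5,7,9,10,11)[THEN M_carrier] by algebra
    also have "\<dots> = \<zero>" unfolding *(12,13) using *(5,7,9,10,11)[THEN M_carrier] by simp
    finally show "(x, z) \<in> frac_rel A M" unfolding *(1,3) frac_rel_iff
      using *(4-11) mult_M by blast
  qed
qed

lemma fraction_eq_iff:
  assumes "a \<in> carrier A" "s \<in> M" "b \<in> carrier A" "t \<in> M"
  shows "fraction a s = fraction b t \<longleftrightarrow> (\<exists>u\<in>M. u \<otimes> (a \<otimes> t \<ominus> b \<otimes> s) = \<zero>)"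
  unfolding fraction_def using eq_equiv_class_iff[OF equiv_frac_rel, of "(a, s)" "(b, t)"] assms
  by (simp add: frac_rel_iff)

lemma fraction_eqI:
  assumes "a \<in> carrier A" "s \<in> M" "b \<in> carrier A" "t \<in> M" "a \<otimes> t = b \<otimes> s"
  shows "fraction a s = fraction b t"
proof -
  have "\<one> \<otimes> (a \<otimes> t \<ominus> b \<otimes> s) = \<zero>" using assms by (simp add: minus_eq r_neg)
  then show ?thesis unfolding fraction_eq_iff[OF assms(1-4)] using one_M by blast
qed

lemma mem_fraction_iff:
  assumes "a \<in> carrier A" "s \<in> M"
  shows "(b, t) \<in> fraction a s \<longleftrightarrow> b \<in> carrier A \<and> t \<in> M \<and> fraction a s = fraction b t"
  using assms fraction_eq_iff[of a s b t] unfolding fraction_def by (auto simp: frac_rel_iff)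

lemma carrier_L: "carrier L = {fraction a s | a s. a \<in> carrier A \<and> s \<in> M}"
  unfolding localization_def fraction_def quotient_def by auto

lemma fraction_closed [simp]: "a \<in> carrier A \<Longrightarrow> s \<in> M \<Longrightarrow> fraction a s \<in> carrier L"
  unfolding carrier_L by blast

lemma one_L: "\<one>\<^bsub>L\<^esub> = fraction \<one> \<one>" and zero_L: "\<zero>\<^bsub>L\<^esub> = fraction \<zero> \<one>"
  unfolding localization_def fraction_def by simp_all

text \<open>\<open>localization\<close> defines its operations by unions over all representatives.
  If the value does not depend on the representative, the union collapses to it.\<close>

lemma UN_fraction:
  assumes "a \<in> carrier A" "s \<in> M" and "\<And>b t. b \<in> carrier A \<Longrightarrow> t \<in> M \<Longrightarrow> fraction a s = fraction b t \<Longrightarrow> f b t = c"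
  shows "(\<Union>(b, t)\<in>fraction a s. f b t) = c"
proof (rule SUP_eq_const)
  have "(a, s) \<in> fraction a s" using assms by (simp add: mem_fraction_iff)
  then show "fraction a s \<noteq> {}" by blast
  fix z assume z: "z \<in> fraction a s"
  obtain b t where "z = (b, t)" by (rule prod.exhaust)
  then show "(case z of (b, t) \<Rightarrow> f b t) = c" using z assms by (simp add: mem_fraction_iff)
qed

lemma mult_L:
  assumes "a \<in> carrier A" "s \<in> M" "b \<in> carrier A" "t \<in> M"
  shows "fraction a s \<otimes>\<^bsub>L\<^esub> fraction b t = fraction (a \<otimes> b) (s \<otimes> t)"
proof -
  have eq: "fraction (a' \<otimes> b') (s' \<otimes> t') = fraction (a \<otimes> b) (s \<otimes> t)"
    if *: "a' \<in> carrier A" "s' \<in> M" "fraction a s = fraction a' s'" "b' \<in> carrier A" "t' \<in> M" "fraction b t = fraction b' t'"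
    for a' s' b' t'
  proof -
    obtain u where u: "u \<in> M" "u \<otimes> (a \<otimes> s' \<ominus> a' \<otimes> s) = \<zero>" using * assms fraction_eq_iff by blast
    obtain v where v: "v \<in> M" "v \<otimes> (b \<otimes> t' \<ominus> b' \<otimes> t) = \<zero>" using * assms fraction_eq_iff by blast
    have cl: "u \<in> carrier A" "v \<in> carrier A" "s \<in> carrier A" "t \<in> carrier A" "s' \<in> carrier A" "t' \<in> carrier A"
      using u v assms * by auto
    \<comment> \<open>The multiplier \<open>u \<otimes> v\<close> serves as witness because the
      difference of the two products is a combination of the two given relations.\<close>
    have "(u \<otimes> v) \<otimes> ((a \<otimes> b) \<otimes> (s' \<otimes> t') \<ominus> (a' \<otimes> b') \<otimes> (s \<otimes> t))
      = ((v \<otimes> b) \<otimes> t') \<otimes> (u \<otimes> (a \<otimes> s' \<ominus> a' \<otimes> s)) \<oplus> ((u \<otimes> a') \<otimes> s) \<otimes> (v \<otimes> (b \<otimes> t' \<ominus> b' \<otimes> t))"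
      using cl assms(1,3) *(1,4) by algebra
    also have "\<dots> = \<zero>" unfolding u(2) v(2) using cl assms(1,3) *(1,4) by simp
    finally have "fraction (a \<otimes> b) (s \<otimes> t) = fraction (a' \<otimes> b') (s' \<otimes> t')"
      using fraction_eq_iff[of "a \<otimes> b" "s \<otimes> t" "a' \<otimes> b'" "s' \<otimes> t'"] u v assms * mult_M m_closed by blast
    then show ?thesis by (rule sym)
  qed
  have "fraction a s \<otimes>\<^bsub>L\<^esub> fraction b t = (\<Union>(a, s)\<in>fraction a s. \<Union>(b, t)\<in>fraction b t. fraction (a \<otimes> b) (s \<otimes> t))"
    unfolding localization_def fraction_def by simp
  also have "\<dots> = fraction (a \<otimes> b) (s \<otimes> t)"
    by (intro UN_fraction assms eq)
  finally show ?thesis .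
qed

lemma add_L:
  assumes "a \<in> carrier A" "s \<in> M" "b \<in> carrier A" "t \<in> M"
  shows "fraction a s \<oplus>\<^bsub>L\<^esub> fraction b t = fraction (a \<otimes> t \<oplus> b \<otimes> s) (s \<otimes> t)"
proof -
  have eq: "fraction (a' \<otimes> t' \<oplus> b' \<otimes> s') (s' \<otimes> t') = fraction (a \<otimes> t \<oplus> b \<otimes> s) (s \<otimes> t)"
    if *: "a' \<in> carrier A" "s' \<in> M" "fraction a s = fraction a' s'" "b' \<in> carrier A" "t' \<in> M" "fraction b t = fraction b' t'"
    for a' s' b' t'
  proof -
    obtain u where u: "u \<in> M" "u \<otimes> (a \<otimes> s' \<ominus> a' \<otimes> s) = \<zero>" using * assms fraction_eq_iff by blast
    obtain v where v: "v \<in> M" "v \<otimes> (b \<otimes> t' \<ominus> b' \<otimes> t) = \<zero>" using * assms fraction_eq_iff by blast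
    have cl: "u \<in> carrier A" "v \<in> carrier A" "s \<in> carrier A" "t \<in> carrier A" "s' \<in> carrier A" "t' \<in> carrier A"
      using u v assms * by auto
    have "(u \<otimes> v) \<otimes> ((a \<otimes> t \<oplus> b \<otimes> s) \<otimes> (s' \<otimes> t') \<ominus> (a' \<otimes> t' \<oplus> b' \<otimes> s') \<otimes> (s \<otimes> t))
      = ((v \<otimes> t) \<otimes> t') \<otimes> (u \<otimes> (a \<otimes> s' \<ominus> a' \<otimes> s)) \<oplus> ((u \<otimes> s) \<otimes> s') \<otimes> (v \<otimes> (b \<otimes> t' \<ominus> b' \<otimes> t))"
      using cl assms(1,3) *(1,4) by algebra
    also have "\<dots> = \<zero>" unfolding u(2) v(2) using cl assms(1,3) *(1,4) by simp
    finally have "fraction (a \<otimes> t \<oplus> b \<otimes> s) (s \<otimes> t) = fraction (a' \<otimes> t' \<oplus> b' \<otimes> s') (s' \<otimes> t')"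
      by (intro fraction_eq_iff[THEN iffD2] bexI[of _ "u \<otimes> v"]) (use cl u(1) v(1) assms * in simp_all)
    then show ?thesis by (rule sym)
  qed
  have "fraction a s \<oplus>\<^bsub>L\<^esub> fraction b t = (\<Union>(a, s)\<in>fraction a s. \<Union>(b, t)\<in>fraction b t. fraction (a \<otimes> t \<oplus> b \<otimes> s) (s \<otimes> t))"
    unfolding localization_def fraction_def by simp
  also have "\<dots> = fraction (a \<otimes> t \<oplus> b \<otimes> s) (s \<otimes> t)"
    by (intro UN_fraction assms eq)
  finally show ?thesis .
qed

lemma L_cases:
  assumes "z \<in> carrier L"
  obtains a s where "a \<in> carrier A" "s \<in> M" "z = fraction a s"
  using assms unfolding carrier_L by blast

lemma L_cring: "cring L"
proof (rule cringI)
  show "abelian_group L"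
  proof (rule abelian_groupI)
    fix x y assume "x \<in> carrier L" "y \<in> carrier L"
    then obtain a s b t where *: "x = fraction a s" "y = fraction b t" "a \<in> carrier A" "s \<in> M" "b \<in> carrier A" "t \<in> M"
      by (metis L_cases)
    note cl = *(3,5) *(4,6)[THEN M_carrier]
    show "x \<oplus>\<^bsub>L\<^esub> y \<in> carrier L" unfolding *(1,2) add_L[OF *(3-6)] using * by simp
    show "x \<oplus>\<^bsub>L\<^esub> y = y \<oplus>\<^bsub>L\<^esub> x" unfolding *(1,2) add_L[OF *(3-6)] add_L[OF *(5,6,3,4)]
      using cl by (simp add: a_comm m_comm)
  next
    fix x y z assume "x \<in> carrier L" "y \<in> carrier L" "z \<in> carrier L"
    then obtain a s b t c u where *: "x = fraction a s" "y = fraction b t" "z = fraction c u"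
      "a \<in> carrier A" "s \<in> M" "b \<in> carrier A" "t \<in> M" "c \<in> carrier A" "u \<in> M"
      by (metis L_cases)
    note cl = *(4,6,8) *(5,7,9)[THEN M_carrier]
    have "x \<oplus>\<^bsub>L\<^esub> y \<oplus>\<^bsub>L\<^esub> z = fraction ((a \<otimes> t \<oplus> b \<otimes> s) \<otimes> u \<oplus> c \<otimes> (s \<otimes> t)) ((s \<otimes> t) \<otimes> u)"
      unfolding *(1-3) using *(4-9) by (simp add: add_L)
    also have "(a \<otimes> t \<oplus> b \<otimes> s) \<otimes> u \<oplus> c \<otimes> (s \<otimes> t) = a \<otimes> (t \<otimes> u) \<oplus> (b \<otimes> u \<oplus> c \<otimes> t) \<otimes> s"
      using cl by algebra
    also have "(s \<otimes> t) \<otimes> u = s \<otimes> (t \<otimes> u)" using cl by algebra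
    also have "fraction (a \<otimes> (t \<otimes> u) \<oplus> (b \<otimes> u \<oplus> c \<otimes> t) \<otimes> s) (s \<otimes> (t \<otimes> u)) = x \<oplus>\<^bsub>L\<^esub> (y \<oplus>\<^bsub>L\<^esub> z)"
      unfolding *(1-3) using *(4-9) by (simp add: add_L)
    finally show "x \<oplus>\<^bsub>L\<^esub> y \<oplus>\<^bsub>L\<^esub> z = x \<oplus>\<^bsub>L\<^esub> (y \<oplus>\<^bsub>L\<^esub> z)" .
  next
    show "\<zero>\<^bsub>L\<^esub> \<in> carrier L" unfolding zero_L by simp
    fix x assume "x \<in> carrier L"
    then obtain a s where *: "x = fraction a s" "a \<in> carrier A" "s \<in> M" by (metis L_cases)
    show "\<zero>\<^bsub>L\<^esub> \<oplus>\<^bsub>L\<^esub> x = x" unfolding zero_L *(1) using * by (simp add: add_L)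
    have "fraction (\<ominus> a) s \<oplus>\<^bsub>L\<^esub> x = fraction (\<ominus> a \<otimes> s \<oplus> a \<otimes> s) (s \<otimes> s)"
      unfolding *(1) using * by (simp add: add_L)
    also have "\<ominus> a \<otimes> s \<oplus> a \<otimes> s = \<zero>" using *(2) *(3)[THEN M_carrier] by algebra
    also have "fraction \<zero> (s \<otimes> s) = \<zero>\<^bsub>L\<^esub>" unfolding zero_L by (rule fraction_eqI) (use * in auto)
    finally show "\<exists>y\<in>carrier L. y \<oplus>\<^bsub>L\<^esub> x = \<zero>\<^bsub>L\<^esub>" using *(2,3) by (intro bexI[of _ "fraction (\<ominus> a) s"]) simp_all
  qed
  show "Group.comm_monoid L"
  proof (rule comm_monoidI)
    show "\<one>\<^bsub>L\<^esub> \<in> carrier L" unfolding one_L by simp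
    fix x assume x: "x \<in> carrier L"
    then obtain a s where *: "x = fraction a s" "a \<in> carrier A" "s \<in> M" by (metis L_cases)
    show "\<one>\<^bsub>L\<^esub> \<otimes>\<^bsub>L\<^esub> x = x" unfolding one_L *(1) using * by (simp add: mult_L)
    fix y assume "y \<in> carrier L"
    then obtain b t where **: "y = fraction b t" "b \<in> carrier A" "t \<in> M" by (metis L_cases)
    show "x \<otimes>\<^bsub>L\<^esub> y \<in> carrier L" unfolding * ** using * ** by (simp add: mult_L)
    show "x \<otimes>\<^bsub>L\<^esub> y = y \<otimes>\<^bsub>L\<^esub> x" unfolding *(1) **(1) using * ** by (simp add: mult_L m_comm)
    fix z assume "z \<in> carrier L"
    then obtain c u where ***: "z = fraction c u" "c \<in> carrier A" "u \<in> M" by (metis L_cases)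
    show "x \<otimes>\<^bsub>L\<^esub> y \<otimes>\<^bsub>L\<^esub> z = x \<otimes>\<^bsub>L\<^esub> (y \<otimes>\<^bsub>L\<^esub> z)"
      unfolding *(1) **(1) ***(1) using * ** *** by (simp add: mult_L m_assoc)
  qed
  fix x y z assume "x \<in> carrier L" "y \<in> carrier L" "z \<in> carrier L"
  then obtain a s b t c u where *: "x = fraction a s" "y = fraction b t" "z = fraction c u"
    "a \<in> carrier A" "s \<in> M" "b \<in> carrier A" "t \<in> M" "c \<in> carrier A" "u \<in> M"
    by (metis L_cases)
  note cl = *(4,6,8) *(5,7,9)[THEN M_carrier]
  show "(x \<oplus>\<^bsub>L\<^esub> y) \<otimes>\<^bsub>L\<^esub> z = x \<otimes>\<^bsub>L\<^esub> z \<oplus>\<^bsub>L\<^esub> y \<otimes>\<^bsub>L\<^esub> z"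
    unfolding *(1-3) add_L[OF *(4-7)] mult_L[OF *(4,5,8,9)] mult_L[OF *(6,7,8,9)]
  proof (subst mult_L)
    show "fraction ((a \<otimes> t \<oplus> b \<otimes> s) \<otimes> c) ((s \<otimes> t) \<otimes> u) = fraction (a \<otimes> c) (s \<otimes> u) \<oplus>\<^bsub>L\<^esub> fraction (b \<otimes> c) (t \<otimes> u)"
      by (subst add_L, use *(4-9) in simp_all, rule fraction_eqI, use *(4-9) in simp_all) (use cl in algebra)
  qed (use *(4-9) in simp_all)
qed

sublocale L: cring L by (rule L_cring)

lemma fraction_pow: "a \<in> carrier A \<Longrightarrow> s \<in> M \<Longrightarrow> fraction a s [^]\<^bsub>L\<^esub> (n::nat) = fraction (a [^] n) (s [^] n) \<and> s [^] n \<in> M"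
  by (induction n) (simp_all add: one_L mult_L)

lemma fraction_eq_zero_iff:
  assumes "a \<in> carrier A" "s \<in> M"
  shows "fraction a s = \<zero>\<^bsub>L\<^esub> \<longleftrightarrow> (\<exists>u\<in>M. u \<otimes> a = \<zero>)"
  unfolding zero_L fraction_eq_iff[OF assms zero_closed one_M] using assms by (simp add: minus_eq)

lemma reduced_localization:
  assumes "reduced_ring A"
  shows "reduced_ring L"
  unfolding reduced_ring_def
proof (intro conjI ballI allI impI)
  show "cring L" by (rule L_cring)
  fix x and n :: nat assume "x \<in> carrier L" and x0: "x [^]\<^bsub>L\<^esub> n = \<zero>\<^bsub>L\<^esub>"
  then obtain a s where *: "x = fraction a s" "a \<in> carrier A" "s \<in> M" by (metis L_cases)
  then obtain u where u: "u \<in> M" "u \<otimes> a [^] n = \<zero>"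
    using x0 fraction_pow[OF *(2,3), of n] fraction_eq_zero_iff[of "a [^] n" "s [^] n"] by auto
  \<comment> \<open>The exponent \<open>Suc n\<close> instead of \<open>n\<close> ensures that a
    factor \<open>u\<close> is available even for \<open>n = 0\<close>.\<close>
  have "(u \<otimes> a) [^] Suc n = (u [^] n \<otimes> a) \<otimes> (u \<otimes> a [^] n)"
    using u(1)[THEN M_carrier] *(2) by (simp add: nat_pow_distrib m_ac)
  also have "\<dots> = \<zero>" unfolding u(2) using u(1)[THEN M_carrier] *(2) by simp
  finally have "u \<otimes> a = \<zero>" using assms u(1)[THEN M_carrier] *(2) unfolding reduced_ring_def by (metis m_closed)
  then show "x = \<zero>\<^bsub>L\<^esub>" using fraction_eq_zero_iff[OF *(2,3)] u(1) *(1) by blast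
qed

section \<open>Primes of a localization\<close>

definition "loc_ideal P = {fraction a s | a s. a \<in> P \<and> s \<in> M}"

text \<open>Two representatives are related by an equation whose extra factors come from
  \<open>M\<close>. None of them lies in \<open>P\<close>, so primeness cancels them, and the
  numerator of any representative decides membership.\<close>

lemma fraction_mem_loc_ideal_iff:
  assumes P: "primeideal P A" "P \<inter> M = {}" and a: "a \<in> carrier A" "s \<in> M"
  shows "fraction a s \<in> loc_ideal P \<longleftrightarrow> a \<in> P"
proof
  interpret P: primeideal P A by fact
  assume "fraction a s \<in> loc_ideal P"
  then obtain b t where b: "fraction a s = fraction b t" "b \<in> P" "t \<in> M" unfolding loc_ideal_def by blast
  then have bA: "b \<in> carrier A" using P.Icarr by blast
  obtain u where u: "u \<in> M" "u \<otimes> (a \<otimes> t \<ominus> b \<otimes> s) = \<zero>" using b(1) fraction_eq_iff[OF a bA b(3)] by blast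
  have cl: "u \<in> carrier A" "t \<in> carrier A" "s \<in> carrier A" using u b a by auto
  have "(a \<otimes> t) \<otimes> u = u \<otimes> (a \<otimes> t \<ominus> b \<otimes> s) \<oplus> (u \<otimes> s) \<otimes> b" using cl a(1) bA by algebra
  also have "\<dots> \<in> P" unfolding u(2) using P.zero_closed b(2) cl by (intro P.a_closed P.I_l_closed) auto
  finally have "a \<otimes> t \<in> P \<or> u \<in> P" using P.I_prime cl a(1) by simp
  then have "a \<otimes> t \<in> P" using u(1) P(2) by blast
  then have "a \<in> P \<or> t \<in> P" using P.I_prime cl a(1) by simp
  then show "a \<in> P" using b(3) P(2) by blast
next
  assume "a \<in> P"
  then show "fraction a s \<in> loc_ideal P" unfolding loc_ideal_def using a by blast
qed

lemma loc_ideal_subset_iff: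
  assumes P: "primeideal P A" "P \<inter> M = {}" and Q: "primeideal Q A" "Q \<inter> M = {}"
  shows "loc_ideal P \<subseteq> loc_ideal Q \<longleftrightarrow> P \<subseteq> Q"
proof
  assume sub: "loc_ideal P \<subseteq> loc_ideal Q"
  show "P \<subseteq> Q"
  proof
    fix a assume a: "a \<in> P"
    then have "a \<in> carrier A" using ideal.Icarr[OF primeideal.axioms(1)[OF P(1)]] by blast
    then show "a \<in> Q"
      using fraction_mem_loc_ideal_iff[OF P, of a \<one>] fraction_mem_loc_ideal_iff[OF Q, of a \<one>] sub a one_M by blast
  qed
next
  assume "P \<subseteq> Q"
  then show "loc_ideal P \<subseteq> loc_ideal Q" unfolding loc_ideal_def by blast
qed

lemma loc_ideal_primeideal:
  assumes P: "primeideal P A" "P \<inter> M = {}"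
  shows "primeideal (loc_ideal P) L"
proof -
  interpret P: primeideal P A by fact
  note mem = fraction_mem_loc_ideal_iff[OF P]
  have id: "ideal (loc_ideal P) L"
  proof (rule L.ideal_if_submod[OF submodI])
    show "loc_ideal P \<subseteq> carrier L" unfolding loc_ideal_def carrier_L using P.Icarr by blast
    show "\<zero>\<^bsub>L\<^esub> \<in> loc_ideal P" using mem[of \<zero> \<one>] P.zero_closed by (simp add: zero_L)
    show "x \<oplus>\<^bsub>L\<^esub> y \<in> loc_ideal P" if xy: "x \<in> loc_ideal P" "y \<in> loc_ideal P" for x y
    proof -
      obtain a s b t where *: "x = fraction a s" "y = fraction b t" "a \<in> P" "s \<in> M" "b \<in> P" "t \<in> M"
        using xy unfolding loc_ideal_def by blast
      then have "a \<otimes> t \<oplus> b \<otimes> s \<in> P" by (intro P.a_closed P.I_r_closed) auto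
      then show ?thesis using * P.Icarr[OF *(3)] P.Icarr[OF *(5)] by (simp add: add_L mem)
    qed
    show "y \<otimes>\<^bsub>L\<^esub> x \<in> loc_ideal P" if xy: "y \<in> carrier L" "x \<in> loc_ideal P" for x y
    proof -
      obtain a s b t where *: "x = fraction a s" "y = fraction b t" "a \<in> P" "s \<in> M" "b \<in> carrier A" "t \<in> M"
        using xy unfolding loc_ideal_def carrier_L by blast
      then have "b \<otimes> a \<in> P" by (intro P.I_l_closed)
      then show ?thesis using * P.Icarr[OF *(3)] by (simp add: mult_L mem)
    qed
  qed
  show ?thesis
  proof (rule primeidealI[OF id L_cring])
    have "\<one>\<^bsub>L\<^esub> \<notin> loc_ideal P" unfolding one_L mem[OF one_closed one_M] by (rule P.one_notin)
    then show "carrier L \<noteq> loc_ideal P" using L.one_closed by blast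
    fix x y assume "x \<in> carrier L" "y \<in> carrier L" and xy: "x \<otimes>\<^bsub>L\<^esub> y \<in> loc_ideal P"
    then obtain a s b t where *: "x = fraction a s" "y = fraction b t" "a \<in> carrier A" "s \<in> M" "b \<in> carrier A" "t \<in> M"
      by (metis L_cases)
    then have "a \<otimes> b \<in> P" using xy by (simp add: mult_L mem)
    then have "a \<in> P \<or> b \<in> P" using P.I_prime * by blast
    then show "x \<in> loc_ideal P \<or> y \<in> loc_ideal P" using * by (simp add: mem)
  qed
qed

text \<open>The fractions \<open>a/s\<close> and \<open>a/1\<close> differ by a unit, so a prime is
  determined by the numerators it contains. Such a numerator cannot lie in \<open>M\<close>, as it
  would be a unit.\<close>

lemma primeideal_L_cases:
  assumes Q: "primeideal Q L"
  obtains P where "primeideal P A" "P \<inter> M = {}" "Q = loc_ideal P"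
proof -
  interpret Q: primeideal Q L by fact
  define P where "P = {a \<in> carrier A. fraction a \<one> \<in> Q}"
  have hom: "ring_hom_ring A L (\<lambda>a. fraction a \<one>)"
    by (rule ring_hom_ringI) (auto simp: ring_axioms L.ring_axioms mult_L add_L one_L)
  have P: "primeideal P A" unfolding P_def by (rule ring_hom_ring.primeideal_vimage[OF hom is_cring Q])
  have inv: "fraction s \<one> \<otimes>\<^bsub>L\<^esub> fraction \<one> s = \<one>\<^bsub>L\<^esub>" if "s \<in> M" for s
  proof -
    have "fraction s \<one> \<otimes>\<^bsub>L\<^esub> fraction \<one> s = fraction (s \<otimes> \<one>) (\<one> \<otimes> s)"
      by (rule mult_L) (use that in simp_all)
    also have "\<dots> = fraction \<one> \<one>" by (rule fraction_eqI) (use that in simp_all)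
    finally show ?thesis unfolding one_L .
  qed
  have dis: "P \<inter> M = {}"
  proof (rule ccontr)
    assume "P \<inter> M \<noteq> {}"
    then obtain s where s: "s \<in> M" "fraction s \<one> \<in> Q" unfolding P_def by blast
    then have "fraction s \<one> \<otimes>\<^bsub>L\<^esub> fraction \<one> s \<in> Q" by (intro Q.I_r_closed) auto
    then show False using inv[OF s(1)] Q.one_notin by simp
  qed
  have mem: "fraction a s \<in> Q \<longleftrightarrow> a \<in> P" if as: "a \<in> carrier A" "s \<in> M" for a s
  proof
    have 1: "fraction a s = fraction a \<one> \<otimes>\<^bsub>L\<^esub> fraction \<one> s" using as by (simp add: mult_L)
    have 2: "fraction a \<one> = fraction a s \<otimes>\<^bsub>L\<^esub> fraction s \<one>"
    proof -
      have "fraction a s \<otimes>\<^bsub>L\<^esub> fraction s \<one> = fraction (a \<otimes> s) (s \<otimes> \<one>)"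
        by (rule mult_L) (use as in simp_all)
      also have "\<dots> = fraction a \<one>" by (rule fraction_eqI) (use as in simp_all)
      finally show ?thesis by (rule sym)
    qed
    show "a \<in> P" if "fraction a s \<in> Q"
    proof -
      have "fraction a s \<otimes>\<^bsub>L\<^esub> fraction s \<one> \<in> Q" by (rule Q.I_r_closed[OF that]) (use as in simp)
      then show ?thesis unfolding P_def using 2 as by simp
    qed
    show "fraction a s \<in> Q" if "a \<in> P"
      unfolding 1 by (rule Q.I_r_closed) (use that as in \<open>auto simp: P_def\<close>)
  qed
  have "Q = loc_ideal P"
  proof
    show "Q \<subseteq> loc_ideal P"
    proof
      fix x assume x: "x \<in> Q"
      obtain a s where "a \<in> carrier A" "s \<in> M" "x = fraction a s" by (rule L_cases[OF Q.Icarr[OF x]])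
      then show "x \<in> loc_ideal P" using mem x unfolding loc_ideal_def by blast
    qed
    show "loc_ideal P \<subseteq> Q" unfolding loc_ideal_def using mem P_def by blast
  qed
  then show thesis using that P dis by blast
qed

end

section \<open>Localization at a prime ideal\<close>

lemma (in primeideal) localize_complement: "localize R (carrier R - I)"
proof (intro localize.intro localize_axioms.intro is_cring)
  show "\<one> \<in> carrier R - I" using one_notin by simp
  show "carrier R - I \<subseteq> carrier R" by (rule Diff_subset)
  show "s \<otimes> t \<in> carrier R - I" if "s \<in> carrier R - I" "t \<in> carrier R - I" for s t
    using that I_prime[of s t] by auto
qed

lemma (in primeideal) local_localization_at: "local_ring (localization_at R I)"
proof -
  interpret l: localize R "carrier R - I" by (rule localize_complement)
  have dis: "I \<inter> (carrier R - I) = {}" by blast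
  note mem = l.fraction_mem_loc_ideal_iff[OF primeideal dis]
  interpret m: primeideal "l.loc_ideal I" l.L by (rule l.loc_ideal_primeideal[OF primeideal dis])
  have max: "maximalideal (l.loc_ideal I) l.L"
  proof (rule maximalidealI[OF m.is_ideal])
    show "carrier l.L \<noteq> l.loc_ideal I" by (rule m.I_notcarr)
    fix J assume J: "ideal J l.L" "l.loc_ideal I \<subseteq> J" "J \<subseteq> carrier l.L"
    interpret J: ideal J l.L by fact
    show "J = l.loc_ideal I \<or> J = carrier l.L"
    proof (rule disjCI)
      assume "J \<noteq> carrier l.L"
      have "x \<in> l.loc_ideal I" if x: "x \<in> J" for x
      proof (rule ccontr)
        assume xn: "x \<notin> l.loc_ideal I"
        obtain a s where *: "a \<in> carrier R" "s \<in> carrier R - I" "x = l.fraction a s" by (rule l.L_cases[OF J.Icarr[OF x]])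
        \<comment> \<open>With its numerator outside \<open>I\<close>, the fraction
          \<open>a/s\<close> has the inverse \<open>s/a\<close>.\<close>
        then have a: "a \<in> carrier R - I" using xn mem by blast
        have "x \<otimes>\<^bsub>l.L\<^esub> l.fraction s a \<in> J" by (rule J.I_r_closed[OF x]) (use * a in simp)
        moreover have "x \<otimes>\<^bsub>l.L\<^esub> l.fraction s a = \<one>\<^bsub>l.L\<^esub>"
        proof -
          have sR: "s \<in> carrier R" "a \<in> carrier R" using * by blast+
          have "x \<otimes>\<^bsub>l.L\<^esub> l.fraction s a = l.fraction (a \<otimes> s) (s \<otimes> a)"
            unfolding *(3) by (rule l.mult_L[OF *(1,2) sR(1) a])
          also have "\<dots> = l.fraction \<one> \<one>"
            by (rule l.fraction_eqI[OF _ l.mult_M[OF *(2) a] _ l.one_M]) (use sR in \<open>simp_all add: m_comm\<close>)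
          finally show ?thesis unfolding l.one_L .
        qed
        ultimately show False using J.one_imp_carrier \<open>J \<noteq> carrier l.L\<close> by simp
      qed
      then show "J = l.loc_ideal I" using J(2) by blast
    qed
  qed
  have uniq: "N = l.loc_ideal I" if N: "maximalideal N l.L" for N
  proof -
    interpret N: maximalideal N l.L by fact
    have "primeideal N l.L" by (rule l.L.maximalideal_prime[OF N])
    then obtain P where P: "primeideal P R" "P \<inter> (carrier R - I) = {}" "N = l.loc_ideal P"
      using l.primeideal_L_cases by blast
    then have "P \<subseteq> I" using ideal.Icarr[OF primeideal.axioms(1)[OF P(1)]] by blast
    then have "N \<subseteq> l.loc_ideal I" unfolding P(3) using l.loc_ideal_subset_iff[OF P(1,2) primeideal dis] by blast
    then show ?thesis using N.I_maximal[OF m.is_ideal] m.a_subset m.I_notcarr by blast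
  qed
  show ?thesis unfolding local_ring_def localization_at_def using l.L_cring max uniq by blast
qed

section \<open>Reducedness, minimal primes, dimension\<close>

lemma reduced_ringD:
  "reduced_ring R \<Longrightarrow> x \<in> carrier R \<Longrightarrow> x [^]\<^bsub>R\<^esub> (n::nat) = \<zero>\<^bsub>R\<^esub> \<Longrightarrow> x = \<zero>\<^bsub>R\<^esub>"
  unfolding reduced_ring_def by blast

lemma (in "domain") domain_reduced: "reduced_ring R"
  unfolding reduced_ring_def
proof (intro conjI ballI allI impI cring_axioms)
  fix x and n :: nat assume x: "x \<in> carrier R" and "x [^] n = \<zero>"
  then show "x = \<zero>"
  proof (induction n)
    case 0 then show ?case by simp
  next
    case (Suc n) then show ?case using integral[of "x [^] n" x] by auto
  qed
qed

text \<open>With zero divisors degrees need not add, but the coefficient of \<open>f^k\<close> at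
  \<open>k N\<close> is still the \<open>k\<close>-th power of the coefficient of \<open>f\<close>
  at \<open>N\<close>. The latter is therefore nilpotent, hence zero, and the degree bound
  drops.\<close>

lemma (in UP_cring) reduced_UP:
  assumes "reduced_ring R"
  shows "reduced_ring P"
  unfolding reduced_ring_def
proof (intro conjI ballI allI impI)
  show "cring P" by (rule P.is_cring)
  fix f and n :: nat assume f: "f \<in> carrier P" and fn: "f [^]\<^bsub>P\<^esub> n = \<zero>\<^bsub>P\<^esub>"
  have "f = \<zero>\<^bsub>P\<^esub>" if "f \<in> span_pow P scalars indet N" for N
    using that
  proof (induction N)
    case 0 then show ?case by simp
  next
    case (Suc N)
    have N: "cf f i = \<zero>" if "i > N" for i using Suc.prems that unfolding span_pow_eq by simp
    have top: "(\<forall>i>k * N. cf (f [^]\<^bsub>P\<^esub> k) i = \<zero>) \<and> cf (f [^]\<^bsub>P\<^esub> k) (k * N) = cf f N [^] k" for k :: nat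
    proof (induction k)
      case 0 then show ?case by simp
    next
      case (Suc k)
      let ?g = "f [^]\<^bsub>P\<^esub> k"
      have g: "?g \<in> carrier P" using f by simp
      have zero: "cf ?g j \<otimes> cf f (i - j) = \<zero>" if "Suc k * N \<le> i" "j \<le> i" "j \<noteq> k * N \<or> i \<noteq> Suc k * N" for i j
      proof (cases "j > k * N")
        case True
        then show ?thesis using Suc f by simp
      next
        case False
        then have "i - j > N" using that by auto
        then show ?thesis using N f g by simp
      qed
      have "cf (f [^]\<^bsub>P\<^esub> Suc k) i = \<zero>" if "i > Suc k * N" for i
      proof -
        have "cf (f [^]\<^bsub>P\<^esub> Suc k) i = (\<Oplus>j\<in>{..i}. cf ?g j \<otimes> cf f (i - j))" using f g by simp
        also have "\<dots> = \<zero>" by (rule R.add.finprod_one_eqI) (use zero[of i] that in simp)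
        finally show ?thesis .
      qed
      moreover have "cf (f [^]\<^bsub>P\<^esub> Suc k) (Suc k * N) = cf f N [^] Suc k"
      proof -
        have "cf (f [^]\<^bsub>P\<^esub> Suc k) (Suc k * N) = (\<Oplus>j\<in>{..Suc k * N}. cf ?g j \<otimes> cf f (Suc k * N - j))" using f g by simp
        also have "\<dots> = (\<Oplus>j\<in>{..Suc k * N}. if k * N = j then cf ?g j \<otimes> cf f (Suc k * N - j) else \<zero>)"
          by (rule R.finsum_cong') (use zero[of "Suc k * N"] f g in auto)
        also have "\<dots> = cf ?g (k * N) \<otimes> cf f (Suc k * N - k * N)"
          by (rule R.finsum_singleton) (use f g in auto)
        also have "\<dots> = cf f N [^] Suc k" using Suc by simp
        finally show ?thesis .
      qed
      ultimately show ?case by blast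
    qed
    have "cf f N [^] n = \<zero>" using top[of n] fn by simp
    then have "cf f N = \<zero>" by (rule reduced_ringD[OF assms coeff_closed[OF f]])
    then have "cf f i = \<zero>" if "i \<ge> N" for i using N[of i] that by (cases "i = N") auto
    then show ?case using Suc.IH f unfolding span_pow_eq by blast
  qed
  then show "f = \<zero>\<^bsub>P\<^esub>" using ex_span_pow[OF f] by blast
qed

lemma (in ring_epi) reduced_ring_iff:
  "reduced_ring S \<longleftrightarrow> (\<forall>a\<in>carrier R. \<forall>n::nat. a [^] n \<in> ker \<longrightarrow> a \<in> ker)"
proof
  assume red: "reduced_ring S"
  show "\<forall>a\<in>carrier R. \<forall>n::nat. a [^] n \<in> ker \<longrightarrow> a \<in> ker"
  proof (intro ballI allI impI)
    fix a and n :: nat assume a: "a \<in> carrier R" and "a [^] n \<in> ker"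
    then have "h a [^]\<^bsub>S\<^esub> n = \<zero>\<^bsub>S\<^esub>" unfolding ker_def by simp
    from reduced_ringD[OF red _ this] show "a \<in> ker" using a unfolding ker_def by simp
  qed
next
  assume rad: "\<forall>a\<in>carrier R. \<forall>n::nat. a [^] n \<in> ker \<longrightarrow> a \<in> ker"
  show "reduced_ring S"
    unfolding reduced_ring_def
  proof (intro conjI ballI allI impI)
    show "cring S" by (rule S.is_cring)
    fix y and n :: nat assume "y \<in> carrier S" and y: "y [^]\<^bsub>S\<^esub> n = \<zero>\<^bsub>S\<^esub>"
    then have "y \<in> h ` carrier R" using surj by simp
    then obtain a where a: "a \<in> carrier R" "y = h a" by blast
    then have "a [^] n \<in> ker" using y unfolding ker_def by simp
    then have "a \<in> ker" using rad a(1) by blast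
    then show "y = \<zero>\<^bsub>S\<^esub>" using a(2) unfolding ker_def by simp
  qed
qed

text \<open>The assumption \<open>Q 0\<close> makes the set on the right nonempty, so that the
  successor commutes with its supremum.\<close>

lemma Sup_enat_Suc:
  assumes "Q 0" "\<And>n. P (Suc n) \<longleftrightarrow> Q n"
  shows "Sup {enat n | n. P n} = Sup {enat n | n. Q n} + 1"
proof -
  have "Sup {enat n | n. Q n} + 1 = Sup (eSuc ` {enat n | n. Q n})"
    using eSuc_Sup[of "{enat n | n. Q n}"] assms(1) by (auto simp: eSuc_plus_1)
  also have "\<dots> = Sup {enat n | n. P n}"
  proof (rule antisym)
    show "Sup (eSuc ` {enat n | n. Q n}) \<le> Sup {enat n | n. P n}"
    proof (rule Sup_least)
      fix y assume "y \<in> eSuc ` {enat n | n. Q n}"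
      then obtain n where "y = enat (Suc n)" "Q n" by (auto simp: eSuc_enat)
      then show "y \<le> Sup {enat n | n. P n}" using assms(2) by (intro Sup_upper) auto
    qed
    show "Sup {enat n | n. P n} \<le> Sup (eSuc ` {enat n | n. Q n})"
    proof (rule Sup_least)
      fix y assume "y \<in> {enat n | n. P n}"
      then obtain n where n: "y = enat n" "P n" by blast
      show "y \<le> Sup (eSuc ` {enat n | n. Q n})"
      proof (cases n)
        case 0
        then show ?thesis using n by (simp add: zero_enat_def[symmetric])
      next
        case (Suc m)
        then have "Q m" "y = eSuc (enat m)" using n assms(2) by (auto simp: eSuc_enat)
        then show ?thesis by (intro Sup_upper) blast
      qed
    qed
  qed
  finally show ?thesis by (rule sym)
qed

text \<open>The primes form a star: a greatest prime \<mm> and pairwise incomparable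
  \<open>N k\<close> below it. The element \<open>y k\<close> acts as the coordinate on the
  \<open>k\<close>-th axis and lies in every prime except \<open>N k\<close>. A family of primes
  with intersection inside \<open>N k\<close> must therefore contain \<open>N k\<close>.\<close>

lemma star_spectrum:
  assumes R: "cring R" and S: "infinite S"
    and primes: "\<And>Q. primeideal Q R \<longleftrightarrow> Q = \<mm> \<or> (\<exists>k\<in>S. Q = N k)"
    and N: "\<And>k. k \<in> S \<Longrightarrow> N k \<subseteq> \<mm>"
    and y: "\<And>k. k \<in> S \<Longrightarrow> y k \<in> \<mm>" "\<And>k l. k \<in> S \<Longrightarrow> l \<in> S \<Longrightarrow> y k \<in> N l \<longleftrightarrow> k \<noteq> l"
  shows "pz_ring R" "krull_dim R = 1" "infinite (minimal_primes R {\<zero>\<^bsub>R\<^esub>})"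
proof -
  have \<mm>: "primeideal \<mm> R" and Np: "\<And>k. k \<in> S \<Longrightarrow> primeideal (N k) R" using primes by blast+
  have lt: "N k \<subset> \<mm>" if "k \<in> S" for k using N[OF that] y(1)[OF that] y(2)[OF that that] by blast
  have inj: "k = l" if "k \<in> S" "l \<in> S" "N k \<subseteq> N l" for k l
    using y(2)[OF that(2,1)] y(2)[OF that(2,2)] that(3) by blast
  obtain k0 where k0: "k0 \<in> S" using S by (metis ex_in_conv finite.emptyI)
  show "pz_ring R"
    unfolding pz_ring_def
  proof (intro conjI allI impI, rule R)
    fix P F assume "primeideal P R \<and> (\<forall>Q\<in>F. primeideal Q R) \<and> carrier R \<inter> \<Inter>F \<subseteq> P"
    then have PF: "primeideal P R" "\<And>Q. Q \<in> F \<Longrightarrow> primeideal Q R" "carrier R \<inter> \<Inter>F \<subseteq> P" by auto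
    from primes[of P] PF(1) consider "P = \<mm>" | k where "k \<in> S" "P = N k" by blast
    then show "\<exists>Q\<in>F. Q \<subseteq> P"
    proof cases
      case 1
      have "F \<noteq> {}"
      proof
        assume "F = {}"
        then have "carrier R \<subseteq> P" using PF(3) by simp
        then show False using primeideal.I_notcarr[OF PF(1)] ideal.Icarr[OF primeideal.axioms(1)[OF PF(1)]] by blast
      qed
      then obtain Q where "Q \<in> F" by blast
      moreover have "Q \<subseteq> \<mm>" using primes[of Q] PF(2)[OF \<open>Q \<in> F\<close>] N by blast
      ultimately show ?thesis using 1 by blast
    next
      case 2
      show ?thesis
      proof (rule ccontr)
        assume no: "\<not> ?thesis"
        have "y k \<in> Q" if QF: "Q \<in> F" for Q
        proof -
          from primes[of Q] PF(2)[OF QF] consider "Q = \<mm>" | l where "l \<in> S" "Q = N l" by blast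
          then show ?thesis
          proof cases
            case 1 then show ?thesis using y(1) 2(1) by simp
          next
            case (2 l)
            then have "l \<noteq> k" using no QF \<open>P = N k\<close> by blast
            then show ?thesis using y(2)[OF \<open>k \<in> S\<close> 2(1)] 2(2) by simp
          qed
        qed
        moreover have "y k \<in> carrier R"
          using y(1)[OF 2(1)] ideal.Icarr[OF primeideal.axioms(1)[OF \<mm>]] by blast
        ultimately have "y k \<in> P" using PF(3) by blast
        then show False using 2 y(2) by simp
      qed
    qed
  qed
  have chain: "(\<exists>P. pchain R {} n P) \<longleftrightarrow> n \<le> 1" for n
  proof
    assume "\<exists>P. pchain R {} n P"
    show "n \<le> 1"
    proof (rule ccontr)
      assume "\<not> n \<le> 1"
      then obtain m where m: "n = Suc (Suc m)" by (metis One_nat_def Suc_le_eq not0_implies_Suc not_le zero_less_iff_neq_zero le_0_eq nat_le_linear)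
      then obtain P2 P1 P0 where P: "primeideal P2 R" "P1 \<subset> P2" "primeideal P1 R" "P0 \<subset> P1" "pchain R {} m P0"
        using \<open>\<exists>P. pchain R {} n P\<close> by auto
      note P0 = pchain_primeideal[OF P(5)]
      have "P1 \<noteq> \<mm>" using primes[of P2] P(1,2) lt by blast
      then obtain k where k: "k \<in> S" "P1 = N k" using primes[of P1] P(3) by blast
      have "P0 \<noteq> \<mm>" using P(4) k lt[OF k(1)] by blast
      then obtain l where l: "l \<in> S" "P0 = N l" using primes[of P0] P0 by blast
      then show False using inj[of l k] k P(4) by blast
    qed
  next
    assume "n \<le> 1"
    have "pchain R {} 0 (N k0)" "pchain R {} (Suc 0) \<mm>" using Np[OF k0] \<mm> lt[OF k0] by auto
    moreover have "n = 0 \<or> n = Suc 0" using \<open>n \<le> 1\<close> by auto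
    ultimately show "\<exists>P. pchain R {} n P" by blast
  qed
  show "krull_dim R = 1"
    unfolding krull_dim_pchain chain
  proof (rule antisym)
    show "Sup {enat n |n. n \<le> 1} \<le> 1" by (rule Sup_least) (auto simp: one_enat_def)
    show "1 \<le> Sup {enat n |n. n \<le> 1}" by (rule Sup_upper) (auto simp: one_enat_def)
  qed
  have "N k \<in> minimal_primes R {\<zero>\<^bsub>R\<^esub>}" if k: "k \<in> S" for k
    unfolding minimal_primes_def
  proof (intro CollectI conjI allI impI)
    show "primeideal (N k) R" by (rule Np[OF k])
    show "{\<zero>\<^bsub>R\<^esub>} \<subseteq> N k"
      using additive_subgroup.zero_closed[OF ideal.axioms(1)[OF primeideal.axioms(1)[OF Np[OF k]]]] by simp
    fix Q assume Q: "primeideal Q R \<and> {\<zero>\<^bsub>R\<^esub>} \<subseteq> Q \<and> Q \<subseteq> N k"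
    then have "Q \<noteq> \<mm>" using lt[OF k] by blast
    then obtain l where l: "l \<in> S" "Q = N l" using primes[of Q] Q by blast
    then show "Q = N k" using inj[of l k] k Q by blast
  qed
  then have "N ` S \<subseteq> minimal_primes R {\<zero>\<^bsub>R\<^esub>}" by blast
  moreover have "infinite (N ` S)" using S inj by (subst finite_image_iff) (auto simp: inj_on_def)
  ultimately show "infinite (minimal_primes R {\<zero>\<^bsub>R\<^esub>})" using finite_subset by blast
qed

lemma (in UP_cring) krull_dim_UP:
  assumes "noetherian_ring R" "domain R"
  shows "krull_dim P = krull_dim R + 1"
  unfolding krull_dim_pchain
proof (rule Sup_enat_Suc)
  interpret D: "domain" R by fact
  show "\<exists>p. pchain R {} 0 p" using D.zeroprimeideal by auto
  show "(\<exists>Q. pchain P {} (Suc n) Q) \<longleftrightarrow> (\<exists>p. pchain R {} n p)" for n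
    by (rule ex_pchain_UP_iff[OF assms(1)])
qed

section \<open>The union of the coordinate axes\<close>

context mpoly_cring
begin

definition "J k = vanish (axis k)"
definition "I = vanish (\<Union>k\<in>S. axis k)"
definition "\<mm> = vanish {{#}}"

lemma I_ideal: "ideal I T"
  unfolding I_def by (rule vanish_ideal) (use axis_sub in blast)

lemma I_eq_INT: "S \<noteq> {} \<Longrightarrow> I = (\<Inter>k\<in>S. J k)"
  unfolding I_def J_def vanish_def by auto

lemma I_sub_J: "k \<in> S \<Longrightarrow> I \<subseteq> J k"
  unfolding I_def J_def vanish_def by auto

lemma proj_ker:
  assumes "k \<in> S"
  shows "ring_epi.ker T (UP K) (proj k) = J k"
proof -
  interpret p: ring_epi T "UP K" "proj k" by (rule proj_epi[OF assms])
  show ?thesis unfolding p.ker_def J_def vanish_def axis_def UP_apply(4) by (auto simp: proj_def fun_eq_iff)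
qed

lemma const_pow: "a \<in> carrier K \<Longrightarrow> mterm a {#} [^]\<^bsub>T\<^esub> (n::nat) = mterm (a [^] n) {#}"
proof (induction n)
  case 0
  show ?case by (simp add: T_simps(3))
next
  case (Suc n)
  then show ?case by (simp add: mterm_mult)
qed

lemma empty_axis: "{#} \<in> axis k"
  unfolding mem_axis_iff by simp

lemma const_mem_J_iff: "a \<in> carrier K \<Longrightarrow> mterm a {#} \<in> J k \<longleftrightarrow> a = \<zero>"
proof -
  assume a: "a \<in> carrier K"
  have "mterm a {#} {#} = a" unfolding mterm_def by simp
  then show ?thesis using empty_axis[of k] mterm_closed[OF a, of "{#}"] unfolding J_def vanish_def
    by (auto simp: mterm_def)
qed

text \<open>Only the zero constant lies in \<open>I\<close>, so nilpotent constants of the quotient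
  are nilpotent in \<open>K\<close>. Conversely each \<open>J k\<close> is the kernel of a map onto
  a reduced polynomial ring, hence radical, and radicality passes to the intersection.\<close>

lemma reduced_Quot_iff:
  assumes S: "S \<noteq> {}"
  shows "reduced_ring (T Quot I) \<longleftrightarrow> reduced_ring K"
proof -
  note Q = T.Quot_ring_epi[OF I_ideal]
  obtain k where k: "k \<in> S" using S by blast
  interpret U: UP_cring K "UP K" by unfold_locales
  show ?thesis
    unfolding ring_epi.reduced_ring_iff[OF Q(1)] Q(2)
  proof
    assume rad: "\<forall>a\<in>carrier T. \<forall>n::nat. a [^]\<^bsub>T\<^esub> n \<in> I \<longrightarrow> a \<in> I"
    show "reduced_ring K"
      unfolding reduced_ring_def
    proof (intro conjI ballI allI impI is_cring)
      fix a and n :: nat assume a: "a \<in> carrier K" and "a [^] n = \<zero>"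
      then have "mterm a {#} [^]\<^bsub>T\<^esub> n \<in> J k" for k
        using const_mem_J_iff[of "\<zero>" k] a by (simp add: const_pow)
      then have "mterm a {#} [^]\<^bsub>T\<^esub> n \<in> I" unfolding I_eq_INT[OF S] by blast
      moreover have "mterm a {#} \<in> carrier T" using mterm_closed[OF a, of "{#}"] by simp
      ultimately have "mterm a {#} \<in> I" using rad by blast
      then have "mterm a {#} \<in> J k" using I_sub_J[OF k] by blast
      then show "a = \<zero>" using const_mem_J_iff[OF a] by simp
    qed
  next
    assume red: "reduced_ring K"
    show "\<forall>a\<in>carrier T. \<forall>n::nat. a [^]\<^bsub>T\<^esub> n \<in> I \<longrightarrow> a \<in> I"
    proof (intro ballI allI impI)
      fix g and n :: nat assume g: "g \<in> carrier T" and gn: "g [^]\<^bsub>T\<^esub> n \<in> I"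
      have "g \<in> J k" if k: "k \<in> S" for k
      proof -
        note iff = ring_epi.reduced_ring_iff[OF proj_epi[OF k], unfolded proj_ker[OF k]]
        have "g [^]\<^bsub>T\<^esub> n \<in> J k" using gn I_sub_J[OF k] by (rule subsetD[rotated])
        then show ?thesis using iffD1[OF iff U.reduced_UP[OF red], rule_format, OF g] by simp
      qed
      then show "g \<in> I" unfolding I_eq_INT[OF S] by blast
    qed
  qed
qed

lemma ind_mem_J_iff: "\<one> \<noteq> \<zero> \<Longrightarrow> i \<in> S \<Longrightarrow> ind i \<in> J k \<longleftrightarrow> i \<noteq> k"
proof -
  assume 1: "\<one> \<noteq> \<zero>" and i: "i \<in> S"
  have "ind i m = \<zero>" if "i \<noteq> k" "m \<in> axis k" for m
    using that unfolding mem_axis_iff ind_eq mterm_def by auto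
  moreover have "ind k {#k#} \<noteq> \<zero>" "{#k#} \<in> axis k" using 1 unfolding ind_eq mterm_def mem_axis_iff by auto
  ultimately show ?thesis using ind_closed[OF i] unfolding J_def vanish_def by blast
qed

lemma J_primeideal:
  assumes "domain K" "k \<in> S"
  shows "primeideal (J k) T"
proof -
  interpret p: ring_epi T "UP K" "proj k" by (rule proj_epi[OF assms(2)])
  interpret U: UP_domain K "UP K" by (intro UP_domain.intro assms(1))
  have "primeideal {g \<in> carrier T. proj k g \<in> {\<zero>\<^bsub>UP K\<^esub>}} T"
    by (rule p.vimage_primeideal[OF U.zeroprimeideal])
  moreover have "{g \<in> carrier T. proj k g \<in> {\<zero>\<^bsub>UP K\<^esub>}} = J k"
    using proj_ker[OF assms(2)] unfolding p.ker_def by simp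
  ultimately show ?thesis by simp
qed

lemma prime_contains_J:
  assumes S: "S \<noteq> {}" and P: "primeideal P T" "I \<subseteq> P"
  shows "\<exists>k\<in>S. J k \<subseteq> P"
proof -
  interpret P: primeideal P T by fact
  have J: "J k \<subseteq> P" if "\<And>i. i \<in> S \<Longrightarrow> i \<noteq> k \<Longrightarrow> ind i \<in> P" for k
    unfolding J_def genideal_others[symmetric]
    by (rule T.genideal_minimal[OF P.is_ideal]) (use that in blast)
  show ?thesis
  proof (cases "\<exists>k\<in>S. ind k \<notin> P")
    case True
    then obtain k where k: "k \<in> S" "ind k \<notin> P" by blast
    have "ind i \<in> P" if i: "i \<in> S" "i \<noteq> k" for i
    proof -
      let ?G = "{ind i \<otimes>\<^bsub>T\<^esub> ind k | i k. i \<in> S \<and> k \<in> S \<and> i \<noteq> k}"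
      have "?G \<subseteq> carrier T" using ind_closed by auto
      then have "?G \<subseteq> I" unfolding I_def genideal_pairs[OF S, symmetric] by (rule T.genideal_self)
      then have "ind i \<otimes>\<^bsub>T\<^esub> ind k \<in> P" using i k(1) P(2) by blast
      then show ?thesis using P.I_prime[OF ind_closed[OF i(1)] ind_closed[OF k(1)]] k(2) by blast
    qed
    then show ?thesis using J k(1) by blast
  next
    case False
    then show ?thesis using J S by blast
  qed
qed

text \<open>Over a domain the \<open>J k\<close> are prime, and pairwise incomparable because the
  variables tell them apart. For the converse one prime \<open>J k\<close> is enough: no nonzero
  constant lies in it, so \<open>K\<close> embeds into the quotient domain.\<close>

lemma domain_iff_minimal_primes:
  assumes S: "S \<noteq> {}"
  shows "domain K \<longleftrightarrow> minimal_primes T I = {J k | k. k \<in> S}"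
proof
  assume dom: "domain K"
  have one: "\<one> \<noteq> \<zero>" using domain.one_not_zero[OF dom] .
  have inj: "k = l" if "k \<in> S" "l \<in> S" "J k \<subseteq> J l" for k l
    using ind_mem_J_iff[OF one that(2), of k] ind_mem_J_iff[OF one that(2), of l] that(3) by blast
  have 1: "J k \<in> minimal_primes T I" if k: "k \<in> S" for k
    unfolding minimal_primes_def
  proof (intro CollectI conjI allI impI J_primeideal[OF dom k] I_sub_J[OF k])
    fix Q assume Q: "primeideal Q T \<and> I \<subseteq> Q \<and> Q \<subseteq> J k"
    then obtain l where l: "l \<in> S" "J l \<subseteq> Q" using prime_contains_J[OF S] by blast
    then have "l = k" using inj k Q by blast
    then show "Q = J k" using l Q by blast
  qed
  moreover have "\<exists>k\<in>S. P = J k" if P: "P \<in> minimal_primes T I" for P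
  proof -
    have P': "primeideal P T" "I \<subseteq> P" "\<And>Q. primeideal Q T \<Longrightarrow> I \<subseteq> Q \<Longrightarrow> Q \<subseteq> P \<Longrightarrow> Q = P"
      using P unfolding minimal_primes_def by blast+
    obtain k where k: "k \<in> S" "J k \<subseteq> P" using prime_contains_J[OF S P'(1,2)] by blast
    then have "J k = P" using P'(3)[OF J_primeideal[OF dom k(1)] I_sub_J[OF k(1)]] by blast
    then show ?thesis using k by blast
  qed
  ultimately show "minimal_primes T I = {J k | k. k \<in> S}" by blast
next
  assume min: "minimal_primes T I = {J k | k. k \<in> S}"
  obtain k where k: "k \<in> S" using S by blast
  then have "primeideal (J k) T" using min unfolding minimal_primes_def by blast
  then interpret J: primeideal "J k" T .
  show "domain K"
  proof
    show "\<one> \<noteq> \<zero>"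
    proof
      assume "\<one> = \<zero>"
      then have "mterm \<one> {#} \<in> J k" using const_mem_J_iff by simp
      then show False using J.one_notin by (simp add: T_simps(3))
    qed
    fix a b assume ab: "a \<otimes> b = \<zero>" "a \<in> carrier K" "b \<in> carrier K"
    have "mterm a {#} \<otimes>\<^bsub>T\<^esub> mterm b {#} \<in> J k"
      using ab const_mem_J_iff[of "\<zero>" k] by (simp add: mterm_mult)
    then have "mterm a {#} \<in> J k \<or> mterm b {#} \<in> J k"
      using J.I_prime mterm_closed[of a "{#}"] mterm_closed[of b "{#}"] ab(2,3) by simp
    then show "a = \<zero> \<or> b = \<zero>" using const_mem_J_iff ab(2,3) by blast
  qed
qed

lemma krull_dim_Quot:
  assumes S: "S \<noteq> {}"
  shows "krull_dim (T Quot I) = krull_dim (UP K)"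
proof -
  \<comment> \<open>The smallest member of the chain selects \<open>k\<close>, and all larger
    members then contain the same \<open>J k\<close>.\<close>
  have 1: "\<exists>k\<in>S. pchain T (J k) n P" if "pchain T I n P" for n P
    using that
  proof (induction n arbitrary: P)
    case 0
    then show ?case using prime_contains_J[OF S, of P] by simp
  next
    case (Suc n)
    then obtain Q where Q: "primeideal P T" "Q \<subset> P" "pchain T I n Q" by auto
    obtain k where "k \<in> S" "pchain T (J k) n Q" using Suc.IH[OF Q(3)] by blast
    then show ?case using Q unfolding pchain.simps by blast
  qed
  have "(\<exists>P. pchain (T Quot I) {} n P) \<longleftrightarrow> (\<exists>P. pchain (UP K) {} n P)" for n
  proof -
    note Q = T.Quot_ring_epi[OF I_ideal]
    have "(\<exists>P. pchain (T Quot I) {} n P) \<longleftrightarrow> (\<exists>P. pchain T I n P)"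
      using ring_epi.ex_pchain_iff[OF Q(1)] unfolding Q(2) .
    also have "\<dots> \<longleftrightarrow> (\<exists>k\<in>S. \<exists>P. pchain T (J k) n P)"
      using 1 pchain_smaller[OF _ I_sub_J] by blast
    also have "\<dots> \<longleftrightarrow> (\<exists>P. pchain (UP K) {} n P)"
      using ring_epi.ex_pchain_iff[OF proj_epi] proj_ker S by auto
    finally show ?thesis .
  qed
  then show ?thesis unfolding krull_dim_pchain by simp
qed

text \<open>Modulo \<open>J k\<close> one computes in \<open>K[x_k]\<close>, where a nonzero
  polynomial is a power of \<open>x_k\<close> times a factor \<open>u\<close> with nonzero constant
  term. The inclusion \<open>P \<subseteq> \<mm>\<close> keeps \<open>u\<close> out of
  \<open>P\<close>, so \<open>x_k\<close> itself lies in \<open>P\<close>.\<close>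

lemma primes_below_origin:
  assumes K: "field K" and S: "S \<noteq> {}" and P: "primeideal P T" "I \<subseteq> P" "P \<subseteq> \<mm>"
  shows "P = \<mm> \<or> (\<exists>k\<in>S. P = J k)"
proof (rule disjCI)
  interpret F: field K by fact
  interpret P: primeideal P T by fact
  assume no: "\<not> (\<exists>k\<in>S. P = J k)"
  obtain k where k: "k \<in> S" "J k \<subseteq> P" using prime_contains_J[OF S P(1,2)] by blast
  then obtain g where g: "g \<in> P" "g \<notin> J k" using no by blast
  have gT: "g \<in> carrier T" using P.Icarr g by blast
  have ex: "\<exists>n. g (replicate_mset n k) \<noteq> \<zero>" using g(2) gT unfolding J_def vanish_def axis_def by auto
  define n where "n = (LEAST n. g (replicate_mset n k) \<noteq> \<zero>)"
  have n: "g (replicate_mset n k) \<noteq> \<zero>" "\<And>i. i < n \<Longrightarrow> g (replicate_mset i k) = \<zero>"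
    unfolding n_def using LeastI_ex[OF ex] not_less_Least by blast+
  let ?r = "replicate_mset n k"
  \<comment> \<open>The shift divides by \<open>x_k^n\<close> and discards the terms that are not
    divisible by it. On the axis nothing is discarded, by the choice of \<open>n\<close>, so
    \<open>?d\<close> vanishes there; this is all that \<open>?d \<in> J k\<close> asks.\<close>
  define u where "u m = g (m + ?r)" for m
  have rS: "set_mset (replicate_mset i k) \<subseteq> S" for i using k(1) by simp
  have uT: "u \<in> carrier T"
  proof -
    have "(\<lambda>m. m + ?r) ` {m. u m \<noteq> \<zero>} \<subseteq> {m. g m \<noteq> \<zero>}" unfolding u_def by auto
    moreover have "finite {m. g m \<noteq> \<zero>}" using gT unfolding carrier_T by blast
    ultimately have "finite ((\<lambda>m. m + ?r) ` {m. u m \<noteq> \<zero>})" by (rule finite_subset)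
    then have "finite {m. u m \<noteq> \<zero>}" by (rule finite_imageD) (simp add: inj_on_def)
    moreover have "set_mset m \<subseteq> S" if "u m \<noteq> \<zero>" for m
    proof -
      have "set_mset (m + ?r) \<subseteq> S" using that gT unfolding u_def carrier_T by blast
      then show ?thesis by simp
    qed
    ultimately show ?thesis unfolding carrier_T using gT by (simp add: u_def)
  qed
  have xT: "mterm \<one> ?r \<in> carrier T" using mterm_closed rS by simp
  let ?d = "g \<ominus>\<^bsub>T\<^esub> mterm \<one> ?r \<otimes>\<^bsub>T\<^esub> u"
  have dT: "?d \<in> carrier T" using gT xT uT by simp
  have "?d \<in> J k"
  proof -
    have "?d m = \<zero>" if mk: "m \<in> axis k" for m
    proof -
      obtain i where i: "m = replicate_mset i k" using mk unfolding axis_def by blast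
      have xu: "(mterm \<one> ?r \<otimes>\<^bsub>T\<^esub> u) m = g m"
      proof (cases "n \<le> i")
        case True
        then have "?r \<subseteq># m" unfolding i count_le_replicate_mset_subset_eq[symmetric] by simp
        moreover from this have "u (m - ?r) = g m" unfolding u_def by simp
        ultimately show ?thesis unfolding mterm_mult_apply[OF one_closed uT] using gT by simp
      next
        case False
        then have "\<not> ?r \<subseteq># m" unfolding i using size_mset_mono[of ?r "replicate_mset i k"] by auto
        then show ?thesis unfolding mterm_mult_apply[OF one_closed uT] using n(2)[of i] False i by simp
      qed
      have "g = ?d \<oplus>\<^bsub>T\<^esub> mterm \<one> ?r \<otimes>\<^bsub>T\<^esub> u"
        using gT T.m_closed[OF xT uT] by algebra
      then have "g m = ?d m \<oplus> (mterm \<one> ?r \<otimes>\<^bsub>T\<^esub> u) m" by (metis T_simps(2))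
      then have "g m = ?d m \<oplus> g m" unfolding xu .
      then show "?d m = \<zero>" using T_coeff_closed[OF dT, of m] T_coeff_closed[OF gT, of m] by (metis add.r_cancel_one')
    qed
    then show ?thesis using dT unfolding J_def vanish_def by blast
  qed
  then have "?d \<in> P" using k(2) by blast
  then have "g \<ominus>\<^bsub>T\<^esub> ?d \<in> P" by (rule P.minus_mem[OF g(1)])
  moreover have eq: "g \<ominus>\<^bsub>T\<^esub> ?d = mterm \<one> ?r \<otimes>\<^bsub>T\<^esub> u" using gT T.m_closed[OF xT uT] by algebra
  ultimately have "mterm \<one> ?r \<otimes>\<^bsub>T\<^esub> u \<in> P" by (simp only: eq)
  moreover have "u {#} \<noteq> \<zero>" unfolding u_def using n(1) by simp
  then have "u \<notin> P" using P(3) unfolding \<mm>_def vanish_def by blast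
  ultimately have "mterm \<one> ?r \<in> P" using P.I_prime[OF xT uT] by blast
  moreover have "ind k \<in> P" if "mterm \<one> (replicate_mset i k) \<in> P" for i
    using that
  proof (induction i)
    case 0
    then show ?case using P.one_notin by (simp add: T_simps(3))
  next
    case (Suc i)
    have "ind k \<otimes>\<^bsub>T\<^esub> mterm \<one> (replicate_mset i k) = mterm \<one> (replicate_mset (Suc i) k)"
      unfolding ind_eq using rS[of i] by (subst mterm_mult) simp_all
    then show ?case using P.I_prime[OF ind_closed[OF k(1)] mterm_closed[OF one_closed rS]] Suc by metis
  qed
  ultimately have indk: "ind k \<in> P" by blast
  have "ind i \<in> P" if "i \<in> S" for i
    using indk k(2) ind_mem_J_iff[OF F.one_not_zero that, of k] by (cases "i = k") auto
  then have "\<mm> \<subseteq> P" unfolding \<mm>_def genideal_all[symmetric]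
    by (intro T.genideal_minimal[OF P.is_ideal]) blast
  then show "P = \<mm>" using P(3) by blast
qed

lemma origin_primeideal:
  assumes "domain K"
  shows "primeideal \<mm> T"
proof (rule primeidealI[OF _ T.is_cring])
  interpret D: "domain" K by fact
  show "ideal \<mm> T" unfolding \<mm>_def by (rule vanish_ideal) auto
  have "mterm \<one> {#} \<notin> \<mm>" unfolding \<mm>_def vanish_def mterm_def by simp
  then show "carrier T \<noteq> \<mm>" using mterm_closed[of \<one> "{#}"] by auto
  fix f g assume fg: "f \<in> carrier T" "g \<in> carrier T" "f \<otimes>\<^bsub>T\<^esub> g \<in> \<mm>"
  have "{k. k \<subseteq># {#}} = {{#} :: 'i multiset}" by auto
  then have "(f \<otimes>\<^bsub>T\<^esub> g) {#} = f {#} \<otimes> g {#}" unfolding T_simps using fg(1,2) by simp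
  then have "f {#} \<otimes> g {#} = \<zero>" using fg(3) unfolding \<mm>_def vanish_def by simp
  then show "f \<in> \<mm> \<or> g \<in> \<mm>" using fg(1,2) D.integral unfolding \<mm>_def vanish_def by auto
qed

lemma J_sub_origin: "J k \<subseteq> \<mm>"
  unfolding J_def \<mm>_def vanish_def using empty_axis by auto

lemma ind_mem_origin: "i \<in> S \<Longrightarrow> ind i \<in> \<mm>"
  using ind_closed unfolding \<mm>_def vanish_def ind_eq mterm_def by auto

lemma localization_at_origin:
  assumes K: "field K" and S: "infinite S"
  defines "R \<equiv> localization_at (T Quot I) (quot_ideal T I \<mm>)"
  shows "reduced_ring R \<and> local_ring R \<and> pz_ring R \<and> krull_dim R = 1 \<and> infinite (minimal_primes R {\<zero>\<^bsub>R\<^esub>})"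
proof -
  interpret F: field K by fact
  have S0: "S \<noteq> {}" using S by auto
  define A where "A = T Quot I"
  define h where "h = (+>\<^bsub>T\<^esub>) I"
  note Q = T.Quot_ring_epi[OF I_ideal, folded A_def h_def]
  interpret h: ring_epi T A h by (rule Q(1))
  have ker: "h.ker = I" by (rule Q(2))
  have Im: "I \<subseteq> \<mm>" using S0 I_sub_J J_sub_origin by blast
  have mp: "primeideal \<mm> T" by (rule origin_primeideal[OF F.domain_axioms])
  have img: "primeideal (h ` P) A" if "primeideal P T" "I \<subseteq> P" for P
    using h.image_primeideal[OF that(1)] that(2) ker by simp
  have img_mem: "h a \<in> h ` P \<longleftrightarrow> a \<in> P" if "primeideal P T" "I \<subseteq> P" "a \<in> carrier T" for P a
    using h.image_mem_iff[OF primeideal.axioms(1)[OF that(1)] _ that(3)] that(2) ker by simp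
  define N where "N = h ` \<mm>"
  have N: "primeideal N A" unfolding N_def by (rule img[OF mp Im])
  define M where "M = carrier A - N"
  have R: "R = localization A M"
    unfolding R_def localization_at_def M_def A_def N_def quot_ideal_def h_def ..
  interpret l: localize A M unfolding M_def by (rule primeideal.localize_complement[OF N])
  have red: "reduced_ring R"
    unfolding R by (rule l.reduced_localization) (use reduced_Quot_iff[OF S0] F.domain_reduced in \<open>simp add: A_def\<close>)
  have loc: "local_ring R"
    using primeideal.local_localization_at[OF N] unfolding R_def A_def N_def quot_ideal_def h_def .
  define W where "W P = l.loc_ideal (h ` P)" for P
  have dis: "h ` P \<inter> M = {}" if "P \<subseteq> \<mm>" for P
    using that unfolding M_def N_def by blast
  have J: "primeideal (J k) T" "I \<subseteq> J k" "J k \<subseteq> \<mm>" if "k \<in> S" for k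
    using J_primeideal[OF F.domain_axioms that] I_sub_J[OF that] J_sub_origin by blast+
  \<comment> \<open>Two correspondences are composed: primes of the localization are primes of
    \<open>A\<close> inside \<open>N\<close>, and these are primes of \<open>T\<close> between
    \<open>I\<close> and \<mm>.\<close>
  have primes: "primeideal V R \<longleftrightarrow> V = W \<mm> \<or> (\<exists>k\<in>S. V = W (J k))" for V
  proof
    assume "primeideal V R"
    then obtain P' where P': "primeideal P' A" "P' \<inter> M = {}" "V = l.loc_ideal P'"
      unfolding R using l.primeideal_L_cases by blast
    define P where "P = {a \<in> carrier T. h a \<in> P'}"
    have PP: "primeideal P T" unfolding P_def by (rule h.vimage_primeideal[OF P'(1)])
    have P'c: "P' \<subseteq> carrier A" using ideal.Icarr[OF primeideal.axioms(1)[OF P'(1)]] by blast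
    have IP: "I \<subseteq> P" using h.ker_sub_vimage[OF primeideal.axioms(1)[OF P'(1)]] unfolding ker P_def .
    have hP: "h ` P = P'" unfolding P_def by (rule h.image_vimage[OF P'c])
    have "P \<subseteq> \<mm>"
    proof
      fix a assume a: "a \<in> P"
      then have "h a \<in> N" "a \<in> carrier T" using P'(2) P'c unfolding P_def M_def by auto
      then show "a \<in> \<mm>" unfolding N_def using img_mem[OF mp Im] by blast
    qed
    then show "V = W \<mm> \<or> (\<exists>k\<in>S. V = W (J k))"
      using primes_below_origin[OF K S0 PP IP] unfolding W_def P'(3) hP[symmetric] by blast
  next
    have 1: "primeideal (W P) R" if "primeideal P T" "I \<subseteq> P" "P \<subseteq> \<mm>" for P
      unfolding W_def R by (rule l.loc_ideal_primeideal[OF img[OF that(1,2)] dis[OF that(3)]])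
    assume "V = W \<mm> \<or> (\<exists>k\<in>S. V = W (J k))"
    then show "primeideal V R" using 1[OF mp Im order_refl] 1[OF J] by blast
  qed
  \<comment> \<open>The variables separate the primes: \<open>x_k\<close> lies in \<open>J l\<close>
    exactly when \<open>l\<close> differs from \<open>k\<close>.\<close>
  define y where "y k = l.fraction (h (ind k)) \<one>\<^bsub>A\<^esub>" for k
  have ymem: "y k \<in> W P \<longleftrightarrow> ind k \<in> P" if "primeideal P T" "I \<subseteq> P" "P \<subseteq> \<mm>" "k \<in> S" for P k
    unfolding y_def W_def
    using l.fraction_mem_loc_ideal_iff[OF img[OF that(1,2)] dis[OF that(3)], of "h (ind k)" "\<one>\<^bsub>A\<^esub>"]
      img_mem[OF that(1,2) ind_closed[OF that(4)]] ind_closed[OF that(4)] by simp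
  have W_mono: "W P \<subseteq> W P'" if "P \<subseteq> P'" for P P'
    unfolding W_def l.loc_ideal_def using that by blast
  have Rc: "cring R" unfolding R by (rule l.L_cring)
  have "y k \<in> W \<mm>" if "k \<in> S" for k
    using ymem[OF mp Im order_refl that] ind_mem_origin[OF that] by simp
  moreover have "y k \<in> W (J l) \<longleftrightarrow> k \<noteq> l" if "k \<in> S" "l \<in> S" for k l
    using ymem[OF J[OF that(2)] that(1)] ind_mem_J_iff[OF F.one_not_zero that(1)] by simp
  moreover have "W (J k) \<subseteq> W \<mm>" if "k \<in> S" for k using W_mono[OF J(3)[OF that]] .
  ultimately show ?thesis
    using star_spectrum[OF Rc S, of "W \<mm>" "\<lambda>k. W (J k)" y] primes red loc by simp
qed

end

theorem theorem3p13:
  fixes K :: "('a, 'm) ring_scheme" and S :: "'i set"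
  fixes x :: "'i \<Rightarrow> ('i multiset \<Rightarrow> 'a)" and T :: "('i multiset \<Rightarrow> 'a) ring"
    and I :: "('i multiset \<Rightarrow> 'a) set" and J :: "'i \<Rightarrow> ('i multiset \<Rightarrow> 'a) set"
    and \<mm> :: "('i multiset \<Rightarrow> 'a) set" and R :: "(('i multiset \<Rightarrow> 'a) set \<times> ('i multiset \<Rightarrow> 'a) set) set ring"
  assumes K: "cring K" and S: "S \<noteq> {}"
  defines "x \<equiv> ring.indexed_var K"
    and "T \<equiv> mpoly_ring K S"
    and "I \<equiv> Idl\<^bsub>T\<^esub> {x i \<otimes>\<^bsub>T\<^esub> x k | i k. i \<in> S \<and> k \<in> S \<and> i \<noteq> k}"
    and "J \<equiv> (\<lambda>k. Idl\<^bsub>T\<^esub> {x i | i. i \<in> S \<and> i \<noteq> k})"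
    and "\<mm> \<equiv> Idl\<^bsub>T\<^esub> {x i | i. i \<in> S}"
    and "R \<equiv> localization_at (T Quot I) (quot_ideal T I \<mm>)"
  shows "(I = (\<Inter>k\<in>S. J k) \<and> (reduced_ring K \<longleftrightarrow> reduced_ring (T Quot I))) \<and>
    (domain K \<longleftrightarrow> minimal_primes T I = {J k | k. k \<in> S}) \<and>
    (noetherian_ring K \<and> domain K \<longrightarrow> krull_dim (T Quot I) = krull_dim K + 1) \<and>
    (infinite S \<and> field K \<longrightarrow>
       reduced_ring R \<and> local_ring R \<and> pz_ring R \<and> krull_dim R = 1 \<and>
       infinite (minimal_primes R {\<zero>\<^bsub>R\<^esub>}))"
proof -
  interpret m: mpoly_cring K S T
    by (intro mpoly_cring.intro K) (simp add: T_def)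
  interpret U: UP_cring K "UP K" by (intro UP_cring.intro K)
  have I: "I = m.I" unfolding I_def x_def m.I_def by (rule m.genideal_pairs[OF S])
  have J: "J k = m.J k" for k unfolding J_def x_def m.J_def by (rule m.genideal_others)
  have \<mm>: "\<mm> = m.\<mm>" unfolding \<mm>_def x_def m.\<mm>_def by (rule m.genideal_all)
  have "krull_dim (T Quot m.I) = krull_dim K + 1" if "noetherian_ring K" "domain K"
    using m.krull_dim_Quot[OF S] U.krull_dim_UP[OF that] by simp
  then show ?thesis
    unfolding R_def I J \<mm>
    using m.I_eq_INT[OF S] m.reduced_Quot_iff[OF S] m.domain_iff_minimal_primes[OF S] m.localization_at_origin
    by blast
qed

end
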